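(* Let $G$ be a finite group, let $p$ be a prime dividing the order of $G$ with $\gcd(|G|, p-1) = 1$, and let $N$ be a normal subgroup of $G$ such that $G/N$ is $p$-nilpotent. Let $P$ be a Sylow $p$-subgroup of $N$, and suppose that every maximal subgroup of $P$ satisfies the partial $\Pi$-property in $N_{G}(P)$ and that the derived subgroup $P'$ of $P$ satisfies the partial $\Pi$-property in $G$. Then $G$ is $p$-nilpotent.
   Context: All groups are finite. For a set $\pi$ of primes, a positive integer is a $\pi$-number if all its prime divisors belong to $\pi$ (so $1$ is always a $\pi$-number, and is the only one when $\pi$ is empty). For a finite group $X$, $\pi(X)$ denotes the set of primes dividing $|X|$. Partial $\Pi$-property: a subgroup $H$ of a finite group $G$ satisfies the partial $\Pi$-property in $G$ if there exists a chief series $1 = G_{0} < G_{1} < \cdots < G_{n} = G$ of $G$ such that for every $i$ with $1 \leq i \leq n$, the index $|G/G_{i-1} : N_{G/G_{i-1}}(HG_{i-1}/G_{i-1} \cap G_{i}/G_{i-1})|$ is a $\pi(HG_{i-1}/G_{i-1} \cap G_{i}/G_{i-1})$-number. *)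

theory Defs
  imports "HOL-Algebra.Algebra" "HOL-Computational_Algebra.Primes"
begin

text \<open>All definitions are meant for finite groups. A subgroup \<open>H\<close> of \<open>G\<close>, regarded as a group in its
  own right, is \<open>G\<lparr>carrier := H\<rparr>\<close>. \<open>prime\<close> on numbers has to be qualified because HOL-Algebra's
  \<open>Divisibility\<close> reuses the name.\<close>

definition pi_number :: "nat set \<Rightarrow> nat \<Rightarrow> bool"
  where "pi_number \<pi> m \<longleftrightarrow> 0 < m \<and> (\<forall>q. Factorial_Ring.prime q \<and> q dvd m \<longrightarrow> q \<in> \<pi>)"

definition group_primes :: "('a, 'b) monoid_scheme \<Rightarrow> nat set"
  where "group_primes G = {q. Factorial_Ring.prime q \<and> q dvd Coset.order G}"

definition subgroup_index :: "('a, 'b) monoid_scheme \<Rightarrow> 'a set \<Rightarrow> nat"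
  where "subgroup_index G H = card (rcosets\<^bsub>G\<^esub> H)"

definition maximal_subgroup :: "'a set \<Rightarrow> ('a, 'b) monoid_scheme \<Rightarrow> bool"
  where "maximal_subgroup M G \<longleftrightarrow>
    subgroup M G \<and> M \<noteq> carrier G \<and> \<not> (\<exists>L. subgroup L G \<and> M \<subset> L \<and> L \<subset> carrier G)"

definition sylow_subgroup :: "nat \<Rightarrow> 'a set \<Rightarrow> ('a, 'b) monoid_scheme \<Rightarrow> bool"
  where "sylow_subgroup p P G \<longleftrightarrow> subgroup P G \<and> card P = p ^ multiplicity p (Coset.order G)"

text \<open>A group is \<open>p\<close>-nilpotent if it has a normal \<open>p\<close>-complement, that is, a normal subgroup of order
  prime to \<open>p\<close> whose quotient is a \<open>p\<close>-group.\<close>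

definition p_nilpotent :: "nat \<Rightarrow> ('a, 'b) monoid_scheme \<Rightarrow> bool"
  where "p_nilpotent p G \<longleftrightarrow>
    (\<exists>K. K \<lhd> G \<and> \<not> p dvd card K \<and> (\<exists>k. Coset.order (G Mod K) = p ^ k))"

text \<open>The terms of the series are \<open>C 0, \<dots>, C n\<close>; values of \<open>C\<close> beyond \<open>n\<close> are irrelevant. The trivial
  group has the chief series of length \<open>0\<close>.\<close>

definition chief_series :: "('a, 'b) monoid_scheme \<Rightarrow> nat \<Rightarrow> (nat \<Rightarrow> 'a set) \<Rightarrow> bool"
  where "chief_series G n C \<longleftrightarrow>
    C 0 = {\<one>\<^bsub>G\<^esub>} \<and> C n = carrier G \<and> (\<forall>i\<le>n. C i \<lhd> G) \<and>
    (\<forall>i\<in>{1..n}. C (i - 1) \<subset> C i \<and>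
      \<not> (\<exists>L. L \<lhd> G \<and> C (i - 1) \<subset> L \<and> L \<subset> C i))"

text \<open>For \<open>K \<lhd> G\<close> and a subgroup \<open>A\<close> containing \<open>K\<close>, the carrier of \<open>G\<lparr>carrier := A\<rparr> Mod K\<close> is the
  subgroup \<open>A/K\<close> of \<open>G Mod K\<close>; with \<open>A = H <#> K\<close> this is \<open>HK/K\<close>.\<close>

definition partial_Pi_property :: "'a set \<Rightarrow> ('a, 'b) monoid_scheme \<Rightarrow> bool"
  where "partial_Pi_property H G \<longleftrightarrow> subgroup H G \<and>
    (\<exists>n C. chief_series G n C \<and>
      (\<forall>i\<in>{1..n}.
        let K = C (i - 1);
            Q = G Mod K;
            S = carrier (G\<lparr>carrier := H <#>\<^bsub>G\<^esub> K\<rparr> Mod K) \<inter> carrier (G\<lparr>carrier := C i\<rparr> Mod K)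
        in pi_number (group_primes (Q\<lparr>carrier := S\<rparr>)) (subgroup_index Q (normalizer Q S))))"

end

(*
The subgroup N may be replaced by the preimage K of the normal p-complement of G/N, a normal
subgroup of p-power index that still has P as a Sylow p-subgroup.

(1) N(P) is p-nilpotent. Otherwise choose E normal in N(P), maximal in P such that N(P)/E is not
p-nilpotent. As p-nilpotency of quotients is inherited by intersections, there is a least normal
subgroup R of N(P) with E < R <= P. If R lies in every maximal subgroup of P above E, a
Schur-Zassenhaus complement gives a contradiction. If not, take U invariant under a Sylow
p-subgroup with |R : U| = p and a maximal subgroup M of P with M meeting R in U. The
partial Pi-property of M makes U normal, so U = E, R/E has order p, and gcd(|G|, p-1) = 1 makes it
central, a contradiction again. Hence N_K(P) = P C_K(P).

(2) A chief factor G_i/G_{i-1} is covered or avoided by P', and K/(K meet G_i) is p-nilpotent by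
downward induction. If the factor is covered, it consists of non-generators of P, and the argument of
(1) applies. If it is avoided, its intersection with the image of P is central there, hence not fused
by (1), and the transfer into it has a normal p-complement as kernel. So K, and with it G, is
p-nilpotent.
*)
theory Submission
  imports Defs "HOL-Number_Theory.Residues"
begin

section \<open>Conjugation and invariant subgroups\<close>

text \<open>Both steps get normality from one observation: a set normalised by a subgroup of index
  prime to p and by one of p-power index is normalised by the whole group. For a p-subgroup H the
  partial Pi-property supplies the second, since the sections of H G_{i-1} meet G_i over G_{i-1} are
  p-groups. The first is, in (1), a Sylow p-subgroup, for the sake of which U is chosen invariant,
  and in (2) N(P), by the Frattini argument. In (2) the section over G_{i-1} thus becomes normal
  and, the factor being chief, is trivial or everything. The obstacle in (1) is that the chief
  series belonging to M is unrelated to E and R. The remedy is the first term G_i whose intersection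
  with P leaves E: R lies below (P meet G_i)E because R is least and not merely minimal. The
  p-nilpotency of a quotient is expressed through exponents of elements, so that it passes to
  intersections, quotients and preimages without counting. Schur-Zassenhaus and transfer both come
  from comparing two systems of coset representatives of an abelian subgroup.\<close>

definition conj_by :: "('a, 'b) monoid_scheme \<Rightarrow> 'a \<Rightarrow> 'a \<Rightarrow> 'a"
  where "conj_by G g x = g \<otimes>\<^bsub>G\<^esub> x \<otimes>\<^bsub>G\<^esub> inv\<^bsub>G\<^esub> g"

text \<open>Inclusion is enough because conjugation is injective and the groups are finite
  (\<open>cj_image_eq\<close>). With arbitrary sets \<open>S\<close> and \<open>A\<close>,
  normality, invariance under a Sylow subgroup and containment in a normalizer are all
  instances.\<close>

definition invar :: "('a, 'b) monoid_scheme \<Rightarrow> 'a set \<Rightarrow> 'a set \<Rightarrow> bool"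
  where "invar G S A \<longleftrightarrow> (\<forall>s\<in>S. \<forall>a\<in>A. conj_by G s a \<in> A)"

lemma invarD: "invar G S A \<Longrightarrow> s \<in> S \<Longrightarrow> a \<in> A \<Longrightarrow> conj_by G s a \<in> A"
  by (simp add: invar_def)

lemma invarI: "(\<And>s a. s \<in> S \<Longrightarrow> a \<in> A \<Longrightarrow> conj_by G s a \<in> A) \<Longrightarrow> invar G S A"
  by (simp add: invar_def)

lemma invar_mono: "invar G S A \<Longrightarrow> T \<subseteq> S \<Longrightarrow> invar G T A"
  by (auto simp: invar_def)

lemma invar_Int: "invar G S A \<Longrightarrow> invar G S B \<Longrightarrow> invar G S (A \<inter> B)"
  by (auto simp: invar_def)

section \<open>Conjugation and products of subgroups in an arbitrary group\<close>

context group
begin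

abbreviation cj :: "'a \<Rightarrow> 'a \<Rightarrow> 'a"
  where "cj \<equiv> conj_by G"

lemma inv_mult_cancel_left [simp]:
  "x \<in> carrier G \<Longrightarrow> y \<in> carrier G \<Longrightarrow> inv x \<otimes> (x \<otimes> y) = y"
  "x \<in> carrier G \<Longrightarrow> y \<in> carrier G \<Longrightarrow> x \<otimes> (inv x \<otimes> y) = y"
  by (simp_all add: m_assoc [symmetric])

lemma inv_mult_cancel_right [simp]:
  "x \<in> carrier G \<Longrightarrow> y \<in> carrier G \<Longrightarrow> y \<otimes> inv x \<otimes> x = y"
  "x \<in> carrier G \<Longrightarrow> y \<in> carrier G \<Longrightarrow> y \<otimes> x \<otimes> inv x = y"
  by (simp_all add: m_assoc)

lemma cj_closed [simp]: "g \<in> carrier G \<Longrightarrow> x \<in> carrier G \<Longrightarrow> cj g x \<in> carrier G"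
  by (simp add: conj_by_def)

lemma cj_mult:
  "g \<in> carrier G \<Longrightarrow> x \<in> carrier G \<Longrightarrow> y \<in> carrier G \<Longrightarrow> cj g (x \<otimes> y) = cj g x \<otimes> cj g y"
  by (simp add: conj_by_def m_assoc)

lemma cj_cj:
  "g \<in> carrier G \<Longrightarrow> h \<in> carrier G \<Longrightarrow> x \<in> carrier G \<Longrightarrow> cj g (cj h x) = cj (g \<otimes> h) x"
  by (simp add: conj_by_def m_assoc inv_mult_group)

lemma cj_one [simp]: "g \<in> carrier G \<Longrightarrow> cj g \<one> = \<one>" "x \<in> carrier G \<Longrightarrow> cj \<one> x = x"
  by (simp_all add: conj_by_def)

lemma cj_inv: "g \<in> carrier G \<Longrightarrow> x \<in> carrier G \<Longrightarrow> cj g (inv x) = inv (cj g x)"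
  by (simp add: conj_by_def m_assoc inv_mult_group)

lemma cj_pow: "g \<in> carrier G \<Longrightarrow> x \<in> carrier G \<Longrightarrow> cj g (x [^] (n::nat)) = cj g x [^] n"
  by (induction n) (simp_all add: cj_mult)

lemma cj_cancel [simp]:
  "g \<in> carrier G \<Longrightarrow> x \<in> carrier G \<Longrightarrow> cj (inv g) (cj g x) = x"
  "g \<in> carrier G \<Longrightarrow> x \<in> carrier G \<Longrightarrow> cj g (cj (inv g) x) = x"
  by (simp_all add: cj_cj)

lemma cj_eq_iff:
  "g \<in> carrier G \<Longrightarrow> x \<in> carrier G \<Longrightarrow> y \<in> carrier G \<Longrightarrow> cj g x = cj g y \<longleftrightarrow> x = y"
  by (metis cj_cancel(1))

lemma cj_fixed_iff:
  "g \<in> carrier G \<Longrightarrow> x \<in> carrier G \<Longrightarrow> cj g x = x \<longleftrightarrow> g \<otimes> x = x \<otimes> g"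
  by (metis conj_by_def inv_mult_cancel_right m_closed)

lemma cj_subgroup: "subgroup H G \<Longrightarrow> g \<in> H \<Longrightarrow> x \<in> H \<Longrightarrow> cj g x \<in> H"
  by (simp add: conj_by_def subgroup.m_closed subgroup.m_inv_closed)

lemma invar_self: "subgroup H G \<Longrightarrow> invar G H H"
  by (simp add: invar_def cj_subgroup)

lemma normal_iff_invar: "N \<lhd> G \<longleftrightarrow> subgroup N G \<and> invar G (carrier G) N"
  by (simp add: normal_inv_iff invar_def conj_by_def)

lemma normal_cj: "N \<lhd> G \<Longrightarrow> g \<in> carrier G \<Longrightarrow> x \<in> N \<Longrightarrow> cj g x \<in> N"
  by (simp add: normal_inv_iff conj_by_def)

lemma normal_invar: "N \<lhd> G \<Longrightarrow> S \<subseteq> carrier G \<Longrightarrow> invar G S N"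
  by (auto simp: normal_iff_invar invar_def)

lemma subgroup_pow: "subgroup H G \<Longrightarrow> x \<in> H \<Longrightarrow> x [^] (n::nat) \<in> H"
  by (induction n) (auto simp: subgroup.one_closed subgroup.m_closed)

lemma subgroup_carrier: "subgroup H G \<Longrightarrow> x \<in> H \<Longrightarrow> x \<in> carrier G"
  by (rule subgroup.mem_carrier)

lemma subgroup_cancel_left:
  assumes "subgroup H G" "x \<in> H" "y \<in> carrier G" shows "x \<otimes> y \<in> H \<longleftrightarrow> y \<in> H"
  by (metis assms inv_mult_cancel_left(1) subgroup.m_closed subgroup.m_inv_closed subgroup_carrier)

lemma subgroup_cancel_right:
  assumes "subgroup H G" "x \<in> H" "y \<in> carrier G" shows "y \<otimes> x \<in> H \<longleftrightarrow> y \<in> H"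
  by (metis assms inv_mult_cancel_right(2) subgroup.m_closed subgroup.m_inv_closed subgroup_carrier)

lemma subgroup_inv_iff:
  assumes "subgroup H G" "x \<in> carrier G" shows "inv x \<in> H \<longleftrightarrow> x \<in> H"
  by (metis assms inv_inv subgroup.m_inv_closed)

text \<open>By Bezout, a m + b n = 1 gives x = (x^m)^a (x^n)^b. This is the basic means of passing
  from exponents to membership in a subgroup.\<close>

lemma coprime_pow_mem:
  assumes H: "subgroup H G" and x: "x \<in> carrier G" and m: "x [^] (m::nat) \<in> H"
    and n: "x [^] (n::nat) \<in> H" and mn: "coprime m n"
  shows "x \<in> H"
proof -
  have "gcd (int m) (int n) = 1" using mn by (simp add: gcd_int_int_eq)
  then have "\<exists>a b. a * int m + b * int n = 1" using bezout_int [of "int m" "int n"] by simp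
  then obtain a b :: int where ab: "a * int m + b * int n = 1" by blast
  have int: "y [^] (i::int) \<in> H" if "y \<in> H" for y i
    using subgroup_pow [OF H that, of "nat i"]
      subgroup.m_inv_closed [OF H subgroup_pow [OF H that, of "nat (- i)"]]
    unfolding int_pow_def2 by (cases "i < 0") (simp_all only: if_True if_False)
  have "int m * a + int n * b = 1" using ab by (simp only: mult.commute)
  then have "x = x [^] (int m * a + int n * b)" using x by simp
  also have "\<dots> = x [^] (int m * a) \<otimes> x [^] (int n * b)"
    using x by (rule int_pow_mult)
  also have "x [^] (int m * a) = (x [^] m) [^] a" using x by (metis int_pow_pow int_pow_int)
  also have "x [^] (int n * b) = (x [^] n) [^] b" using x by (metis int_pow_pow int_pow_int)
  finally show ?thesis
    using int [OF m] int [OF n] H by (metis subgroup.m_closed)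
qed

lemma pow_dvd_mem:
  assumes "subgroup H G" "x \<in> carrier G" "x [^] (m::nat) \<in> H" "m dvd n"
  shows "x [^] n \<in> H"
proof -
  from \<open>m dvd n\<close> obtain k where "n = m * k" by blast
  then have "x [^] n = (x [^] m) [^] k" using assms(2) by (simp add: nat_pow_pow)
  then show ?thesis using assms by (simp add: subgroup_pow)
qed

text \<open>In a b a' b' the factor b moves past a' at the cost of conjugating a' by b, which stays
  in \<open>A\<close>.\<close>

lemma subgroup_set_mult_invar:
  assumes A: "subgroup A G" and B: "subgroup B G" and inv: "invar G B A"
  shows "subgroup (A <#> B) G"
proof (rule subgroupI)
  have AB: "A \<subseteq> carrier G" "B \<subseteq> carrier G" using A B by (simp_all add: subgroup.subset)
  show "A <#> B \<subseteq> carrier G" using AB by (rule setmult_subset_G)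
  show "A <#> B \<noteq> {}" using A B unfolding set_mult_def by (auto dest: subgroup.one_closed)
next
  fix x assume "x \<in> A <#> B"
  then obtain a b where ab: "a \<in> A" "b \<in> B" "x = a \<otimes> b" unfolding set_mult_def by auto
  have c: "a \<in> carrier G" "b \<in> carrier G" using ab A B by (auto dest: subgroup_carrier)
  have "inv x = cj (inv b) (inv a) \<otimes> inv b"
    using c ab by (simp add: conj_by_def inv_mult_group)
  moreover have "cj (inv b) (inv a) \<in> A" "inv b \<in> B"
    using ab A B inv by (auto intro!: invarD [OF inv] subgroup.m_inv_closed)
  ultimately show "inv x \<in> A <#> B" unfolding set_mult_def by auto
next
  fix x y assume "x \<in> A <#> B" "y \<in> A <#> B"
  then obtain a b a' b' where ab: "a \<in> A" "b \<in> B" "x = a \<otimes> b" "a' \<in> A" "b' \<in> B" "y = a' \<otimes> b'"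
    unfolding set_mult_def by auto
  have c: "a \<in> carrier G" "b \<in> carrier G" "a' \<in> carrier G" "b' \<in> carrier G"
    using ab A B by (auto dest: subgroup_carrier)
  have "x \<otimes> y = (a \<otimes> cj b a') \<otimes> (b \<otimes> b')"
    using c ab by (simp add: conj_by_def m_assoc)
  moreover have "a \<otimes> cj b a' \<in> A" "b \<otimes> b' \<in> B"
    using ab A B inv by (auto intro!: invarD [OF inv] subgroup.m_closed)
  ultimately show "x \<otimes> y \<in> A <#> B" unfolding set_mult_def by auto
qed

lemma set_multI: "a \<in> A \<Longrightarrow> b \<in> B \<Longrightarrow> a \<otimes> b \<in> A <#> B"
  unfolding set_mult_def by auto

lemma set_multE:
  assumes "x \<in> A <#> B" obtains a b where "a \<in> A" "b \<in> B" "x = a \<otimes> b"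
  using assms unfolding set_mult_def by auto

lemma subset_set_mult_left: "A \<subseteq> carrier G \<Longrightarrow> subgroup B G \<Longrightarrow> A \<subseteq> A <#> B"
  using set_multI [OF _ subgroup.one_closed] by fastforce

lemma subset_set_mult_right: "subgroup A G \<Longrightarrow> B \<subseteq> carrier G \<Longrightarrow> B \<subseteq> A <#> B"
  using set_multI [OF subgroup.one_closed] by fastforce

lemma set_mult_subset: "subgroup H G \<Longrightarrow> A \<subseteq> H \<Longrightarrow> B \<subseteq> H \<Longrightarrow> A <#> B \<subseteq> H"
  by (auto elim!: set_multE intro: subgroup.m_closed)

lemma invar_set_mult:
  assumes "invar G S A" "invar G S B" "A \<subseteq> carrier G" "B \<subseteq> carrier G" "S \<subseteq> carrier G"
  shows "invar G S (A <#> B)"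
proof (rule invarI)
  fix s x assume s: "s \<in> S" and "x \<in> A <#> B"
  then obtain a b where ab: "a \<in> A" "b \<in> B" "x = a \<otimes> b" by (auto elim: set_multE)
  then have "cj s x = cj s a \<otimes> cj s b"
    using s assms(3-5) by (subst cj_mult [symmetric]) auto
  then show "cj s x \<in> A <#> B" using ab s assms(1,2) by (simp add: invarD set_multI)
qed

lemma normal_set_mult:
  assumes "A \<lhd> G" "B \<lhd> G" shows "A <#> B \<lhd> G"
  using assms unfolding normal_iff_invar
  by (auto intro!: subgroup_set_mult_invar invar_set_mult
      intro: invar_mono subgroup.subset dest: subgroup_carrier)

text \<open>Dedekind's law: if a e lies in \<open>M\<close> and e in \<open>E\<close>, a subset of
  \<open>M\<close>, then a lies in \<open>M\<close>.\<close>

lemma set_mult_Int_modular: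
  assumes E: "subgroup E G" "E \<subseteq> M" and M: "subgroup M G" and A: "A \<subseteq> carrier G"
  shows "M \<inter> (A <#> E) = (M \<inter> A) <#> E"
proof
  show "M \<inter> (A <#> E) \<subseteq> (M \<inter> A) <#> E"
  proof
    fix x assume x: "x \<in> M \<inter> (A <#> E)"
    then obtain a e where ae: "a \<in> A" "e \<in> E" "x = a \<otimes> e" by (auto elim: set_multE)
    then have "a \<in> M" using x E A M subgroup_cancel_right [OF M, of e a] by auto
    then show "x \<in> (M \<inter> A) <#> E" using ae by (auto intro: set_multI)
  qed
  show "(M \<inter> A) <#> E \<subseteq> M \<inter> (A <#> E)"
    using E M by (auto elim!: set_multE intro: set_multI subgroup.m_closed)
qed

end

section \<open>Finite groups: restriction to subgroups, normalizers\<close>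

locale finite_group = group +
  assumes finite_carrier: "finite (carrier G)"
begin

lemma finite_subgroup: "subgroup H G \<Longrightarrow> finite H"
  using finite_carrier finite_subset subgroup.subset by blast

lemma finite_subset_carrier: "H \<subseteq> carrier G \<Longrightarrow> finite H"
  using finite_carrier finite_subset by blast

lemma card_subgroup_pos: "subgroup H G \<Longrightarrow> 0 < card H"
  using finite_subgroup subgroup.one_closed card_gt_0_iff by blast

lemma finite_group_subgroup:
  assumes "subgroup H G" shows "finite_group (G\<lparr>carrier := H\<rparr>)"
  using assms by (simp add: finite_group_def finite_group_axioms_def subgroup_imp_group finite_subgroup)

lemma subgroup_iff_restrict:
  assumes "subgroup K G"
  shows "subgroup H (G\<lparr>carrier := K\<rparr>) \<longleftrightarrow> subgroup H G \<and> H \<subseteq> K"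
  using assms group.incl_subgroup [OF group_axioms assms] subgroup_incl subgroup.subset by fastforce

lemma card_dvd_subgroup:
  assumes "subgroup H G" "subgroup K G" "H \<subseteq> K" shows "card H dvd card K"
proof -
  have "card (rcosets\<^bsub>G\<lparr>carrier := K\<rparr>\<^esub> H) * card H = card K"
    using group.lagrange [OF subgroup_imp_group [OF assms(2)] subgroup_incl [OF assms(1,2,3)]]
    by (simp add: order_def)
  then show ?thesis by (rule dvdI [OF trans [OF sym mult.commute]])
qed

lemma finite_group_Mod:
  assumes "N \<lhd> G" shows "finite_group (G Mod N)"
  using assms finite_carrier
  by (simp add: finite_group_def finite_group_axioms_def normal.factorgroup_is_group carrier_FactGroup)

lemma pow_card_eq_one: "subgroup H G \<Longrightarrow> x \<in> H \<Longrightarrow> x [^] card H = \<one>"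
  using group.pow_order_eq_1 [OF subgroup_imp_group, of H x]
  by (simp add: order_def nat_pow_consistent [symmetric])

lemma conj_by_restrict:
  assumes "subgroup H G" "g \<in> H" shows "conj_by (G\<lparr>carrier := H\<rparr>) g x = cj g x"
  using assms by (simp add: conj_by_def)

lemma invar_restrict:
  assumes "subgroup H G" "S \<subseteq> H" shows "invar (G\<lparr>carrier := H\<rparr>) S A \<longleftrightarrow> invar G S A"
  using assms unfolding invar_def by (metis conj_by_restrict subsetD)

lemma normal_restrict_iff:
  assumes "subgroup H G"
  shows "N \<lhd> G\<lparr>carrier := H\<rparr> \<longleftrightarrow> subgroup N G \<and> N \<subseteq> H \<and> invar G H N"
  using assms
  by (auto simp: group.normal_iff_invar subgroup_imp_group subgroup_iff_restrict invar_restrict)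

text \<open>Inverses are powers: inv x = x^(|G|-1).\<close>

lemma submonoid_imp_subgroup:
  assumes "H \<subseteq> carrier G" "\<one> \<in> H" "\<And>x y. x \<in> H \<Longrightarrow> y \<in> H \<Longrightarrow> x \<otimes> y \<in> H"
  shows "subgroup H G"
proof (rule subgroupI)
  fix x assume x: "x \<in> H"
  then have c: "x \<in> carrier G" using assms by auto
  have pw: "x [^] (n::nat) \<in> H" for n by (induction n) (use x assms in auto)
  have "0 < order G" using finite_carrier by (simp add: order_gt_0_iff_finite)
  then have "x [^] (order G - 1) \<otimes> x = \<one>"
    using pow_order_eq_1 [OF c] by (metis Suc_diff_1 nat_pow_Suc)
  then have "inv x = x [^] (order G - 1)" using c by (metis inv_equality nat_pow_closed)
  then show "inv x \<in> H" using pw by simp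
qed (use assms in auto)

lemma cj_image_eq:
  assumes "g \<in> carrier G" "U \<subseteq> carrier G" "\<And>u. u \<in> U \<Longrightarrow> cj g u \<in> U"
  shows "cj g ` U = U"
proof -
  have "inj_on (cj g) U" using assms by (meson cj_eq_iff inj_onI subsetD)
  moreover have "finite U" using assms finite_carrier finite_subset by blast
  ultimately show ?thesis using assms by (simp add: endo_inj_surj image_subset_iff)
qed

text \<open>The library's \<open>normalizer\<close> is a stabiliser and demands equality of U and
  its conjugate; in a finite group one inclusion implies it.\<close>

lemma mem_normalizer_iff:
  assumes "U \<subseteq> carrier G"
  shows "g \<in> normalizer G U \<longleftrightarrow> g \<in> carrier G \<and> (\<forall>u\<in>U. cj g u \<in> U)"
proof -
  have "g <# U #> inv g = cj g ` U"
    by (auto simp: l_coset_def r_coset_def conj_by_def)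
  then show ?thesis
    using assms cj_image_eq [of g U]
    by (auto simp: normalizer_def stabilizer_def)
qed

lemma normalizer_subgroup: "U \<subseteq> carrier G \<Longrightarrow> subgroup (normalizer G U) G"
  by (rule normalizer_imp_subgroup)

lemma invar_normalizer: "U \<subseteq> carrier G \<Longrightarrow> invar G (normalizer G U) U"
  by (simp add: invar_def mem_normalizer_iff)

lemma subset_normalizer_iff:
  "U \<subseteq> carrier G \<Longrightarrow> S \<subseteq> carrier G \<Longrightarrow> S \<subseteq> normalizer G U \<longleftrightarrow> invar G S U"
  by (auto simp: invar_def mem_normalizer_iff)

end

section \<open>Finite \<open>p\<close>-groups and Sylow subgroups\<close>

text \<open>\<open>BijGroup\<close> consists of maps extensional on \<open>\<Omega>\<close>, hence
  the \<open>restrict\<close>. The map of inv h inverts the map of h.\<close>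

lemma (in group) group_actionI:
  assumes closed: "\<And>h x. h \<in> carrier G \<Longrightarrow> x \<in> \<Omega> \<Longrightarrow> f h x \<in> \<Omega>"
    and one: "\<And>x. x \<in> \<Omega> \<Longrightarrow> f \<one> x = x"
    and mult: "\<And>g h x. g \<in> carrier G \<Longrightarrow> h \<in> carrier G \<Longrightarrow> x \<in> \<Omega> \<Longrightarrow> f (g \<otimes> h) x = f g (f h x)"
  shows "group_action G \<Omega> (\<lambda>h. restrict (f h) \<Omega>)"
proof -
  have bij: "restrict (f h) \<Omega> \<in> Bij \<Omega>" if h: "h \<in> carrier G" for h
  proof -
    have "bij_betw (restrict (f h) \<Omega>) \<Omega> \<Omega>"
    proof (rule bij_betw_byWitness [where f' = "f (inv h)"])
      show "\<forall>x\<in>\<Omega>. f (inv h) (restrict (f h) \<Omega> x) = x"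
        using h one mult [of "inv h" h] by simp
      show "\<forall>x\<in>\<Omega>. restrict (f h) \<Omega> (f (inv h) x) = x"
        using h one mult [of h "inv h"] closed by simp
    qed (use closed h in auto)
    then show ?thesis by (simp add: Bij_def)
  qed
  have "(\<lambda>h. restrict (f h) \<Omega>) \<in> hom G (BijGroup \<Omega>)"
  proof (rule homI)
    fix g h assume gh: "g \<in> carrier G" "h \<in> carrier G"
    show "restrict (f (g \<otimes> h)) \<Omega> = restrict (f g) \<Omega> \<otimes>\<^bsub>BijGroup \<Omega>\<^esub> restrict (f h) \<Omega>"
      using gh bij closed mult by (auto simp: BijGroup_def compose_def restrict_def fun_eq_iff)
  qed (use bij in \<open>simp add: BijGroup_def\<close>)
  then show ?thesis
    by (simp add: group_action_def group_hom_def group_hom_axioms_def group_BijGroup)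
qed

text \<open>Every orbit has p-power length by the orbit-stabiliser theorem. It either contains no
  fixed point, and then its length is divisible by p, or consists of a single one. Hence only fixed
  points count modulo p.\<close>

lemma (in group) p_group_fixed_points:
  assumes p: "Factorial_Ring.prime (p::nat)" and ord: "order G = p ^ a" and fin: "finite \<Omega>"
    and closed: "\<And>h x. h \<in> carrier G \<Longrightarrow> x \<in> \<Omega> \<Longrightarrow> f h x \<in> \<Omega>"
    and one: "\<And>x. x \<in> \<Omega> \<Longrightarrow> f \<one> x = x"
    and mult: "\<And>g h x. g \<in> carrier G \<Longrightarrow> h \<in> carrier G \<Longrightarrow> x \<in> \<Omega> \<Longrightarrow> f (g \<otimes> h) x = f g (f h x)"
  shows "card \<Omega> mod p = card {x \<in> \<Omega>. \<forall>h\<in>carrier G. f h x = x} mod p"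
proof -
  define \<phi> where "\<phi> = (\<lambda>h. restrict (f h) \<Omega>)"
  define F where "F = {x \<in> \<Omega>. \<forall>h\<in>carrier G. f h x = x}"
  interpret group_action G \<Omega> \<phi> unfolding \<phi>_def using closed one mult by (rule group_actionI)
  have sub: "W \<subseteq> \<Omega>" if "W \<in> orbits G \<Omega> \<phi>" for W using that orbits_coverture by auto
  have eq: "card W mod p = card (W \<inter> F) mod p" if W: "W \<in> orbits G \<Omega> \<phi>" for W
  proof -
    obtain x where x: "x \<in> \<Omega>" "W = orbit G \<phi> x" using W by (auto simp: orbits_def)
    have X_eq: "W = {f h x |h. h \<in> carrier G}" using x by (auto simp: orbit_def \<phi>_def)
    show ?thesis
    proof (cases "W \<inter> F = {}")
      case True
      have "x \<in> W" unfolding X_eq using one [OF x(1)] by force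
      have "card W dvd p ^ a" using orbit_stabilizer_theorem [OF x(1)] x(2) ord by (metis dvd_triv_left)
      then obtain j where j: "card W = p ^ j" using p by (auto simp: divides_primepow_nat)
      have "card W \<noteq> 1"
      proof
        assume "card W = 1"
        then have "W = {x}" using \<open>x \<in> W\<close> by (auto simp: card_1_singleton_iff)
        then have "x \<in> F" using x(1) unfolding F_def X_eq by auto
        then show False using True \<open>x \<in> W\<close> by auto
      qed
      then have "p dvd card W" using j by (cases j) auto
      then show ?thesis using True by simp
    next
      case False
      then obtain y h where y: "y \<in> F" "y = f h x" "h \<in> carrier G" by (auto simp: X_eq)
      have "x = f (inv h) y" using y x one mult [of "inv h" h x] by simp
      then have "x = y" using y by (auto simp: F_def)
      then have "W = {x}" using y one [OF x(1)] unfolding X_eq F_def by force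
      have "x \<in> F" using y(1) unfolding \<open>x = y\<close> .
      then show ?thesis using \<open>W = {x}\<close> by simp
    qed
  qed
  have finX: "finite W" if "W \<in> orbits G \<Omega> \<phi>" for W using sub [OF that] fin finite_subset by blast
  have "card \<Omega> = (\<Sum>W\<in>orbits G \<Omega> \<phi>. \<Sum>x\<in>W. 1)"
    by (subst disjoint_sum [OF fin]) simp
  also have "\<dots> = (\<Sum>W\<in>orbits G \<Omega> \<phi>. card W)" by simp
  finally have 1: "card \<Omega> = (\<Sum>W\<in>orbits G \<Omega> \<phi>. card W)" .
  have "card F = (\<Sum>x\<in>\<Omega>. if x \<in> F then 1 else 0)"
    using fin by (simp add: F_def sum.If_cases Int_def)
  also have "\<dots> = (\<Sum>W\<in>orbits G \<Omega> \<phi>. \<Sum>x\<in>W. if x \<in> F then 1 else 0)"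
    by (rule disjoint_sum [OF fin, symmetric])
  also have "\<dots> = (\<Sum>W\<in>orbits G \<Omega> \<phi>. card (W \<inter> F))"
    using finX by (intro sum.cong) (simp_all add: sum.If_cases)
  finally have 2: "card F = (\<Sum>W\<in>orbits G \<Omega> \<phi>. card (W \<inter> F))" .
  have "card \<Omega> mod p = (\<Sum>W\<in>orbits G \<Omega> \<phi>. card W mod p) mod p"
    unfolding 1 by (rule mod_sum_eq [symmetric])
  also have "\<dots> = (\<Sum>W\<in>orbits G \<Omega> \<phi>. card (W \<inter> F) mod p) mod p" using eq by simp
  also have "\<dots> = card F mod p" unfolding 2 by (rule mod_sum_eq)
  finally show ?thesis unfolding F_def .
qed

lemma dvd_prime_power_cases:
  fixes p n :: nat
  assumes "Factorial_Ring.prime p" "n dvd p ^ a" "n \<noteq> 1" shows "p dvd n"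
proof -
  obtain j where j: "n = p ^ j" using assms by (auto simp: divides_primepow_nat)
  then have "j \<noteq> 0" using assms(3) by auto
  then show ?thesis using j by (cases j) auto
qed

lemma prime_power_if_only_prime_divisor:
  fixes p n :: nat
  assumes p: "Factorial_Ring.prime p" and n: "0 < n"
    and only: "\<And>q. Factorial_Ring.prime q \<Longrightarrow> q dvd n \<Longrightarrow> q = p"
  shows "\<exists>k. n = p ^ k"
proof -
  obtain k m where km: "n = p ^ k * m" "\<not> p dvd m"
    using n p by (metis multiplicity_decompose' not_prime_unit neq0_conv)
  have "m = 1"
  proof (rule ccontr)
    assume "m \<noteq> 1"
    then obtain q where "Factorial_Ring.prime q" "q dvd m" using prime_factor_nat by blast
    then show False using only km by (metis dvd_mult)
  qed
  then show ?thesis using km by auto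
qed

section \<open>Sylow subgroups, and indices controlled by exponents\<close>

context finite_group
begin

lemma sylow_exists:
  assumes "Factorial_Ring.prime p" "subgroup K G" "card K = p ^ a * n"
  shows "\<exists>Q. subgroup Q G \<and> Q \<subseteq> K \<and> card Q = p ^ a"
  using sylow_thm [OF assms(1) subgroup_imp_group [OF assms(2)], of a n] assms(3)
    finite_subgroup [OF assms(2)] subgroup_iff_restrict [OF assms(2)]
  by (auto simp: order_def)

lemma card_decompose:
  assumes "Factorial_Ring.prime p" "subgroup K G"
  obtains a n where "card K = p ^ a * n" "\<not> p dvd n"
  using multiplicity_decompose' [of "card K" p] card_subgroup_pos [OF assms(2)] assms(1)
  by (metis neq0_conv not_prime_unit)

text \<open>Fixed points of \<open>Q\<close> acting by right multiplication on the cosets of \<open>P\<close> in \<open>K\<close>.\<close>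

lemma sylow_contains_conjugate:
  assumes p: "Factorial_Ring.prime p" and K: "subgroup K G"
    and P: "subgroup P G" "P \<subseteq> K" "card K = card P * n" "\<not> p dvd n"
    and Q: "subgroup Q G" "Q \<subseteq> K" "card Q = p ^ b"
  shows "\<exists>x\<in>K. \<forall>q\<in>Q. cj x q \<in> P"
proof -
  let ?K = "G\<lparr>carrier := K\<rparr>"
  define \<Omega> where "\<Omega> = rcosets\<^bsub>?K\<^esub> P"
  have \<Omega>: "\<Omega> = (\<lambda>x. P #> x) ` K" by (auto simp: \<Omega>_def RCOSETS_def)
  have sub: "P \<subseteq> carrier G" "Q \<subseteq> carrier G" "K \<subseteq> carrier G"
    using P Q K by (auto dest: subgroup.subset)
  have "card \<Omega> * card P = card K"
    using group.lagrange [OF subgroup_imp_group [OF K] subgroup_incl [OF P(1) K P(2)]]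
    by (simp add: \<Omega>_def order_def)
  then have card: "card \<Omega> = n" using P(3) card_subgroup_pos [OF P(1)] by (simp add: mult.commute)
  have fin: "finite \<Omega>" unfolding \<Omega> using finite_subgroup [OF K] by simp
  interpret Q: group "G\<lparr>carrier := Q\<rparr>" using Q(1) by (rule subgroup_imp_group)
  have "card \<Omega> mod p =
      card {W \<in> \<Omega>. \<forall>h\<in>carrier (G\<lparr>carrier := Q\<rparr>). W #> inv h = W} mod p"
  \<comment> \<open>The inverse turns right multiplication into a left action, as
    \<open>p_group_fixed_points\<close> requires.\<close>
  proof (rule Q.p_group_fixed_points [OF p _ fin, where f = "\<lambda>h W. W #> inv h"])
    show "order (G\<lparr>carrier := Q\<rparr>) = p ^ b" using Q by (simp add: order_def)
  next
    fix h W assume h: "h \<in> carrier (G\<lparr>carrier := Q\<rparr>)" and "W \<in> \<Omega>"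
    then obtain x where x: "x \<in> K" "W = P #> x" by (auto simp: \<Omega>)
    have "x \<in> carrier G" "h \<in> carrier G" using x h sub Q by auto
    then have "W #> inv h = P #> (x \<otimes> inv h)" using x sub by (simp add: coset_mult_assoc)
    moreover have "x \<otimes> inv h \<in> K"
      using x h Q K by (simp add: subgroup.m_closed subgroup.m_inv_closed subsetD)
    ultimately have "W #> inv h = P #> (x \<otimes> inv h)" "x \<otimes> inv h \<in> K" by auto
    then show "W #> inv h \<in> \<Omega>" by (auto simp: \<Omega>)
  next
    fix W assume "W \<in> \<Omega>"
    then obtain x where x: "x \<in> K" "W = P #> x" by (auto simp: \<Omega>)
    then show "W #> inv \<one>\<^bsub>G\<lparr>carrier := Q\<rparr>\<^esub> = W"
      using sub r_coset_subset_G by (simp add: subsetD)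
  next
    fix g h W assume gh: "g \<in> carrier (G\<lparr>carrier := Q\<rparr>)" "h \<in> carrier (G\<lparr>carrier := Q\<rparr>)" and "W \<in> \<Omega>"
    then obtain x where x: "x \<in> K" "W = P #> x" by (auto simp: \<Omega>)
    have "g \<in> carrier G" "h \<in> carrier G" "W \<subseteq> carrier G"
      using gh x sub r_coset_subset_G by (auto simp: subsetD)
    then show "W #> inv (g \<otimes>\<^bsub>G\<lparr>carrier := Q\<rparr>\<^esub> h) = W #> inv h #> inv g"
      by (simp add: coset_mult_assoc inv_mult_group)
  qed
  then have "\<not> p dvd card {W \<in> \<Omega>. \<forall>h\<in>Q. W #> inv h = W}"
    using P(4) by (simp add: card dvd_eq_mod_eq_0)
  then have "{W \<in> \<Omega>. \<forall>h\<in>Q. W #> inv h = W} \<noteq> {}" by (metis card.empty dvd_0_right)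
  then obtain x where x: "x \<in> K" and fixed: "\<And>h. h \<in> Q \<Longrightarrow> P #> x #> inv h = P #> x"
    by (auto simp: \<Omega>)
  have "cj x q \<in> P" if q: "q \<in> Q" for q
  proof -
    have c: "x \<in> carrier G" "q \<in> carrier G" using x q sub by auto
    have "P #> x = P #> (x \<otimes> q)"
      using fixed [of "inv q"] q Q(1) sub c by (simp add: subgroup.m_inv_closed coset_mult_assoc)
    then have "x \<otimes> q \<in> P #> x" using rcos_self [of "x \<otimes> q" P] c P(1) by simp
    then show ?thesis
      using subgroup.rcos_module [OF P(1) group_axioms, of x "x \<otimes> q"] c by (simp add: conj_by_def)
  qed
  then show ?thesis using x by blast
qed

lemma sylow_conjugate:
  assumes p: "Factorial_Ring.prime p" and K: "subgroup K G"
    and P: "subgroup P G" "P \<subseteq> K" "card K = card P * n" "\<not> p dvd n"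
    and Q: "subgroup Q G" "Q \<subseteq> K" "card Q = p ^ b" and PQ: "card P = card Q"
  shows "\<exists>x\<in>K. cj x ` Q = P"
proof -
  obtain x where x: "x \<in> K" "\<forall>q\<in>Q. cj x q \<in> P"
    using sylow_contains_conjugate [OF p K P Q] by blast
  have "inj_on (cj x) Q"
    by (rule inj_onI) (use x K Q cj_eq_iff in \<open>meson subgroup_carrier\<close>)
  then have "card (cj x ` Q) = card P" using PQ by (simp add: card_image)
  moreover have "cj x ` Q \<subseteq> P" using x by auto
  ultimately have "cj x ` Q = P" using finite_subgroup [OF P(1)] by (simp add: card_subset_eq)
  then show ?thesis using x by blast
qed

lemma subgroup_cj_image:
  assumes "subgroup H G" "x \<in> carrier G" shows "subgroup (cj x ` H) G"
proof (rule subgroupI)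
  show "cj x ` H \<subseteq> carrier G" using assms by (auto dest: subgroup_carrier)
  show "cj x ` H \<noteq> {}" using subgroup.one_closed [OF assms(1)] by auto
next
  fix y assume "y \<in> cj x ` H"
  then obtain h where h: "h \<in> H" "y = cj x h" by auto
  then have "inv y = cj x (inv h)" using assms subgroup_carrier by (simp add: cj_inv)
  then show "inv y \<in> cj x ` H" using h assms subgroup.m_inv_closed by (metis imageI)
next
  fix y z assume "y \<in> cj x ` H" "z \<in> cj x ` H"
  then obtain h k where h: "h \<in> H" "y = cj x h" "k \<in> H" "z = cj x k" by auto
  then have "y \<otimes> z = cj x (h \<otimes> k)" using assms subgroup_carrier by (simp add: cj_mult)
  then show "y \<otimes> z \<in> cj x ` H" using h assms subgroup.m_closed by (metis imageI)
qed

lemma card_cj_image: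
  assumes "H \<subseteq> carrier G" "x \<in> carrier G" shows "card (cj x ` H) = card H"
  using assms by (intro card_image inj_onI) (meson cj_eq_iff subsetD)

text \<open>The normal subgroup A/B of the p-group S/B meets its centre nontrivially. Without
  forming quotients: \<open>S\<close> acts by conjugation on the cosets of \<open>B\<close> in
  \<open>A\<close>, whose number is a nontrivial power of p; the coset \<open>B\<close> itself is
  fixed, so there is a second fixed coset, and z is taken from it.\<close>

lemma central_element_mod:
  assumes p: "Factorial_Ring.prime p" and S: "subgroup S G" "card S = p ^ a"
    and AB: "subgroup A G" "subgroup B G" "B \<subset> A" "A \<subseteq> S"
    and inv: "invar G S A" "invar G S B"
  shows "\<exists>z\<in>A - B. \<forall>s\<in>S. cj s z \<otimes> inv z \<in> B"
proof -
  let ?A = "G\<lparr>carrier := A\<rparr>"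
  define \<Omega> where "\<Omega> = rcosets\<^bsub>?A\<^esub> B"
  have \<Omega>: "\<Omega> = (\<lambda>x. B #> x) ` A" by (auto simp: \<Omega>_def RCOSETS_def)
  have sub: "B \<subseteq> carrier G" "S \<subseteq> carrier G" "A \<subseteq> carrier G"
    using AB S by (auto dest: subgroup.subset)
  have lag: "card \<Omega> * card B = card A"
    using group.lagrange [OF subgroup_imp_group [OF AB(1)] subgroup_incl [OF AB(2,1)]] AB
    by (simp add: \<Omega>_def order_def psubset_imp_subset)
  moreover have "card B < card A" using AB finite_subgroup by (simp add: psubset_card_mono)
  ultimately have "card \<Omega> \<noteq> 1" by auto
  moreover have "card \<Omega> dvd p ^ a"
    using lag card_dvd_subgroup [OF AB(1) S(1) AB(4)] S(2) by (metis dvd_triv_left dvd_trans)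
  ultimately have pdvd: "p dvd card \<Omega>" using p by (auto intro: dvd_prime_power_cases)
  have fin: "finite \<Omega>" unfolding \<Omega> using finite_subgroup [OF AB(1)] by simp
  have img: "cj s ` (B #> x) = B #> cj s x" if s: "s \<in> S" and x: "x \<in> carrier G" for s x
  proof -
    have "cj s ` B = B" using cj_image_eq s sub inv(2) by (simp add: invarD subsetD)
    have "cj s ` (B #> x) = (\<lambda>b. b \<otimes> cj s x) ` (cj s ` B)"
      using s x sub by (auto simp: r_coset_def image_UN cj_mult subsetD)
    also have "\<dots> = B #> cj s x" unfolding \<open>cj s ` B = B\<close> by (auto simp: r_coset_def)
    finally show ?thesis .
  qed
  interpret S: group "G\<lparr>carrier := S\<rparr>" using S(1) by (rule subgroup_imp_group)
  have "card \<Omega> mod p = card {W \<in> \<Omega>. \<forall>h\<in>carrier (G\<lparr>carrier := S\<rparr>). cj h ` W = W} mod p"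
  proof (rule S.p_group_fixed_points [OF p _ fin, where f = "\<lambda>h W. cj h ` W"])
    show "order (G\<lparr>carrier := S\<rparr>) = p ^ a" using S by (simp add: order_def)
  next
    fix h W assume h: "h \<in> carrier (G\<lparr>carrier := S\<rparr>)" and "W \<in> \<Omega>"
    then obtain x where x: "x \<in> A" "W = B #> x" by (auto simp: \<Omega>)
    have "cj h ` W = B #> cj h x" "cj h x \<in> A"
      using x h sub inv img [of h x] by (simp_all add: invarD subsetD)
    then show "cj h ` W \<in> \<Omega>" by (auto simp: \<Omega>)
  next
    fix W assume "W \<in> \<Omega>"
    then obtain x where x: "x \<in> A" "W = B #> x" by (auto simp: \<Omega>)
    show "cj \<one>\<^bsub>G\<lparr>carrier := S\<rparr>\<^esub> ` W = W"
      using x sub img [of \<one> x] subgroup.one_closed [OF S(1)] by (simp add: subsetD)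
  next
    fix g h W assume gh: "g \<in> carrier (G\<lparr>carrier := S\<rparr>)" "h \<in> carrier (G\<lparr>carrier := S\<rparr>)" and "W \<in> \<Omega>"
    then obtain x where x: "x \<in> A" "W = B #> x" by (auto simp: \<Omega>)
    have "W \<subseteq> carrier G" using x sub r_coset_subset_G by (auto simp: subsetD)
    then show "cj (g \<otimes>\<^bsub>G\<lparr>carrier := S\<rparr>\<^esub> h) ` W = cj g ` cj h ` W"
      using gh sub by (auto simp: image_image cj_cj subsetD intro!: image_cong)
  qed
  moreover define \<Phi> where "\<Phi> = {W \<in> \<Omega>. \<forall>h\<in>S. cj h ` W = W}"
  ultimately have "p dvd card \<Phi>"
    using pdvd by (simp add: dvd_eq_mod_eq_0)
  then have "\<Phi> \<noteq> {B}"
    using p by (metis card_1_singleton_iff One_nat_def not_prime_unit)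
  moreover have "B \<in> \<Phi>"
    using img [of _ \<one>] sub subgroup.one_closed [OF AB(1)] unfolding \<Omega> \<Phi>_def
    by (auto intro!: image_eqI [of _ _ \<one>] simp: subsetD coset_mult_one [OF sub(1)])
  ultimately obtain W where "W \<in> \<Phi>" "W \<noteq> B" by blast
  then obtain z where "z \<in> A" "W = B #> z" "\<And>h. h \<in> S \<Longrightarrow> cj h ` W = W"
    by (auto simp: \<Omega> \<Phi>_def)
  with \<open>W \<noteq> B\<close> have z: "z \<in> A" "B #> z \<noteq> B" and fixed: "\<And>h. h \<in> S \<Longrightarrow> B #> cj h z = B #> z"
    using img sub by (simp_all add: subsetD)
  have "z \<notin> B" using z coset_join2 [of z B] AB(2) sub by auto
  moreover have "cj s z \<otimes> inv z \<in> B" if s: "s \<in> S" for s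
  proof -
    have c: "z \<in> carrier G" "cj s z \<in> carrier G" using z(1) s sub by (simp_all add: subsetD)
    have "cj s z \<in> B #> z" using fixed [OF s] rcos_self [OF c(2) AB(2)] by simp
    then show ?thesis using subgroup.rcos_module [OF AB(2) group_axioms c(1) c(2)] by simp
  qed
  ultimately show ?thesis using z by blast
qed

text \<open>A Sylow p-subgroup Q of \<open>K\<close> lies in \<open>B\<close>: for x in Q both x^m
  and x^|Q| = 1 are in \<open>B\<close>, and the two exponents are coprime. So |B| contains the full
  p-part of |K|.\<close>

lemma index_not_dvd:
  assumes p: "Factorial_Ring.prime p" and B: "subgroup B G" and K: "subgroup K G"
    and sub: "B \<subseteq> K" and card: "card K = card B * n"
    and pow: "\<And>x. x \<in> K \<Longrightarrow> x [^] (m::nat) \<in> B" and m: "\<not> p dvd m"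
  shows "\<not> p dvd n"
proof
  assume "p dvd n"
  obtain a l where al: "card K = p ^ a * l" "\<not> p dvd l" using card_decompose [OF p K] by blast
  obtain Q where Q: "subgroup Q G" "Q \<subseteq> K" "card Q = p ^ a" using sylow_exists [OF p K al(1)] by blast
  have "Q \<subseteq> B"
  proof
    fix x assume x: "x \<in> Q"
    have "x [^] (p ^ a) = \<one>" using pow_card_eq_one [OF Q(1) x] Q(3) by simp
    then have "x [^] (p ^ a) \<in> B" using subgroup.one_closed [OF B] by simp
    moreover have "coprime m (p ^ a)"
      using p m by (metis coprime_commute coprime_power_right_iff prime_imp_coprime)
    ultimately show "x \<in> B"
      using coprime_pow_mem [OF B _ pow, of x] x Q subgroup_carrier by blast
  qed
  then have "p ^ a dvd card B" using card_dvd_subgroup [OF Q(1) B] Q(3) by simp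
  then obtain b where b: "card B = p ^ a * b" by blast
  then have "l = b * n" using card al(1) p by (auto simp: mult.assoc prime_gt_0_nat)
  then show False using \<open>p dvd n\<close> al(2) by simp
qed

text \<open>By \<open>index_not_dvd\<close>, applied to each prime q dividing the index, q divides
  p^k and is therefore p.\<close>

lemma index_prime_power:
  assumes p: "Factorial_Ring.prime p" and B: "subgroup B G" and K: "subgroup K G"
    and sub: "B \<subseteq> K" and pow: "\<And>x. x \<in> K \<Longrightarrow> x [^] (p ^ k) \<in> B"
  shows "\<exists>j. card K = card B * p ^ j"
proof -
  obtain n where n: "card K = card B * n" using card_dvd_subgroup [OF B K sub] by blast
  have "\<exists>j. n = p ^ j"
  proof (rule prime_power_if_only_prime_divisor [OF p])
    show "0 < n" using n card_subgroup_pos [OF K] by (cases n) auto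
    fix q assume q: "Factorial_Ring.prime q" "q dvd n"
    then have "q dvd p ^ k" using index_not_dvd [OF q(1) B K sub n pow] by blast
    then show "q = p" using p q by (metis prime_dvd_power primes_dvd_imp_eq)
  qed
  then show ?thesis using n by auto
qed

text \<open>Lagrange in K/B, read back in \<open>K\<close>. This is the way from an index to an
  exponent.\<close>

lemma pow_index_mem:
  assumes B: "subgroup B G" and K: "subgroup K G" and sub: "B \<subseteq> K" and inv: "invar G K B"
    and card: "card K = card B * n" and x: "x \<in> K"
  shows "x [^] n \<in> B"
proof -
  let ?K = "G\<lparr>carrier := K\<rparr>"
  have N: "B \<lhd> ?K" using assms by (simp add: normal_restrict_iff)
  interpret N: normal B ?K by (rule N)
  interpret Q: group "?K Mod B" by (rule N.factorgroup_is_group)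
  have "order (?K Mod B) * card B = card K"
    using N.lagrange [OF normal_imp_subgroup [OF N]] by (simp add: order_def FactGroup_def)
  then have ord: "order (?K Mod B) = n" using card card_subgroup_pos [OF B] by simp
  have "B #>\<^bsub>?K\<^esub> x \<in> carrier (?K Mod B)" using x by (auto simp: carrier_FactGroup)
  then have "(B #>\<^bsub>?K\<^esub> x) [^]\<^bsub>?K Mod B\<^esub> n = B" using Q.pow_order_eq_1 ord by simp
  then have "B #> (x [^] n) = B" using N.FactGroup_pow [of x n] x by (simp add: nat_pow_consistent [symmetric])
  then show ?thesis using coset_join1 [OF _ _ B] x K subgroup_carrier by auto
qed

lemma mem_of_pow_p_group:
  assumes p: "Factorial_Ring.prime p" and H: "subgroup H G" and P: "subgroup P G" "card P = p ^ a"
    and x: "x \<in> P" "x [^] (i::nat) \<in> H" "\<not> p dvd i"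
  shows "x \<in> H"
proof -
  have "x [^] (p ^ a) \<in> H" using pow_card_eq_one [OF P(1) x(1)] P(2) subgroup.one_closed [OF H] by simp
  moreover have "coprime i (p ^ a)"
    using p x(3) by (metis coprime_commute coprime_power_right_iff prime_imp_coprime)
  ultimately show ?thesis using coprime_pow_mem [OF H _ x(2)] x(1) P(1) subgroup_carrier by blast
qed

end

section \<open>Products over the cosets of an abelian subgroup\<close>

text \<open>Common ground of two constructions: complements of \<open>A\<close> in \<open>K\<close>,
  where both are made normal in the ambient group, and the transfer from \<open>K\<close> to
  \<open>A\<close>.\<close>

locale abelian_subgroup = finite_group +
  fixes A K
  assumes A_sub: "subgroup A G" and K_sub: "subgroup K G" and A_le_K: "A \<subseteq> K"
    and A_comm: "\<And>a b. a \<in> A \<Longrightarrow> b \<in> A \<Longrightarrow> a \<otimes> b = b \<otimes> a"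
begin

abbreviation (input) GA where "GA \<equiv> G\<lparr>carrier := A\<rparr>"

definition cosets where "cosets = (\<lambda>x. A #> x) ` K"

text \<open>The product of \<open>h\<close> over one representative of each coset. It is formed in
  the group on \<open>A\<close>, because \<open>finprod\<close> needs commutativity. For
  \<open>coset_invariant\<close> functions the choice of representatives has no influence.\<close>

definition coset_prod :: "('a \<Rightarrow> 'a) \<Rightarrow> 'a"
  where "coset_prod h = finprod GA (\<lambda>c. h (SOME x. x \<in> c)) cosets"

definition coset_invariant :: "('a \<Rightarrow> 'a) \<Rightarrow> bool"
  where "coset_invariant h \<longleftrightarrow> (\<forall>x\<in>K. \<forall>a\<in>A. h (a \<otimes> x) = h x)"

sublocale GA: comm_group GA
  using A_comm by (intro group.group_comm_groupI subgroup_imp_group A_sub) simp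

lemma in_carrier: "x \<in> K \<Longrightarrow> x \<in> carrier G" "a \<in> A \<Longrightarrow> a \<in> carrier G" "a \<in> A \<Longrightarrow> a \<in> K"
  using A_sub K_sub A_le_K by (auto dest: subgroup_carrier)

lemmas A_closed = subgroup.one_closed [OF A_sub] subgroup.m_closed [OF A_sub]
  subgroup.m_inv_closed [OF A_sub]

lemmas K_closed = subgroup.one_closed [OF K_sub] subgroup.m_closed [OF K_sub]
  subgroup.m_inv_closed [OF K_sub]

lemma finite_cosets: "finite cosets"
  unfolding cosets_def using finite_subgroup [OF K_sub] by simp

lemma card_cosets: "card cosets * card A = card K"
proof -
  have "cosets = rcosets\<^bsub>G\<lparr>carrier := K\<rparr>\<^esub> A" by (auto simp: cosets_def RCOSETS_def)
  then show ?thesis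
    using group.lagrange [OF subgroup_imp_group [OF K_sub] subgroup_incl [OF A_sub K_sub A_le_K]]
    by (simp add: order_def)
qed

lemma same_coset_iff:
  assumes "x \<in> K" "y \<in> K" shows "A #> x = A #> y \<longleftrightarrow> x \<otimes> inv y \<in> A"
proof
  assume "A #> x = A #> y"
  then show "x \<otimes> inv y \<in> A"
    using rcos_self [of x A] subgroup.rcos_module [OF A_sub group_axioms, of y x] assms in_carrier A_sub
    by auto
next
  assume "x \<otimes> inv y \<in> A"
  then have "x \<in> A #> y"
    using subgroup.rcos_module [OF A_sub group_axioms, of y x] assms in_carrier by auto
  then show "A #> x = A #> y" using repr_independence [of x A y] assms in_carrier A_sub by auto
qed

lemma rep_in_coset:
  assumes x: "x \<in> K"
  shows "(SOME y. y \<in> A #> x) \<in> K" "(SOME y. y \<in> A #> x) \<otimes> inv x \<in> A"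
proof -
  let ?y = "SOME y. y \<in> A #> x"
  have "?y \<in> A #> x" using rcos_self [of x A] x in_carrier A_sub by (auto intro: someI)
  then obtain a where a: "a \<in> A" "?y = a \<otimes> x" by (auto simp: r_coset_def)
  then show "?y \<in> K" using x in_carrier K_closed by simp
  show "?y \<otimes> inv x \<in> A" using a x in_carrier by simp
qed

lemma coset_invariantD:
  assumes "coset_invariant h" "x \<in> K" "y \<in> K" "y \<otimes> inv x \<in> A" shows "h y = h x"
proof -
  have "y = (y \<otimes> inv x) \<otimes> x" using assms in_carrier by simp
  then show ?thesis using assms unfolding coset_invariant_def by metis
qed

section \<open>Calculation with products over cosets\<close>

lemma coset_prod_cong:
  assumes "\<And>x. x \<in> K \<Longrightarrow> h x = h' x" "\<And>x. x \<in> K \<Longrightarrow> h' x \<in> A"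
  shows "coset_prod h = coset_prod h'"
  unfolding coset_prod_def
  by (rule GA.finprod_cong') (use assms rep_in_coset in \<open>auto simp: cosets_def\<close>)

lemma coset_prod_closed:
  assumes "\<And>x. x \<in> K \<Longrightarrow> h x \<in> A" shows "coset_prod h \<in> A"
proof -
  have "coset_prod h \<in> carrier GA" unfolding coset_prod_def
    by (rule GA.finprod_closed) (use assms rep_in_coset in \<open>auto simp: cosets_def\<close>)
  then show ?thesis by simp
qed

lemma coset_prod_mult:
  assumes "\<And>x. x \<in> K \<Longrightarrow> h x \<in> A" "\<And>x. x \<in> K \<Longrightarrow> h' x \<in> A"
  shows "coset_prod (\<lambda>x. h x \<otimes> h' x) = coset_prod h \<otimes> coset_prod h'"
proof -
  have "finprod GA (\<lambda>c. h (SOME x. x \<in> c) \<otimes>\<^bsub>GA\<^esub> h' (SOME x. x \<in> c)) cosets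
      = finprod GA (\<lambda>c. h (SOME x. x \<in> c)) cosets \<otimes>\<^bsub>GA\<^esub> finprod GA (\<lambda>c. h' (SOME x. x \<in> c)) cosets"
    by (rule GA.finprod_multf) (use assms rep_in_coset in \<open>auto simp: cosets_def\<close>)
  then show ?thesis by (simp add: coset_prod_def)
qed

lemma coset_prod_const:
  assumes "a \<in> A" shows "coset_prod (\<lambda>x. a) = a [^] card cosets"
  using GA.finprod_const [of a cosets] assms
  by (simp add: coset_prod_def nat_pow_consistent [symmetric])

text \<open>The condition on quotients says that \<open>t\<close> induces a well-defined injective
  map on the cosets of \<open>A\<close>, hence a permutation of this finite set. The invariance of
  \<open>h\<close> absorbs the different representatives.\<close>

lemma coset_prod_reindex:
  assumes h: "coset_invariant h" "\<And>x. x \<in> K \<Longrightarrow> h x \<in> A"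
    and t: "\<And>x. x \<in> K \<Longrightarrow> t x \<in> K"
    and coset: "\<And>x y. x \<in> K \<Longrightarrow> y \<in> K \<Longrightarrow> t x \<otimes> inv (t y) \<in> A \<longleftrightarrow> x \<otimes> inv y \<in> A"
  shows "coset_prod (\<lambda>x. h (t x)) = coset_prod h"
proof -
  define \<pi> where "\<pi> = (\<lambda>c. A #> t (SOME x. x \<in> c))"
  have \<pi>: "\<pi> (A #> x) = A #> t x" if "x \<in> K" for x
    unfolding \<pi>_def using that rep_in_coset [OF that] t coset by (subst same_coset_iff) auto
  have inj: "inj_on \<pi> cosets"
    unfolding inj_on_def cosets_def by (simp add: \<pi> same_coset_iff t coset)
  have img: "\<pi> ` cosets = cosets"
    by (rule endo_inj_surj [OF finite_cosets _ inj]) (auto simp: cosets_def \<pi> t)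
  have "coset_prod h = finprod GA (\<lambda>c. h (SOME x. x \<in> c)) (\<pi> ` cosets)"
    by (simp add: coset_prod_def img)
  also have "\<dots> = finprod GA (\<lambda>c. h (SOME x. x \<in> \<pi> c)) cosets"
    by (rule GA.finprod_reindex [OF _ inj]) (use h rep_in_coset img in \<open>auto simp: cosets_def\<close>)
  also have "\<dots> = finprod GA (\<lambda>c. h (t (SOME x. x \<in> c))) cosets"
  proof (rule GA.finprod_cong' [OF refl])
    fix c assume "c \<in> cosets"
    then obtain x where x: "x \<in> K" "c = A #> x" by (auto simp: cosets_def)
    let ?y = "SOME y. y \<in> c"
    have y: "?y \<in> K" using rep_in_coset [OF x(1)] x(2) by simp
    have "\<pi> c = A #> t ?y" by (simp add: \<pi>_def)
    then show "h (SOME x. x \<in> \<pi> c) = h (t ?y)"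
      using rep_in_coset [of "t ?y"] t [OF y] by (auto intro!: coset_invariantD [OF h(1)])
  qed (use h t rep_in_coset in \<open>auto simp: cosets_def\<close>)
  finally show ?thesis by (simp add: coset_prod_def)
qed

lemma coset_prod_hom:
  assumes h: "\<And>x. x \<in> K \<Longrightarrow> h x \<in> A" and s: "\<And>a. a \<in> A \<Longrightarrow> s a \<in> A" "s \<one> = \<one>"
    "\<And>a b. a \<in> A \<Longrightarrow> b \<in> A \<Longrightarrow> s (a \<otimes> b) = s a \<otimes> s b"
  shows "coset_prod (\<lambda>x. s (h x)) = s (coset_prod h)"
proof -
  have "finprod GA (\<lambda>c. s (f c)) F = s (finprod GA f F) \<and> finprod GA f F \<in> A"
    if "finite F" "\<And>c. c \<in> F \<Longrightarrow> f c \<in> A" for F :: "'a set set" and f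
    using that
  proof (induction F)
    case empty
    then show ?case using s(2) A_closed by simp
  next
    case (insert c F)
    have "finprod GA (\<lambda>c. s (f c)) (insert c F) = s (f c) \<otimes>\<^bsub>GA\<^esub> finprod GA (\<lambda>c. s (f c)) F"
      using insert s by (intro GA.finprod_insert) auto
    moreover have "finprod GA f (insert c F) = f c \<otimes>\<^bsub>GA\<^esub> finprod GA f F"
      using insert by (intro GA.finprod_insert) auto
    ultimately show ?case using insert s A_closed by simp
  qed
  from this [OF finite_cosets, of "\<lambda>c. h (SOME x. x \<in> c)"] show ?thesis
    using h rep_in_coset by (auto simp: coset_prod_def cosets_def)
qed

text \<open>A system of representatives of the right cosets of \<open>A\<close>, written as a
  function on elements: \<open>r x\<close> is the representative of the coset of x. In this form
  translations and conjugations act on it by formulas.\<close>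

definition coset_section :: "('a \<Rightarrow> 'a) \<Rightarrow> bool"
  where "coset_section r \<longleftrightarrow> coset_invariant r \<and> (\<forall>x\<in>K. r x \<in> K \<and> r x \<otimes> inv x \<in> A)"

text \<open>The classical quotient (R|S) of two transversals, the product of all r s^-1 with r and s
  in the same coset.\<close>

definition section_diff :: "('a \<Rightarrow> 'a) \<Rightarrow> ('a \<Rightarrow> 'a) \<Rightarrow> 'a"
  where "section_diff r s = coset_prod (\<lambda>x. r x \<otimes> inv (s x))"

lemma coset_section_exists: "\<exists>r. coset_section r"
proof (intro exI)
  show "coset_section (\<lambda>x. SOME y. y \<in> A #> x)"
    unfolding coset_section_def coset_invariant_def
  proof (intro conjI ballI)
    fix x a assume "x \<in> K" "a \<in> A"
    then have "A #> (a \<otimes> x) = A #> x" using in_carrier K_closed by (subst same_coset_iff) auto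
    then show "(SOME y. y \<in> A #> (a \<otimes> x)) = (SOME y. y \<in> A #> x)" by simp
  qed (use rep_in_coset in auto)
qed

lemma coset_sectionD:
  assumes "coset_section r"
  shows "x \<in> K \<Longrightarrow> r x \<in> K" "x \<in> K \<Longrightarrow> r x \<otimes> inv x \<in> A"
    "x \<in> K \<Longrightarrow> a \<in> A \<Longrightarrow> r (a \<otimes> x) = r x"
  using assms by (auto simp: coset_section_def coset_invariant_def)

lemma section_quotient:
  assumes "coset_section r" "coset_section s" "x \<in> K" shows "r x \<otimes> inv (s x) \<in> A"
proof -
  have c: "r x \<in> carrier G" "s x \<in> carrier G" "x \<in> carrier G"
    using assms coset_sectionD in_carrier by auto
  have "r x \<otimes> inv (s x) = (r x \<otimes> inv x) \<otimes> inv (s x \<otimes> inv x)"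
    using c by (simp add: inv_mult_group m_assoc)
  then show ?thesis using assms coset_sectionD A_closed by simp
qed

lemma section_diff_closed: "coset_section r \<Longrightarrow> coset_section s \<Longrightarrow> section_diff r s \<in> A"
  unfolding section_diff_def by (intro coset_prod_closed section_quotient)

text \<open>Telescoping in each coset. The factors may be rearranged because they all lie in the
  abelian group \<open>A\<close>.\<close>

lemma section_diff_mult:
  assumes "coset_section r" "coset_section s" "coset_section t"
  shows "section_diff r s \<otimes> section_diff s t = section_diff r t"
proof -
  have "section_diff r s \<otimes> section_diff s t
      = coset_prod (\<lambda>x. (r x \<otimes> inv (s x)) \<otimes> (s x \<otimes> inv (t x)))"
    unfolding section_diff_def by (rule coset_prod_mult [symmetric]) (use assms section_quotient in auto)
  also have "\<dots> = section_diff r t" unfolding section_diff_def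
  proof (rule coset_prod_cong)
    fix x assume x: "x \<in> K"
    then have "r x \<in> carrier G" "s x \<in> carrier G" "t x \<in> carrier G"
      using assms coset_sectionD in_carrier by auto
    then show "r x \<otimes> inv (s x) \<otimes> (s x \<otimes> inv (t x)) = r x \<otimes> inv (t x)" by (simp add: m_assoc)
  qed (use assms section_quotient in auto)
  finally show ?thesis .
qed

text \<open>The common pattern of left translation, conjugation and right translation:
  \<open>t\<close> is the permutation of \<open>K\<close> that moves the cosets, and
  \<open>\<sigma>\<close> is what happens to the factors in \<open>A\<close>.\<close>

lemma section_diff_transform:
  assumes r: "coset_section r" "coset_section s" "coset_section r'" "coset_section s'"
    and t: "\<And>x. x \<in> K \<Longrightarrow> t x \<in> K"
      "\<And>x y. x \<in> K \<Longrightarrow> y \<in> K \<Longrightarrow> t x \<otimes> inv (t y) \<in> A \<longleftrightarrow> x \<otimes> inv y \<in> A"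
    and \<sigma>: "\<And>a. a \<in> A \<Longrightarrow> \<sigma> a \<in> A" "\<sigma> \<one> = \<one>"
      "\<And>a b. a \<in> A \<Longrightarrow> b \<in> A \<Longrightarrow> \<sigma> (a \<otimes> b) = \<sigma> a \<otimes> \<sigma> b"
    and eq: "\<And>x. x \<in> K \<Longrightarrow> r' (t x) \<otimes> inv (s' (t x)) = \<sigma> (r x \<otimes> inv (s x))"
  shows "section_diff r' s' = \<sigma> (section_diff r s)"
proof -
  have "section_diff r' s' = coset_prod (\<lambda>x. r' (t x) \<otimes> inv (s' (t x)))"
    unfolding section_diff_def
  proof (rule coset_prod_reindex [symmetric])
    show "coset_invariant (\<lambda>x. r' x \<otimes> inv (s' x))"
      using coset_sectionD(3) [OF r(3)] coset_sectionD(3) [OF r(4)] by (simp add: coset_invariant_def)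
  qed (use r t section_quotient in auto)
  also have "\<dots> = coset_prod (\<lambda>x. \<sigma> (r x \<otimes> inv (s x)))"
    by (rule coset_prod_cong) (use r eq section_quotient \<sigma> in auto)
  also have "\<dots> = \<sigma> (section_diff r s)" unfolding section_diff_def
    by (rule coset_prod_hom) (use r section_quotient \<sigma> in auto)
  finally show ?thesis .
qed

lemma section_diff_cong:
  assumes "coset_section r'" "coset_section s'"
    and "\<And>x. x \<in> K \<Longrightarrow> r x = r' x" "\<And>x. x \<in> K \<Longrightarrow> s x = s' x"
  shows "section_diff r s = section_diff r' s'"
  unfolding section_diff_def by (rule coset_prod_cong) (use assms section_quotient in auto)

lemma section_diff_self: "coset_section r \<Longrightarrow> section_diff r r = \<one>"
  using section_diff_mult [of r r r] section_diff_closed [of r r] in_carrier by simp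

end

section \<open>Complements and transfer\<close>

context abelian_subgroup
begin

lemma coprime_pow_eq_one:
  assumes "a \<in> A" "a [^] (m::nat) = \<one>" "coprime m (card A)" shows "a = \<one>"
proof -
  have "a [^] card A = \<one>" using pow_card_eq_one [OF A_sub assms(1)] .
  then show ?thesis
    using coprime_pow_mem [OF triv_subgroup _ _ _ assms(3), of a] assms in_carrier by simp
qed

text \<open>A power map with exponent prime to |A| is an endomorphism of the abelian group
  \<open>A\<close> with trivial kernel, and \<open>A\<close> is finite.\<close>

lemma pow_surj:
  assumes "coprime m (card A)" shows "(\<lambda>a. a [^] (m::nat)) ` A = A"
proof (rule endo_inj_surj)
  show "finite A" by (rule finite_subgroup [OF A_sub])
  show "(\<lambda>a. a [^] m) ` A \<subseteq> A" using subgroup_pow [OF A_sub] by auto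
  show "inj_on (\<lambda>a. a [^] m) A"
  proof (rule inj_onI)
    fix a b assume ab: "a \<in> A" "b \<in> A" "a [^] m = b [^] m"
    have "(a \<otimes> inv b) [^] m = a [^] m \<otimes> inv b [^] m"
      using ab in_carrier A_closed A_comm by (intro pow_mult_distrib) auto
    also have "\<dots> = \<one>" using ab in_carrier by (simp add: nat_pow_inv)
    finally have "a \<otimes> inv b = \<one>" using coprime_pow_eq_one assms ab A_closed by blast
    then show "a = b" using ab in_carrier by (metis inv_mult_cancel_right(1) l_one)
  qed
qed

text \<open>For a transversal R this is k R: the representative of the coset of x is k times the old
  one of the coset of k^-1 x. In the same way \<open>conj_act\<close> stands for g R g^-1. That the
  results are transversals again rests on the normality of \<open>A\<close>.\<close>

definition left_act :: "'a \<Rightarrow> ('a \<Rightarrow> 'a) \<Rightarrow> 'a \<Rightarrow> 'a"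
  where "left_act k r = (\<lambda>x. k \<otimes> r (inv k \<otimes> x))"

definition conj_act :: "'a \<Rightarrow> ('a \<Rightarrow> 'a) \<Rightarrow> 'a \<Rightarrow> 'a"
  where "conj_act g r = (\<lambda>x. cj g (r (cj (inv g) x)))"

text \<open>The transversal R k. Right translation permutes right cosets by itself, which is why the
  transfer is built on it.\<close>

definition right_act :: "'a \<Rightarrow> ('a \<Rightarrow> 'a) \<Rightarrow> 'a \<Rightarrow> 'a"
  where "right_act k r = (\<lambda>x. r (x \<otimes> inv k) \<otimes> k)"

end

section \<open>Abelian normal subgroups and their complements\<close>

locale abelian_normal_subgroup = abelian_subgroup +
  assumes A_normal: "A \<lhd> G" and K_normal: "K \<lhd> G"
begin

lemma cj_A: "g \<in> carrier G \<Longrightarrow> a \<in> A \<Longrightarrow> cj g a \<in> A"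
  by (rule normal_cj [OF A_normal])

lemma cj_K: "g \<in> carrier G \<Longrightarrow> a \<in> K \<Longrightarrow> cj g a \<in> K"
  by (rule normal_cj [OF K_normal])

lemma cj_A_iff: "g \<in> carrier G \<Longrightarrow> a \<in> carrier G \<Longrightarrow> cj g a \<in> A \<longleftrightarrow> a \<in> A"
  using cj_A cj_A [of "inv g" "cj g a"] by auto

lemma left_act_section:
  assumes r: "coset_section r" and k: "k \<in> K" shows "coset_section (left_act k r)"
  unfolding coset_section_def coset_invariant_def
proof (intro conjI ballI)
  fix x assume x: "x \<in> K"
  have c: "x \<in> carrier G" "k \<in> carrier G" "inv k \<otimes> x \<in> K" "r (inv k \<otimes> x) \<in> carrier G"
    using x k in_carrier K_closed coset_sectionD(1) [OF r] by auto
  show "left_act k r x \<in> K"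
    using c k coset_sectionD(1) [OF r] K_closed by (simp add: left_act_def)
  have "left_act k r x \<otimes> inv x = cj k (r (inv k \<otimes> x) \<otimes> inv (inv k \<otimes> x))"
    using c by (simp add: left_act_def conj_by_def m_assoc inv_mult_group)
  then show "left_act k r x \<otimes> inv x \<in> A"
    using c coset_sectionD(2) [OF r] cj_A by simp
  fix a assume a: "a \<in> A"
  have "inv k \<otimes> (a \<otimes> x) = cj (inv k) a \<otimes> (inv k \<otimes> x)"
    using c a in_carrier by (simp add: conj_by_def m_assoc)
  then show "left_act k r (a \<otimes> x) = left_act k r x"
    using c a coset_sectionD(3) [OF r] cj_A by (simp add: left_act_def)
qed

lemma conj_act_section:
  assumes r: "coset_section r" and k: "k \<in> carrier G" shows "coset_section (conj_act k r)"
  unfolding coset_section_def coset_invariant_def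
proof (intro conjI ballI)
  fix x assume x: "x \<in> K"
  let ?y = "cj (inv k) x"
  have c: "x \<in> carrier G" "?y \<in> K" "r ?y \<in> carrier G" "r ?y \<in> K"
    using x k in_carrier cj_K coset_sectionD(1) [OF r] by auto
  show "conj_act k r x \<in> K" using c k cj_K by (simp add: conj_act_def)
  have "conj_act k r x \<otimes> inv x = cj k (r ?y \<otimes> inv ?y)"
    using c k by (simp add: conj_act_def cj_mult cj_inv in_carrier)
  then show "conj_act k r x \<otimes> inv x \<in> A"
    using c k coset_sectionD(2) [OF r] cj_A by simp
  fix a assume a: "a \<in> A"
  have "cj (inv k) (a \<otimes> x) = cj (inv k) a \<otimes> ?y"
    using c k a in_carrier by (simp add: cj_mult)
  then show "conj_act k r (a \<otimes> x) = conj_act k r x"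
    using c k a coset_sectionD(3) [OF r] cj_A by (simp add: conj_act_def)
qed

lemma section_diff_left_act:
  assumes r: "coset_section r" "coset_section s" and k: "k \<in> K"
  shows "section_diff (left_act k r) (left_act k s) = cj k (section_diff r s)"
proof (rule section_diff_transform [where t = "\<lambda>x. k \<otimes> x"])
  fix x y assume xy: "x \<in> K" "y \<in> K"
  have "k \<otimes> x \<otimes> inv (k \<otimes> y) = cj k (x \<otimes> inv y)"
    using xy k in_carrier by (simp add: conj_by_def m_assoc inv_mult_group)
  then show "k \<otimes> x \<otimes> inv (k \<otimes> y) \<in> A \<longleftrightarrow> x \<otimes> inv y \<in> A"
    using xy k in_carrier by (simp add: cj_A_iff)
next
  fix x assume x: "x \<in> K"
  have "r x \<in> carrier G" "s x \<in> carrier G" "k \<in> carrier G" "x \<in> carrier G"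
    using x k coset_sectionD(1) r in_carrier by auto
  then show "left_act k r (k \<otimes> x) \<otimes> inv (left_act k s (k \<otimes> x)) = cj k (r x \<otimes> inv (s x))"
    by (simp add: left_act_def conj_by_def m_assoc inv_mult_group)
qed (use assms left_act_section cj_A in_carrier K_closed in \<open>auto simp: cj_mult\<close>)

lemma section_diff_conj_act:
  assumes r: "coset_section r" "coset_section s" and k: "k \<in> carrier G"
  shows "section_diff (conj_act k r) (conj_act k s) = cj k (section_diff r s)"
proof (rule section_diff_transform [where t = "\<lambda>x. cj k x"])
  fix x y assume xy: "x \<in> K" "y \<in> K"
  have "cj k x \<otimes> inv (cj k y) = cj k (x \<otimes> inv y)"
    using xy k in_carrier by (simp add: cj_mult cj_inv)
  then show "cj k x \<otimes> inv (cj k y) \<in> A \<longleftrightarrow> x \<otimes> inv y \<in> A"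
    using xy k in_carrier by (simp add: cj_A_iff)
next
  fix x assume x: "x \<in> K"
  have "r x \<in> carrier G" "s x \<in> carrier G" "x \<in> carrier G"
    using x k coset_sectionD(1) r in_carrier by auto
  then show "conj_act k r (cj k x) \<otimes> inv (conj_act k s (cj k x)) = cj k (r x \<otimes> inv (s x))"
    using k by (simp add: conj_act_def cj_mult cj_inv)
qed (use assms conj_act_section cj_A cj_K in_carrier in \<open>auto simp: cj_mult\<close>)

text \<open>Call two sections equivalent if their difference is trivial. \<open>K\<close> acts on
  the classes by \<open>left_act\<close>, and this is the stabiliser of the class of
  \<open>r\<close>.\<close>

definition stab :: "('a \<Rightarrow> 'a) \<Rightarrow> 'a set"
  where "stab r = {k \<in> K. section_diff (left_act k r) r = \<one>}"

lemma left_act_mult: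
  assumes r: "coset_section r" and kl: "k \<in> K" "l \<in> K"
    and s: "coset_section s"
  shows "section_diff (left_act (k \<otimes> l) r) s = section_diff (left_act k (left_act l r)) s"
proof (rule section_diff_cong)
  fix x assume x: "x \<in> K"
  have "inv l \<otimes> (inv k \<otimes> x) \<in> K" using x kl K_closed by simp
  then have "r (inv l \<otimes> (inv k \<otimes> x)) \<in> carrier G" using coset_sectionD(1) [OF r] in_carrier by auto
  then show "left_act (k \<otimes> l) r x = left_act k (left_act l r) x"
    using x kl in_carrier by (simp add: left_act_def m_assoc inv_mult_group)
qed (use assms left_act_section in auto)

lemma stab_subgroup:
  assumes r: "coset_section r" shows "subgroup (stab r) G"
proof (rule submonoid_imp_subgroup)
  show "stab r \<subseteq> carrier G" using in_carrier by (auto simp: stab_def)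
  have "section_diff (left_act \<one> r) r = section_diff r r"
    by (rule section_diff_cong) (use r in_carrier coset_sectionD(1) [OF r] in \<open>auto simp: left_act_def\<close>)
  then show "\<one> \<in> stab r" using section_diff_self [OF r] K_closed by (simp add: stab_def)
  fix k l assume "k \<in> stab r" "l \<in> stab r"
  then have kl: "k \<in> K" "l \<in> K" "section_diff (left_act k r) r = \<one>" "section_diff (left_act l r) r = \<one>"
    by (auto simp: stab_def)
  have "section_diff (left_act (k \<otimes> l) r) r
      = section_diff (left_act k (left_act l r)) (left_act k r) \<otimes> section_diff (left_act k r) r"
    using r kl(1,2) left_act_section section_diff_mult left_act_mult by simp
  also have "\<dots> = \<one>" using r kl left_act_section in_carrier by (simp add: section_diff_left_act)
  finally show "k \<otimes> l \<in> stab r" using kl K_closed by (simp add: stab_def)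
qed

text \<open>For a in \<open>A\<close> the elements x and a^-1 x lie in the same coset, so every
  representative is multiplied by a, and each of the |K:A| factors gains one a. Hence
  \<open>A\<close> acts on the classes through |K:A|-th powers.\<close>

lemma section_diff_left_act_A:
  assumes r: "coset_section r" "coset_section s" and a: "a \<in> A"
  shows "section_diff (left_act a r) s = a [^] card cosets \<otimes> section_diff r s"
proof -
  have "section_diff (left_act a r) r = coset_prod (\<lambda>x. a)" unfolding section_diff_def
  proof (rule coset_prod_cong)
    fix x assume x: "x \<in> K"
    have "left_act a r x = a \<otimes> r x"
      using coset_sectionD(3) [OF r(1) x, of "inv a"] a A_closed by (simp add: left_act_def)
    then show "left_act a r x \<otimes> inv (r x) = a"
      using a x in_carrier coset_sectionD(1) [OF r(1)] by simp
  qed (use a in auto)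
  then have "section_diff (left_act a r) r = a [^] card cosets" using coset_prod_const [OF a] by simp
  then show ?thesis
    using section_diff_mult [of "left_act a r" r s] r a left_act_section in_carrier by simp
qed

text \<open>As for any action, the stabiliser of the translate by a is the conjugate by a; the
  calculation rests on (a k a^-1) a = a k.\<close>

lemma stab_left_act:
  assumes r: "coset_section r" and a: "a \<in> A" and k: "k \<in> stab r"
  shows "cj a k \<in> stab (left_act a r)"
proof -
  have aK: "a \<in> K" "a \<in> carrier G" and kK: "k \<in> K" "k \<in> carrier G"
    and ck: "cj a k \<in> K" using a k in_carrier cj_K by (auto simp: stab_def)
  have "section_diff (left_act (cj a k) (left_act a r)) (left_act a r)
      = section_diff (left_act (cj a k \<otimes> a) r) (left_act a r)"
    using left_act_mult [OF r ck aK(1) left_act_section [OF r aK(1)]] by simp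
  also have "cj a k \<otimes> a = a \<otimes> k" using aK kK by (simp add: conj_by_def)
  also have "section_diff (left_act (a \<otimes> k) r) (left_act a r)
      = section_diff (left_act a (left_act k r)) (left_act a r)"
    using left_act_mult [OF r aK(1) kK(1) left_act_section [OF r aK(1)]] .
  also have "\<dots> = \<one>"
    using r aK kK k left_act_section by (simp add: section_diff_left_act stab_def)
  finally show ?thesis using ck by (simp add: stab_def)
qed

text \<open>\<open>conj_act g\<close> carries the action of k to the action of g k g^-1, and it
  conjugates differences by g, so trivial ones stay trivial.\<close>

lemma stab_conj_act:
  assumes r: "coset_section r" and g: "g \<in> carrier G" and k: "k \<in> stab r"
  shows "cj g k \<in> stab (conj_act g r)"
proof -
  have kK: "k \<in> K" "k \<in> carrier G" and ck: "cj g k \<in> K"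
    using k g in_carrier cj_K by (auto simp: stab_def)
  have "section_diff (left_act (cj g k) (conj_act g r)) (conj_act g r)
      = section_diff (conj_act g (left_act k r)) (conj_act g r)"
  proof (rule section_diff_cong)
    fix x assume x: "x \<in> K"
    let ?y = "cj (inv g) x"
    have "?y \<in> K" using x g cj_K by simp
    then have "inv k \<otimes> ?y \<in> K" using kK K_closed by simp
    then have "r (inv k \<otimes> ?y) \<in> carrier G" using coset_sectionD(1) [OF r] in_carrier by auto
    moreover have "cj (inv g) (inv (cj g k) \<otimes> x) = inv k \<otimes> ?y"
      using g kK x in_carrier by (simp add: cj_mult cj_inv)
    ultimately show "left_act (cj g k) (conj_act g r) x = conj_act g (left_act k r) x"
      using g kK by (simp add: left_act_def conj_act_def cj_mult)
  qed (use r g kK ck left_act_section conj_act_section in auto)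
  also have "\<dots> = \<one>"
    using r g kK k left_act_section by (simp add: section_diff_conj_act stab_def)
  finally show ?thesis using ck by (simp add: stab_def)
qed

text \<open>The stabiliser depends only on the class: (k s|s) is the product of (k s|k r), (k r|r)
  and (r|s), each of them trivial.\<close>

lemma stab_eq:
  assumes r: "coset_section r" "coset_section s" and rs: "section_diff r s = \<one>"
  shows "stab r \<subseteq> stab s"
proof
  fix k assume k: "k \<in> stab r"
  then have kK: "k \<in> K" "section_diff (left_act k r) r = \<one>" by (auto simp: stab_def)
  have sr: "section_diff s r = \<one>"
    using section_diff_mult [OF r(2,1,2)] rs section_diff_self [OF r(2)]
      section_diff_closed [OF r(2,1)] in_carrier by simp
  have "section_diff (left_act k s) s = section_diff (left_act k s) (left_act k r) \<otimes> section_diff (left_act k r) s"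
    using r kK left_act_section by (simp add: section_diff_mult)
  also have "section_diff (left_act k r) s = section_diff (left_act k r) r \<otimes> section_diff r s"
    using r kK(1) left_act_section by (simp add: section_diff_mult)
  finally show "k \<in> stab s"
    using r kK rs sr in_carrier by (simp add: section_diff_left_act stab_def)
qed

text \<open>The complement is the stabiliser of a section \<open>r\<close>. Up to an element of \<open>A\<close>, every \<open>g\<close> maps
  \<open>r\<close> to a section with the same stabiliser, because raising to the power \<open>|K : A|\<close> is bijective on \<open>A\<close>.\<close>

theorem complement_exists:
  assumes cop: "coprime (card cosets) (card A)"
  shows "\<exists>T. subgroup T G \<and> T \<subseteq> K \<and> T \<inter> A = {\<one>} \<and> K \<subseteq> A <#> T \<and>
    (\<forall>g\<in>carrier G. \<exists>a\<in>A. \<forall>t\<in>T. cj (a \<otimes> g) t \<in> T)"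
proof -
  obtain r where r: "coset_section r" using coset_section_exists by blast
  \<comment> \<open>The equation for an element of \<open>A\<close> that translates a section back
    into the class of \<open>r\<close>. It is solvable because the |K:A|-th power map is
    onto.\<close>
  have solve: "\<exists>a\<in>A. a [^] card cosets \<otimes> b = \<one>" if b: "b \<in> A" for b
  proof -
    have "inv b \<in> (\<lambda>a. a [^] card cosets) ` A" using pow_surj [OF cop] b A_closed by simp
    then obtain a where "a \<in> A" "a [^] card cosets = inv b" by auto
    then show ?thesis using b in_carrier by (intro bexI [of _ a]) simp_all
  qed
  show ?thesis
  proof (intro exI conjI ballI)
    show T: "subgroup (stab r) G" by (rule stab_subgroup [OF r])
    show "stab r \<subseteq> K" by (auto simp: stab_def)
    show "stab r \<inter> A = {\<one>}"
    proof
      show "stab r \<inter> A \<subseteq> {\<one>}"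
      proof
        fix a assume a: "a \<in> stab r \<inter> A"
        then have "a [^] card cosets = \<one>"
          using section_diff_left_act_A [OF r r, of a] section_diff_self [OF r] in_carrier by (simp add: stab_def)
        then show "a \<in> {\<one>}" using coprime_pow_eq_one a cop by blast
      qed
      show "{\<one>} \<subseteq> stab r \<inter> A" using subgroup.one_closed [OF T] A_closed by simp
    qed
    show "K \<subseteq> A <#> stab r"
    proof
      fix k assume k: "k \<in> K"
      have kr: "coset_section (left_act k r)" using left_act_section r k by simp
      obtain a where a: "a \<in> A" "a [^] card cosets \<otimes> section_diff (left_act k r) r = \<one>"
        using solve section_diff_closed [OF kr r] by blast
      have "section_diff (left_act (a \<otimes> k) r) r = \<one>"
        using left_act_mult [OF r _ k r, of a] a in_carrier section_diff_left_act_A [OF kr r a(1)] by simp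
      then have "a \<otimes> k \<in> stab r" using a k in_carrier K_closed by (simp add: stab_def)
      then have "inv a \<otimes> (a \<otimes> k) \<in> A <#> stab r" using a A_closed by (intro set_multI) auto
      then show "k \<in> A <#> stab r" using a k in_carrier by simp
    qed
    fix g assume g: "g \<in> carrier G"
    have gr: "coset_section (conj_act g r)" using conj_act_section r g by simp
    obtain a where a: "a \<in> A" "a [^] card cosets \<otimes> section_diff (conj_act g r) r = \<one>"
      using solve section_diff_closed [OF gr r] by blast
    have agr: "coset_section (left_act a (conj_act g r))" using left_act_section gr a in_carrier by simp
    have "cj (a \<otimes> g) t \<in> stab r" if t: "t \<in> stab r" for t
    proof -
      have "cj a (cj g t) \<in> stab (left_act a (conj_act g r))"
        using stab_left_act [OF gr a(1)] stab_conj_act [OF r g t] by simp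
      also have "\<dots> \<subseteq> stab r"
        by (rule stab_eq [OF agr r]) (use section_diff_left_act_A [OF gr r a(1)] a in simp)
      finally show ?thesis using g a t in_carrier by (simp add: cj_cj stab_def)
    qed
    then show "\<exists>a\<in>A. \<forall>t\<in>stab r. cj (a \<otimes> g) t \<in> stab r" using a by blast
  qed
qed

end

section \<open>Transfer into an abelian subgroup\<close>

context abelian_subgroup
begin

lemma right_act_section:
  assumes r: "coset_section r" and k: "k \<in> K" shows "coset_section (right_act k r)"
  unfolding coset_section_def coset_invariant_def
proof (intro conjI ballI)
  fix x assume x: "x \<in> K"
  have c: "x \<in> carrier G" "k \<in> carrier G" "x \<otimes> inv k \<in> K" "r (x \<otimes> inv k) \<in> carrier G"
    using x k in_carrier K_closed coset_sectionD(1) [OF r] by auto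
  show "right_act k r x \<in> K"
    using c k coset_sectionD(1) [OF r] K_closed by (simp add: right_act_def)
  have "right_act k r x \<otimes> inv x = r (x \<otimes> inv k) \<otimes> inv (x \<otimes> inv k)"
    using c by (simp add: right_act_def m_assoc inv_mult_group)
  then show "right_act k r x \<otimes> inv x \<in> A"
    using c coset_sectionD(2) [OF r] by simp
  fix a assume a: "a \<in> A"
  have "a \<otimes> x \<otimes> inv k = a \<otimes> (x \<otimes> inv k)" using c a in_carrier by (simp add: m_assoc)
  then show "right_act k r (a \<otimes> x) = right_act k r x"
    using c a coset_sectionD(3) [OF r] by (simp add: right_act_def)
qed

lemma section_diff_right_act:
  assumes r: "coset_section r" "coset_section s" and k: "k \<in> K"
  shows "section_diff (right_act k r) (right_act k s) = section_diff r s"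
proof (rule section_diff_transform [where t = "\<lambda>x. x \<otimes> k" and \<sigma> = "\<lambda>x. x"])
  fix x y assume xy: "x \<in> K" "y \<in> K"
  then show "x \<otimes> k \<otimes> inv (y \<otimes> k) \<in> A \<longleftrightarrow> x \<otimes> inv y \<in> A"
    using k in_carrier by (simp add: m_assoc inv_mult_group)
next
  fix x assume x: "x \<in> K"
  have "r x \<in> carrier G" "s x \<in> carrier G" "k \<in> carrier G" "x \<in> carrier G"
    using x k coset_sectionD(1) r in_carrier by auto
  then show "right_act k r (x \<otimes> k) \<otimes> inv (right_act k s (x \<otimes> k)) = r x \<otimes> inv (s x)"
    by (simp add: right_act_def m_assoc inv_mult_group)
qed (use assms right_act_section K_closed in auto)

definition transfer :: "('a \<Rightarrow> 'a) \<Rightarrow> 'a \<Rightarrow> 'a"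
  where "transfer r k = section_diff (right_act k r) r"

lemma transfer_closed: "coset_section r \<Longrightarrow> k \<in> K \<Longrightarrow> transfer r k \<in> A"
  unfolding transfer_def by (intro section_diff_closed right_act_section)

text \<open>(R k l|R) = (R k l|R l)(R l|R), and the common right translation by l cancels from the
  first quotient.\<close>

lemma transfer_mult:
  assumes r: "coset_section r" and kl: "k \<in> K" "l \<in> K"
  shows "transfer r (k \<otimes> l) = transfer r k \<otimes> transfer r l"
proof -
  have "transfer r (k \<otimes> l) = section_diff (right_act l (right_act k r)) r"
    unfolding transfer_def
  proof (rule section_diff_cong)
    fix x assume x: "x \<in> K"
    have "x \<otimes> inv l \<otimes> inv k \<in> K" using x kl K_closed by simp
    then have "r (x \<otimes> inv l \<otimes> inv k) \<in> carrier G" using coset_sectionD(1) [OF r] in_carrier by auto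
    then show "right_act (k \<otimes> l) r x = right_act l (right_act k r) x"
      using x kl in_carrier by (simp add: right_act_def m_assoc inv_mult_group)
  qed (use r kl right_act_section in auto)
  also have "\<dots> = section_diff (right_act l (right_act k r)) (right_act l r) \<otimes> section_diff (right_act l r) r"
    using r kl right_act_section by (simp add: section_diff_mult)
  finally show ?thesis using r kl right_act_section by (simp add: section_diff_right_act transfer_def)
qed

text \<open>On the double coset \<open>A t A\<close> put \<open>F (a t b) = a b\<close>; this is well defined since no two elements of
  \<open>A\<close> are fused.\<close>

lemma biequivariant_exists:
  assumes unfused: "\<And>x a. x \<in> K \<Longrightarrow> a \<in> A \<Longrightarrow> cj x a \<in> A \<Longrightarrow> cj x a = a"
  shows "\<exists>F. (\<forall>x\<in>K. F x \<in> A) \<and> (\<forall>x\<in>K. \<forall>a\<in>A. F (a \<otimes> x) = a \<otimes> F x \<and> F (x \<otimes> a) = F x \<otimes> a)"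
proof -
  \<comment> \<open>The double coset A x A. \<open>t\<close> picks one element in each double coset,
    and \<open>P x f\<close> says that f = a b for some way of writing x = a t b.\<close>
  define dc where "dc x = {a \<otimes> x \<otimes> b |a b. a \<in> A \<and> b \<in> A}" for x
  define t where "t x = (SOME y. y \<in> dc x)" for x
  define P where "P x f \<longleftrightarrow> (\<exists>a\<in>A. \<exists>b\<in>A. x = a \<otimes> t x \<otimes> b \<and> f = a \<otimes> b)" for x f
  define F where "F x = (SOME f. P x f)" for x
  have t: "t x \<in> K \<and> (\<exists>f. P x f)" if x: "x \<in> K" for x
  proof -
    have "x \<in> dc x" using x in_carrier A_closed unfolding dc_def by (auto intro!: exI [of _ \<one>])
    then have "t x \<in> dc x" unfolding t_def by (rule someI)
    then obtain a b where ab: "a \<in> A" "b \<in> A" "t x = a \<otimes> x \<otimes> b" unfolding dc_def by auto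
    then have "x = inv a \<otimes> t x \<otimes> inv b" using x in_carrier by (simp add: m_assoc)
    then have "P x (inv a \<otimes> inv b)" using ab A_closed unfolding P_def by blast
    then show ?thesis using ab x in_carrier K_closed by auto
  qed
  \<comment> \<open>From a t b = a' t b' follows t (b' b^-1) t^-1 = a'^-1 a. Both b' b^-1 and its
    conjugate lie in \<open>A\<close>, so they are equal, whence a b = a' b'.\<close>
  have uniq: "f = f'" if x: "x \<in> K" and f: "P x f" "P x f'" for x f f'
  proof -
    obtain a b where ab: "a \<in> A" "b \<in> A" "x = a \<otimes> t x \<otimes> b" "f = a \<otimes> b" using f P_def by auto
    obtain a' b' where ab': "a' \<in> A" "b' \<in> A" "x = a' \<otimes> t x \<otimes> b'" "f' = a' \<otimes> b'" using f P_def by auto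
    have c: "a \<in> carrier G" "b \<in> carrier G" "a' \<in> carrier G" "b' \<in> carrier G" "t x \<in> carrier G"
      using ab ab' t [OF x] in_carrier by auto
    have "a \<otimes> t x \<otimes> b = a' \<otimes> t x \<otimes> b'" using ab(3) ab'(3) by simp
    then have "inv a' \<otimes> (a \<otimes> t x \<otimes> b) \<otimes> inv b = inv a' \<otimes> (a' \<otimes> t x \<otimes> b') \<otimes> inv b" by simp
    then have eq: "inv a' \<otimes> a \<otimes> t x = t x \<otimes> (b' \<otimes> inv b)" using c by (simp add: m_assoc)
    have "cj (t x) (b' \<otimes> inv b) = inv a' \<otimes> a \<otimes> t x \<otimes> inv (t x)"
      using c eq by (simp add: conj_by_def)
    also have "\<dots> = inv a' \<otimes> a" using c by (simp add: m_assoc)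
    finally have "cj (t x) (b' \<otimes> inv b) = inv a' \<otimes> a" .
    then have "b' \<otimes> inv b = inv a' \<otimes> a"
      using unfused [of "t x" "b' \<otimes> inv b"] t [OF x] ab ab' A_closed by simp
    then have "a' \<otimes> (b' \<otimes> inv b) \<otimes> b = a' \<otimes> (inv a' \<otimes> a) \<otimes> b" by simp
    then show ?thesis using c ab(4) ab'(4) by (simp add: m_assoc)
  qed
  have F: "P x (F x)" if "x \<in> K" for x unfolding F_def using t [OF that] by (auto intro: someI_ex)
  have FA: "F x \<in> A" if "x \<in> K" for x using F [OF that] A_closed unfolding P_def by auto
  have dc_left: "dc (a \<otimes> x) = dc x" if "x \<in> K" "a \<in> A" for x a
  proof -
    have "dc (a \<otimes> x) \<subseteq> dc x" if "x \<in> K" "a \<in> A" for x a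
    proof
      fix y assume "y \<in> dc (a \<otimes> x)"
      then obtain c d where cd: "c \<in> A" "d \<in> A" "y = c \<otimes> (a \<otimes> x) \<otimes> d" unfolding dc_def by auto
      then have "y = (c \<otimes> a) \<otimes> x \<otimes> d" using that in_carrier by (simp add: m_assoc)
      then show "y \<in> dc x" using cd that A_closed unfolding dc_def by blast
    qed
    from this [OF that] this [of "a \<otimes> x" "inv a"] show ?thesis
      using that in_carrier K_closed A_closed by auto
  qed
  have dc_right: "dc (x \<otimes> a) = dc x" if "x \<in> K" "a \<in> A" for x a
  proof -
    have "dc (x \<otimes> a) \<subseteq> dc x" if "x \<in> K" "a \<in> A" for x a
    proof
      fix y assume "y \<in> dc (x \<otimes> a)"
      then obtain c d where cd: "c \<in> A" "d \<in> A" "y = c \<otimes> (x \<otimes> a) \<otimes> d" unfolding dc_def by auto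
      then have "y = c \<otimes> x \<otimes> (a \<otimes> d)" using that in_carrier by (simp add: m_assoc)
      then show "y \<in> dc x" using cd that A_closed unfolding dc_def by blast
    qed
    from this [OF that] this [of "x \<otimes> a" "inv a"] show ?thesis
      using that in_carrier K_closed A_closed by auto
  qed
  have "F (a \<otimes> x) = a \<otimes> F x \<and> F (x \<otimes> a) = F x \<otimes> a" if x: "x \<in> K" and a: "a \<in> A" for x a
  proof
    have tl: "t (a \<otimes> x) = t x" "t (x \<otimes> a) = t x" using dc_left dc_right x a by (simp_all add: t_def)
    obtain c d where cd: "c \<in> A" "d \<in> A" "x = c \<otimes> t x \<otimes> d" "F x = c \<otimes> d" using F [OF x] P_def by auto
    have cc: "c \<in> carrier G" "d \<in> carrier G" "a \<in> carrier G" "t x \<in> carrier G"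
      using cd a t [OF x] in_carrier by auto
    have "a \<otimes> x = (a \<otimes> c) \<otimes> t x \<otimes> d" using cd(3) cc by (metis m_assoc m_closed)
    then have "P (a \<otimes> x) (a \<otimes> F x)"
      unfolding P_def tl using cd a cc A_closed by (intro bexI [of _ "a \<otimes> c"] bexI [of _ d]) (simp_all add: m_assoc)
    then show "F (a \<otimes> x) = a \<otimes> F x"
      using uniq [of "a \<otimes> x"] F [of "a \<otimes> x"] x a in_carrier K_closed by simp
    have "x \<otimes> a = c \<otimes> t x \<otimes> (d \<otimes> a)" using cd(3) cc by (metis m_assoc m_closed)
    then have "P (x \<otimes> a) (F x \<otimes> a)"
      unfolding P_def tl using cd a cc A_closed by (intro bexI [of _ c] bexI [of _ "d \<otimes> a"]) (simp_all add: m_assoc)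
    then show "F (x \<otimes> a) = F x \<otimes> a"
      using uniq [of "x \<otimes> a"] F [of "x \<otimes> a"] x a in_carrier K_closed by simp
  qed
  then show ?thesis using FA by blast
qed

text \<open>Let F be the two-sided equivariant map and h = F o r. The factor e of the transfer at x
  satisfies e r(x) = r(x q^-1) q; applying F gives e = q h(x q^-1) h(x)^-1. As x -> x q^-1 permutes
  the cosets, the factors with h cancel in the product and q remains once for each coset.\<close>

lemma transfer_unfused:
  assumes unfused: "\<And>x a. x \<in> K \<Longrightarrow> a \<in> A \<Longrightarrow> cj x a \<in> A \<Longrightarrow> cj x a = a"
    and r: "coset_section r" and q: "q \<in> A"
  shows "transfer r q = q [^] card cosets"
proof -
  obtain F where FA: "\<And>x. x \<in> K \<Longrightarrow> F x \<in> A"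
    and Fl: "\<And>x a. x \<in> K \<Longrightarrow> a \<in> A \<Longrightarrow> F (a \<otimes> x) = a \<otimes> F x"
    and Fr: "\<And>x a. x \<in> K \<Longrightarrow> a \<in> A \<Longrightarrow> F (x \<otimes> a) = F x \<otimes> a"
    using biequivariant_exists [OF unfused] by blast
  have qK: "q \<in> K" "q \<in> carrier G" using q in_carrier by auto
  let ?h = "\<lambda>x. F (r x)"
  have hA: "?h x \<in> A" if "x \<in> K" for x using that coset_sectionD(1) [OF r] FA by simp
  have inv: "coset_invariant ?h" using coset_sectionD(3) [OF r] by (simp add: coset_invariant_def)
  have "transfer r q = coset_prod (\<lambda>x. q \<otimes> (?h (x \<otimes> inv q) \<otimes> inv (?h x)))"
    unfolding transfer_def section_diff_def
  proof (rule coset_prod_cong)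
    fix x assume x: "x \<in> K"
    let ?y = "r (x \<otimes> inv q)"
    let ?e = "right_act q r x \<otimes> inv (r x)"
    have xq: "x \<otimes> inv q \<in> K" using x qK K_closed by simp
    have K: "?y \<in> K" "r x \<in> K" using xq x coset_sectionD(1) [OF r] by auto
    have e: "?e \<in> A" using section_quotient [OF right_act_section [OF r qK(1)] r x] .
    have "?e \<otimes> r x = ?y \<otimes> q" using K qK in_carrier by (simp add: right_act_def)
    then have "?e \<otimes> F (r x) = F ?y \<otimes> q" using Fl [OF K(2) e] Fr [OF K(1) q] by simp
    also have "\<dots> = q \<otimes> F ?y" using A_comm FA K q by simp
    finally have "?e \<otimes> F (r x) \<otimes> inv (F (r x)) = q \<otimes> F ?y \<otimes> inv (F (r x))" by simp
    then show "?e = q \<otimes> (F ?y \<otimes> inv (F (r x)))"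
      using e K FA q in_carrier by (simp add: m_assoc)
  next
    fix x assume x: "x \<in> K"
    then have "x \<otimes> inv q \<in> K" using qK K_closed by simp
    then show "q \<otimes> (?h (x \<otimes> inv q) \<otimes> inv (?h x)) \<in> A" using x q hA A_closed by simp
  qed
  also have "\<dots> = coset_prod (\<lambda>x. q) \<otimes> (coset_prod (\<lambda>x. ?h (x \<otimes> inv q)) \<otimes> coset_prod (\<lambda>x. inv (?h x)))"
    using hA q qK A_closed K_closed by (simp add: coset_prod_mult)
  also have "coset_prod (\<lambda>x. ?h (x \<otimes> inv q)) = coset_prod ?h"
  proof (rule coset_prod_reindex [OF inv])
    fix x y assume "x \<in> K" "y \<in> K"
    then show "x \<otimes> inv q \<otimes> inv (y \<otimes> inv q) \<in> A \<longleftrightarrow> x \<otimes> inv y \<in> A"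
      using qK in_carrier by (simp add: m_assoc inv_mult_group)
  qed (use hA qK K_closed in auto)
  also have "coset_prod ?h \<otimes> coset_prod (\<lambda>x. inv (?h x)) = \<one>"
  proof -
    have "coset_prod ?h \<otimes> coset_prod (\<lambda>x. inv (?h x)) = coset_prod (\<lambda>x. ?h x \<otimes> inv (?h x))"
      using hA A_closed by (simp add: coset_prod_mult)
    also have "\<dots> = coset_prod (\<lambda>x. \<one>)"
      by (rule coset_prod_cong) (use hA in_carrier A_closed in auto)
    finally show ?thesis using coset_prod_const [of \<one>] A_closed by simp
  qed
  finally show ?thesis using coset_prod_const [OF q] qK by simp
qed

text \<open>The transfer restricted to \<open>A\<close> is a power map, bijective by coprimality, so
  its kernel L is a complement of \<open>A\<close> of order |K:A|. An element killed by |K:A| has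
  trivial transfer and lies in L; conversely Lagrange applies in L. Describing L by an exponent
  makes it invariant under everything that normalises \<open>K\<close>.\<close>

theorem unfused_complement:
  assumes unfused: "\<And>x a. x \<in> K \<Longrightarrow> a \<in> A \<Longrightarrow> cj x a \<in> A \<Longrightarrow> cj x a = a"
    and cop: "coprime (card cosets) (card A)"
    and xy: "x \<in> K" "y \<in> K" "x [^] card cosets = \<one>" "y [^] card cosets = \<one>"
  shows "(x \<otimes> y) [^] card cosets = \<one>"
proof -
  obtain r where r: "coset_section r" using coset_section_exists by blast
  let ?\<tau> = "transfer r"
  let ?m = "card cosets"
  define L where "L = {k \<in> K. ?\<tau> k = \<one>}"
  have pow: "?\<tau> (k [^] (n::nat)) = ?\<tau> k [^] n" if "k \<in> K" for k n
  proof (induction n)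
    case 0
    have "?\<tau> \<one> = ?\<tau> \<one> \<otimes> ?\<tau> \<one>" using transfer_mult [OF r, of \<one> \<one>] K_closed by simp
    then show ?case using transfer_closed [OF r] K_closed in_carrier by simp
  next
    case (Suc n)
    then show ?case using that transfer_mult [OF r] subgroup_pow [OF K_sub] by simp
  qed
  have one: "?\<tau> \<one> = \<one>" using pow [of \<one> 0] K_closed by simp
  have L: "subgroup L G"
    by (rule submonoid_imp_subgroup) (use r one transfer_mult K_closed in_carrier in \<open>auto simp: L_def\<close>)
  have in_L: "k \<in> L" if "k \<in> K" "k [^] ?m = \<one>" for k
    using that pow [of k ?m] one transfer_closed [OF r] coprime_pow_eq_one cop by (simp add: L_def)
  have LA: "a = \<one>" if "a \<in> A" "a \<in> L" for a
    using coprime_pow_eq_one [OF that(1) _ cop] that transfer_unfused [OF unfused r that(1)]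
    by (simp add: L_def)
  \<comment> \<open>Only the order of L is wanted, and counting the pairs yields it: k is matched
    with the a in \<open>A\<close> that has the same transfer.\<close>
  have "bij_betw (\<lambda>(l, a). l \<otimes> a) (L \<times> A) K"
    unfolding bij_betw_def
  proof
    have LK: "l \<in> K" if "l \<in> L" for l using that by (simp add: L_def)
    show "inj_on (\<lambda>(l, a). l \<otimes> a) (L \<times> A)"
    proof (rule inj_onI, clarsimp)
      fix l a l' a' assume h: "l \<in> L" "a \<in> A" "l' \<in> L" "a' \<in> A" "l \<otimes> a = l' \<otimes> a'"
      have c: "l \<in> carrier G" "a \<in> carrier G" "l' \<in> carrier G" "a' \<in> carrier G"
        using h LK in_carrier by auto
      have "inv l' \<otimes> (l \<otimes> a) \<otimes> inv a = inv l' \<otimes> (l' \<otimes> a') \<otimes> inv a" using h by simp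
      then have eq: "inv l' \<otimes> l = a' \<otimes> inv a" using c by (simp add: m_assoc)
      have "inv l' \<otimes> l \<in> L" using h L by (simp add: subgroup.m_closed subgroup.m_inv_closed)
      then have "a' \<otimes> inv a = \<one>" using LA eq h A_closed by simp
      then have "a' = a" using c by (metis inv_mult_cancel_right(1) l_one)
      then show "l = l' \<and> a = a'" using h c by simp
    qed
    show "(\<lambda>(l, a). l \<otimes> a) ` (L \<times> A) = K"
    proof
      show "(\<lambda>(l, a). l \<otimes> a) ` (L \<times> A) \<subseteq> K" using LK in_carrier K_closed by auto
      show "K \<subseteq> (\<lambda>(l, a). l \<otimes> a) ` (L \<times> A)"
      proof
        fix k assume k: "k \<in> K"
        obtain a where a: "a \<in> A" "?\<tau> a = ?\<tau> k"
          using pow_surj [OF cop] transfer_closed [OF r k] transfer_unfused [OF unfused r] by force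
        have "?\<tau> (k \<otimes> inv a) \<otimes> ?\<tau> a = ?\<tau> k"
          using transfer_mult [OF r, of "k \<otimes> inv a" a] a k in_carrier K_closed by simp
        then have "?\<tau> (k \<otimes> inv a) = \<one>"
          using a k in_carrier K_closed transfer_closed [OF r] by simp
        then have "k \<otimes> inv a \<in> L" using a k in_carrier K_closed by (simp add: L_def)
        moreover have "k = (k \<otimes> inv a) \<otimes> a" using a k in_carrier by simp
        ultimately show "k \<in> (\<lambda>(l, a). l \<otimes> a) ` (L \<times> A)" using a by force
      qed
    qed
  qed
  then have "card L * card A = card K" using bij_betw_same_card by (fastforce simp: card_cartesian_product)
  then have "card L = ?m" using card_cosets card_subgroup_pos [OF A_sub] by (metis mult_cancel2 neq0_conv)
  moreover have "x \<otimes> y \<in> L" using in_L xy L by (simp add: subgroup.m_closed)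
  ultimately show ?thesis using pow_card_eq_one [OF L] by metis
qed

end

section \<open>Quotients and normal complements relative to a normal subgroup\<close>

locale normal_quotient = finite_group +
  fixes E
  assumes E_normal: "E \<lhd> G"
begin

abbreviation q :: "'a \<Rightarrow> 'a set" where "q x \<equiv> E #> x"

lemma E_sub: "subgroup E G" using E_normal by (rule normal_imp_subgroup)

sublocale Q: finite_group "G Mod E" using E_normal by (rule finite_group_Mod)

sublocale hom: group_hom G "G Mod E" q
  by unfold_locales (rule normal.r_coset_hom_Mod [OF E_normal])

lemma carrier_quotient: "carrier (G Mod E) = q ` carrier G" by (rule carrier_FactGroup)

lemma q_mult: "x \<in> carrier G \<Longrightarrow> y \<in> carrier G \<Longrightarrow> q (x \<otimes> y) = q x \<otimes>\<^bsub>G Mod E\<^esub> q y"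
  by (rule hom.hom_mult)

lemma q_pow: "x \<in> carrier G \<Longrightarrow> q x [^]\<^bsub>G Mod E\<^esub> (n::nat) = q (x [^] n)"
  by (rule normal.FactGroup_pow [OF E_normal])

lemma q_conj: "g \<in> carrier G \<Longrightarrow> x \<in> carrier G \<Longrightarrow> conj_by (G Mod E) (q g) (q x) = q (cj g x)"
  unfolding conj_by_def by (simp only: hom.hom_inv [symmetric] q_mult [symmetric] inv_closed m_closed)

lemma q_eq_iff: "x \<in> carrier G \<Longrightarrow> y \<in> carrier G \<Longrightarrow> q x = q y \<longleftrightarrow> x \<otimes> inv y \<in> E"
  using repr_independence [of x E y] repr_independenceD [OF E_sub, of x y]
    subgroup.rcos_module [OF E_sub group_axioms, of y x] E_sub by auto

lemma q_one_iff: "x \<in> carrier G \<Longrightarrow> q x = E \<longleftrightarrow> x \<in> E"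
  using coset_join1 [of E x] coset_join2 [of x E] E_sub by auto

lemma q_image_iff:
  assumes "subgroup H G" "E \<subseteq> H" "x \<in> carrier G" shows "q x \<in> q ` H \<longleftrightarrow> x \<in> H"
proof
  assume "q x \<in> q ` H"
  then obtain h where h: "h \<in> H" "q x = q h" by auto
  then have "x \<otimes> inv h \<in> H" using assms q_eq_iff [of x h] subgroup_carrier by auto
  then show "x \<in> H" using h assms subgroup_carrier
    by (simp add: subgroup_cancel_right subgroup.m_inv_closed)
qed auto

lemma q_subgroup: "subgroup H G \<Longrightarrow> subgroup (q ` H) (G Mod E)"
  by (rule hom.subgroup_img_is_subgroup)

lemma q_normal: "H \<lhd> G \<Longrightarrow> q ` H \<lhd> G Mod E"
  using normal.surj_hom_normal_subgroup [OF _ hom.group_hom_axioms] carrier_quotient by simp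

lemma card_q_image:
  assumes H: "subgroup H G" "E \<subseteq> H" shows "card (q ` H) * card E = card H"
proof -
  have "q ` H = rcosets\<^bsub>G\<lparr>carrier := H\<rparr>\<^esub> E" by (auto simp: RCOSETS_def)
  then show ?thesis
    using group.lagrange [OF subgroup_imp_group [OF H(1)] subgroup_incl [OF E_sub H]]
    by (simp add: order_def)
qed

definition preimage :: "'a set set \<Rightarrow> 'a set" where "preimage T = {x \<in> carrier G. q x \<in> T}"

lemma preimage_subgroup:
  assumes T: "subgroup T (G Mod E)" shows "subgroup (preimage T) G"
proof (rule submonoid_imp_subgroup)
  show "\<one> \<in> preimage T" using subgroup.one_closed [OF T] E_sub
    by (simp add: preimage_def subgroup.subset)
  show "x \<otimes> y \<in> preimage T" if "x \<in> preimage T" "y \<in> preimage T" for x y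
    using that subgroup.m_closed [OF T] by (simp add: preimage_def q_mult del: mult_FactGroup)
qed (auto simp: preimage_def)

lemma E_subset_preimage: "subgroup T (G Mod E) \<Longrightarrow> E \<subseteq> preimage T"
  using subgroup.one_closed [of T "G Mod E"] q_one_iff subgroup_carrier [OF E_sub]
  by (metis (no_types, lifting) mem_Collect_eq one_FactGroup preimage_def subsetI)

end

text \<open>The p-nilpotency of G/B, expressed by elements of G: K/B has exponent dividing m, which
  is prime to p, and G/K has exponent dividing p^k. For finite groups \<open>index_not_dvd\<close>
  and \<open>index_prime_power\<close> turn exponents into orders.\<close>

definition p_nilpotent_over :: "nat \<Rightarrow> ('a, 'b) monoid_scheme \<Rightarrow> 'a set \<Rightarrow> bool"
  where "p_nilpotent_over p G B \<longleftrightarrow> B \<lhd> G \<and>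
    (\<exists>K m k. K \<lhd> G \<and> B \<subseteq> K \<and> \<not> p dvd (m::nat) \<and> (\<forall>x\<in>K. x [^]\<^bsub>G\<^esub> m \<in> B) \<and>
      (\<forall>x\<in>carrier G. x [^]\<^bsub>G\<^esub> (p ^ k) \<in> K))"

section \<open>Descent of p-nilpotency along a normal p-section\<close>

context finite_group
begin

text \<open>G/(A meet B) embeds into the product of G/A and G/B. In terms of exponents one
  intersects the two subgroups and multiplies the exponents.\<close>

lemma p_nilpotent_over_Int:
  assumes p: "Factorial_Ring.prime p" and A: "p_nilpotent_over p G A" and B: "p_nilpotent_over p G B"
  shows "p_nilpotent_over p G (A \<inter> B)"
proof -
  obtain K m k where K: "A \<lhd> G" "K \<lhd> G" "A \<subseteq> K" "\<not> p dvd (m::nat)"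
    "\<And>x. x \<in> K \<Longrightarrow> x [^] m \<in> A" "\<And>x. x \<in> carrier G \<Longrightarrow> x [^] (p ^ k) \<in> K"
    using A unfolding p_nilpotent_over_def by blast
  obtain L n l where L: "B \<lhd> G" "L \<lhd> G" "B \<subseteq> L" "\<not> p dvd (n::nat)"
    "\<And>x. x \<in> L \<Longrightarrow> x [^] n \<in> B" "\<And>x. x \<in> carrier G \<Longrightarrow> x [^] (p ^ l) \<in> L"
    using B unfolding p_nilpotent_over_def by blast
  note sub = K(1,2) [THEN normal_imp_subgroup] L(1,2) [THEN normal_imp_subgroup]
  show ?thesis unfolding p_nilpotent_over_def
  proof (intro conjI exI ballI)
    show "A \<inter> B \<lhd> G" "K \<inter> L \<lhd> G" using K L normal_subgroup_intersect by auto
    show "A \<inter> B \<subseteq> K \<inter> L" using K L by auto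
    show "\<not> p dvd m * n" using K(4) L(4) p by (simp add: prime_dvd_mult_iff)
    show "x [^] (m * n) \<in> A \<inter> B" if "x \<in> K \<inter> L" for x
    proof
      have c: "x \<in> carrier G" using that sub subgroup_carrier by blast
      show "x [^] (m * n) \<in> A" using pow_dvd_mem [OF sub(1) c K(5), of "m * n"] that by simp
      show "x [^] (m * n) \<in> B" using pow_dvd_mem [OF sub(3) c L(5), of "m * n"] that by simp
    qed
    show "x [^] (p ^ (k + l)) \<in> K \<inter> L" if c: "x \<in> carrier G" for x
    proof
      show "x [^] (p ^ (k + l)) \<in> K"
        using pow_dvd_mem [OF sub(2) c K(6) [OF c], of "p ^ (k + l)"] by (simp add: power_add)
      show "x [^] (p ^ (k + l)) \<in> L"
        using pow_dvd_mem [OF sub(4) c L(6) [OF c], of "p ^ (k + l)"] by (simp add: power_add)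
    qed
  qed
qed

text \<open>\<open>complement_exists\<close> for the abelian section Z/E of G/E, pulled back to G;
  \<open>ab\<close> is the commutativity of Z/E. The last conjunct is a Frattini property, G = Z
  N(T).\<close>

lemma abelian_section_complement:
  assumes p: "Factorial_Ring.prime p" and E: "E \<lhd> G" and Z: "Z \<lhd> G" and EZ: "E \<subseteq> Z"
    and card: "card Z = card E * p ^ j"
    and ab: "\<And>x y. x \<in> Z \<Longrightarrow> y \<in> Z \<Longrightarrow> cj x y \<otimes> inv y \<in> E"
    and K: "K \<lhd> G" "Z \<subseteq> K" and m: "\<not> p dvd (m::nat)" "\<And>x. x \<in> K \<Longrightarrow> x [^] m \<in> Z"
  shows "\<exists>T. subgroup T G \<and> E \<subseteq> T \<and> T \<subseteq> K \<and> T \<inter> Z = E \<and> K \<subseteq> Z <#> T \<and>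
    (\<forall>g\<in>carrier G. \<exists>a\<in>Z. \<forall>t\<in>T. cj (a \<otimes> g) t \<in> T)"
proof -
  interpret normal_quotient G E by (intro normal_quotient.intro normal_quotient_axioms.intro finite_group_axioms E)
  note Zs = normal_imp_subgroup [OF Z] and Ks = normal_imp_subgroup [OF K(1)]
  have Zc: "x \<in> carrier G" if "x \<in> Z" for x using subgroup_carrier [OF Zs that] .
  have Kc: "x \<in> carrier G" if "x \<in> K" for x using subgroup_carrier [OF Ks that] .
  have EK: "E \<subseteq> K" using EZ K by auto
  interpret AN: abelian_normal_subgroup "G Mod E" "q ` Z" "q ` K"
  proof (intro abelian_normal_subgroup.intro abelian_subgroup.intro abelian_subgroup_axioms.intro
      abelian_normal_subgroup_axioms.intro Q.finite_group_axioms)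
    show "subgroup (q ` Z) (G Mod E)" "subgroup (q ` K) (G Mod E)" "q ` Z \<subseteq> q ` K"
      using q_subgroup Zs Ks K by auto
    show "q ` Z \<lhd> G Mod E" "q ` K \<lhd> G Mod E" using q_normal Z K by auto
    fix a b assume "a \<in> q ` Z" "b \<in> q ` Z"
    then obtain x y where xy: "x \<in> Z" "y \<in> Z" "a = q x" "b = q y" by auto
    have c: "x \<in> carrier G" "y \<in> carrier G" using xy Zc by auto
    have "x \<otimes> y \<otimes> inv (y \<otimes> x) = cj x y \<otimes> inv y"
      using c by (simp add: conj_by_def m_assoc inv_mult_group)
    then have "q (x \<otimes> y) = q (y \<otimes> x)" using ab [OF xy(1,2)] c by (subst q_eq_iff) auto
    then show "a \<otimes>\<^bsub>G Mod E\<^esub> b = b \<otimes>\<^bsub>G Mod E\<^esub> a"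
      using xy c by (simp add: q_mult del: mult_FactGroup)
  qed
  have cardZ: "card (q ` Z) = p ^ j"
    using card_q_image [OF Zs EZ] card card_subgroup_pos [OF E_sub] by simp
  have "\<not> p dvd card AN.cosets"
  proof (rule Q.index_not_dvd [OF p AN.A_sub AN.K_sub AN.A_le_K])
    show "card (q ` K) = card (q ` Z) * card AN.cosets"
      using AN.card_cosets by (simp add: mult.commute)
    show "x [^]\<^bsub>G Mod E\<^esub> m \<in> q ` Z" if "x \<in> q ` K" for x
      using that m(2) Kc by (auto simp: q_pow)
  qed (use m in simp)
  then have "coprime (card AN.cosets) (card (q ` Z))"
    unfolding cardZ using p by (metis coprime_commute coprime_power_right_iff prime_imp_coprime)
  then obtain T where T: "subgroup T (G Mod E)" "T \<subseteq> q ` K" "T \<inter> q ` Z = {E}"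
    "q ` K \<subseteq> q ` Z <#>\<^bsub>G Mod E\<^esub> T"
    "\<And>g. g \<in> carrier (G Mod E) \<Longrightarrow> \<exists>a\<in>q ` Z. \<forall>t\<in>T. conj_by (G Mod E) (a \<otimes>\<^bsub>G Mod E\<^esub> g) t \<in> T"
    using AN.complement_exists by auto
  show ?thesis
  proof (intro exI conjI ballI)
    let ?T = "preimage T"
    show Ts: "subgroup ?T G" by (rule preimage_subgroup [OF T(1)])
    show ET: "E \<subseteq> ?T" by (rule E_subset_preimage [OF T(1)])
    show "?T \<subseteq> K" using T(2) q_image_iff [OF Ks EK] unfolding preimage_def by blast
    show "?T \<inter> Z = E"
    proof
      show "?T \<inter> Z \<subseteq> E"
      proof
        fix x assume x: "x \<in> ?T \<inter> Z"
        then have "q x \<in> T \<inter> q ` Z" by (auto simp: preimage_def)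
        then have "q x = E" using T(3) by simp
        then show "x \<in> E" using x Zc q_one_iff by auto
      qed
    qed (use ET EZ in auto)
    show "K \<subseteq> Z <#> ?T"
    proof
      fix x assume x: "x \<in> K"
      then have "q x \<in> q ` Z <#>\<^bsub>G Mod E\<^esub> T" using T(4) by auto
      then obtain z b where z: "z \<in> Z" "b \<in> T" "q x = q z \<otimes>\<^bsub>G Mod E\<^esub> b"
        by (auto elim!: Q.set_multE simp del: mult_FactGroup)
      obtain t where t: "t \<in> carrier G" "b = q t"
        using z(2) subgroup.subset [OF T(1)] carrier_quotient by auto
      have c: "x \<in> carrier G" "z \<in> carrier G" using x z Kc Zc by auto
      have "q x = q (z \<otimes> t)" using z t c by (simp add: q_mult del: mult_FactGroup)
      then have e: "x \<otimes> inv (z \<otimes> t) \<in> E" using c t by (subst (asm) q_eq_iff) auto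
      have "t \<in> ?T" using z t by (simp add: preimage_def)
      moreover have "x \<otimes> inv (z \<otimes> t) \<otimes> z \<in> Z"
        using e z EZ subgroup.m_closed [OF Zs] by auto
      moreover have "x = (x \<otimes> inv (z \<otimes> t) \<otimes> z) \<otimes> t" using c t by (simp add: m_assoc)
      ultimately show "x \<in> Z <#> ?T" using set_multI by metis
    qed
    fix g assume g: "g \<in> carrier G"
    then have "q g \<in> carrier (G Mod E)" by simp
    then obtain a where a: "a \<in> Z"
      "\<And>t. t \<in> T \<Longrightarrow> conj_by (G Mod E) (q a \<otimes>\<^bsub>G Mod E\<^esub> q g) t \<in> T"
      using T(5) by blast
    have "cj (a \<otimes> g) t \<in> ?T" if "t \<in> ?T" for t
    proof -
      have c: "t \<in> carrier G" "q t \<in> T" "a \<otimes> g \<in> carrier G"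
        using that a(1) Zc g by (auto simp: preimage_def)
      have "q (cj (a \<otimes> g) t) = conj_by (G Mod E) (q (a \<otimes> g)) (q t)"
        using q_conj [OF c(3,1)] by (rule sym)
      also have "q (a \<otimes> g) = q a \<otimes>\<^bsub>G Mod E\<^esub> q g" using q_mult [OF Zc [OF a(1)] g] .
      finally show ?thesis using a(2) [OF c(2)] c by (simp add: preimage_def)
    qed
    then show "\<exists>a\<in>Z. \<forall>t\<in>?T. cj (a \<otimes> g) t \<in> ?T" using a by blast
  qed
qed

text \<open>Here \<open>T / E\<close> is a complement of \<open>Z / E\<close> with \<open>G = Z N(T)\<close>, so \<open>Z \<subseteq> N(T)\<close> makes \<open>T\<close> normal.\<close>

lemma p_nilpotent_over_descend:
  assumes p: "Factorial_Ring.prime p" and E: "E \<lhd> G" and Z: "Z \<lhd> G" and EZ: "E \<subseteq> Z"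
    and card: "card Z = card E * p ^ j"
    and ab: "\<And>x y. x \<in> Z \<Longrightarrow> y \<in> Z \<Longrightarrow> cj x y \<otimes> inv y \<in> E"
    and over: "p_nilpotent_over p G Z"
    and normalizes: "\<And>T. subgroup T G \<Longrightarrow> E \<subseteq> T \<Longrightarrow>
      (\<And>g. g \<in> carrier G \<Longrightarrow> \<exists>a\<in>Z. \<forall>t\<in>T. cj (a \<otimes> g) t \<in> T) \<Longrightarrow> invar G Z T"
  shows "p_nilpotent_over p G E"
proof -
  obtain K m k where K: "K \<lhd> G" "Z \<subseteq> K" "\<not> p dvd (m::nat)"
    "\<And>x. x \<in> K \<Longrightarrow> x [^] m \<in> Z" "\<And>x. x \<in> carrier G \<Longrightarrow> x [^] (p ^ k) \<in> K"
    using over unfolding p_nilpotent_over_def by blast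
  obtain T where T: "subgroup T G" "E \<subseteq> T" "T \<subseteq> K" "T \<inter> Z = E" "K \<subseteq> Z <#> T"
    "\<And>g. g \<in> carrier G \<Longrightarrow> \<exists>a\<in>Z. \<forall>t\<in>T. cj (a \<otimes> g) t \<in> T"
    using abelian_section_complement [OF p E Z EZ card ab K(1,2,3,4)] by auto
  note Es = normal_imp_subgroup [OF E] and Zs = normal_imp_subgroup [OF Z]
  have TT: "t \<in> carrier G" if "t \<in> T" for t using that T(1) subgroup_carrier by blast
  have ZT: "invar G Z T" using normalizes T(1,2,6) by blast
  have TN: "T \<lhd> G"
    unfolding normal_iff_invar
  proof (intro conjI T(1) invarI)
    fix g t assume g: "g \<in> carrier G" and t: "t \<in> T"
    obtain a where a: "a \<in> Z" "\<And>t. t \<in> T \<Longrightarrow> cj (a \<otimes> g) t \<in> T" using T(6) [OF g] by blast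
    have c: "a \<in> carrier G" using a Zs subgroup_carrier by blast
    have "cj (inv a) (cj (a \<otimes> g) t) \<in> T"
      using invarD [OF ZT subgroup.m_inv_closed [OF Zs a(1)] a(2) [OF t]] .
    then show "cj g t \<in> T" using c g TT [OF t] by (simp add: cj_cj)
  qed
  from TN interpret T: normal_quotient G T
    by (intro normal_quotient.intro normal_quotient_axioms.intro finite_group_axioms)
  show ?thesis unfolding p_nilpotent_over_def
  proof (intro conjI exI ballI)
    show "E \<lhd> G" "T \<lhd> G" "E \<subseteq> T" "\<not> p dvd m" by (fact E TN T(2) K(3))+
    show "x [^] m \<in> E" if x: "x \<in> T" for x
      using K(4) [of x] T(3,4) x subgroup_pow [OF T(1) x] by blast
    \<comment> \<open>Since K = Z T, the quotient K/T is an image of Z/E and inherits the exponent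
      p^j.\<close>
    have Kpow: "x [^] (p ^ j) \<in> T" if x: "x \<in> K" for x
    proof -
      obtain z t where zt: "z \<in> Z" "t \<in> T" "x = z \<otimes> t" 
        using set_multE [OF subsetD [OF T(5) x]] by metis
      have c: "z \<in> carrier G" "t \<in> carrier G" using zt TT Zs subgroup_carrier by auto
      have "T #> t = T" using T.q_one_iff c zt by simp
      then have "T #> x = (T #> z) <#> (T #> \<one>)" using T.q_mult [of z t] T.q_mult [of z \<one>] c zt TT
        by (simp add: subset_iff)
      then have qx: "T #> x = T #> z" using T.q_mult [of z \<one>] c by simp
      have "z [^] (p ^ j) \<in> E"
        using pow_index_mem [OF Es Zs EZ _ card zt(1)] normal_invar [OF E] Zs subgroup.subset by blast
      then have "T #> (z [^] (p ^ j)) = T" using T.q_one_iff T(2) c by (auto simp: subset_iff)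
      then have "T #> (x [^] (p ^ j)) = T" using T.q_pow [of x] T.q_pow [of z] qx c zt by simp
      then show ?thesis using T.q_one_iff c zt by simp
    qed
    show "x [^] (p ^ (k + j)) \<in> T" if x: "x \<in> carrier G" for x
      using Kpow [OF K(5) [OF x]] x by (simp add: nat_pow_pow power_add)
  qed
qed

text \<open>A subgroup T above \<open>E\<close> is normalised by the central section: z t z^-1
  equals t times a commutator of t^-1 and z, which lies in \<open>E\<close> and so in T.\<close>

lemma p_nilpotent_over_central:
  assumes p: "Factorial_Ring.prime p" and E: "E \<lhd> G" and Z: "Z \<lhd> G" and EZ: "E \<subseteq> Z"
    and card: "card Z = card E * p ^ j"
    and central: "\<And>g z. g \<in> carrier G \<Longrightarrow> z \<in> Z \<Longrightarrow> cj g z \<otimes> inv z \<in> E"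
    and over: "p_nilpotent_over p G Z"
  shows "p_nilpotent_over p G E"
proof (rule p_nilpotent_over_descend [OF p E Z EZ card _ over])
  have Zc: "z \<in> carrier G" if "z \<in> Z" for z using that Z normal_imp_subgroup subgroup_carrier by blast
  show "cj x y \<otimes> inv y \<in> E" if "x \<in> Z" "y \<in> Z" for x y using central that Zc by blast
  fix T assume T: "subgroup T G" "E \<subseteq> T"
  show "invar G Z T"
  proof (rule invarI)
    fix z t assume z: "z \<in> Z" and t: "t \<in> T"
    have c: "z \<in> carrier G" "t \<in> carrier G" using z t Zc T subgroup_carrier by auto
    have "cj (inv t) z \<otimes> inv z \<in> T" using central [OF inv_closed [OF c(2)] z] T(2) by (rule rev_subsetD)
    then have "t \<otimes> (cj (inv t) z \<otimes> inv z) \<in> T" by (rule subgroup.m_closed [OF T(1) t])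
    also have "t \<otimes> (cj (inv t) z \<otimes> inv z) = cj z t"
      using c by (simp add: conj_by_def m_assoc)
    finally show "cj z t \<in> T" .
  qed
qed

text \<open>For x in \<open>P\<close> some a in \<open>Z\<close> makes a x normalise T, so P = Z (P
  meet N(T)). As \<open>Z\<close> contributes nothing to the generation of \<open>P\<close> above
  \<open>E\<close>, it follows that \<open>P\<close>, and with it \<open>Z\<close>, normalises
  T.\<close>

lemma p_nilpotent_over_nongenerators_abelian:
  assumes p: "Factorial_Ring.prime p" and E: "E \<lhd> G" and Z: "Z \<lhd> G" and EZ: "E \<subseteq> Z"
    and card: "card Z = card E * p ^ j"
    and ab: "\<And>x y. x \<in> Z \<Longrightarrow> y \<in> Z \<Longrightarrow> cj x y \<otimes> inv y \<in> E"
    and P: "subgroup P G" "Z \<subseteq> P"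
    and nongen: "\<And>H. subgroup H G \<Longrightarrow> E \<subseteq> H \<Longrightarrow> H \<subseteq> P \<Longrightarrow> P \<subseteq> Z <#> H \<Longrightarrow> H = P"
    and over: "p_nilpotent_over p G Z"
  shows "p_nilpotent_over p G E"
proof (rule p_nilpotent_over_descend [OF p E Z EZ card ab over])
  fix T assume T: "subgroup T G" "E \<subseteq> T"
    and act: "\<And>g. g \<in> carrier G \<Longrightarrow> \<exists>a\<in>Z. \<forall>t\<in>T. cj (a \<otimes> g) t \<in> T"
  have Tc: "T \<subseteq> carrier G" using T(1) by (rule subgroup.subset)
  let ?N = "normalizer G T"
  have N: "subgroup ?N G" by (rule normalizer_subgroup [OF Tc])
  have "P \<inter> ?N = P"
  proof (rule nongen)
    show "subgroup (P \<inter> ?N) G" using P N by (simp add: subgroups_Inter_pair)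
    show "E \<subseteq> P \<inter> ?N" using EZ P T Tc cj_subgroup [OF T(1)] by (auto simp: mem_normalizer_iff subset_iff)
    show "P \<subseteq> Z <#> (P \<inter> ?N)"
    proof
      fix x assume x: "x \<in> P"
      have xc: "x \<in> carrier G" using x P subgroup_carrier by blast
      obtain a where a: "a \<in> Z" "\<And>t. t \<in> T \<Longrightarrow> cj (a \<otimes> x) t \<in> T" using act [OF xc] by blast
      have ac: "a \<in> carrier G" "a \<in> P" using a P subgroup_carrier by auto
      have "a \<otimes> x \<in> P \<inter> ?N"
        using a ac x xc P Tc by (simp add: mem_normalizer_iff subgroup.m_closed)
      moreover have "inv a \<in> Z" using a Z by (simp add: normal_imp_subgroup subgroup.m_inv_closed)
      ultimately have "inv a \<otimes> (a \<otimes> x) \<in> Z <#> (P \<inter> ?N)" by (intro set_multI)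
      then show "x \<in> Z <#> (P \<inter> ?N)" using ac xc by simp
    qed
  qed auto
  then have "Z \<subseteq> ?N" using P by auto
  then show "invar G Z T" using invar_normalizer [OF Tc] invar_mono by blast
qed

lemma subgroup_card_quotient_prime_power:
  assumes p: "Factorial_Ring.prime p" and "subgroup E G" "subgroup Z G" "E \<subseteq> Z"
    and "subgroup P G" "Z \<subseteq> P" "card P = p ^ a"
  shows "\<exists>j. card Z = card E * p ^ j"
proof -
  obtain n where n: "card Z = card E * n" using card_dvd_subgroup assms by blast
  have "card Z dvd p ^ a" using card_dvd_subgroup assms by metis
  then have "n dvd p ^ a" using n by (metis dvd_mult_right)
  then show ?thesis using p n by (auto simp: divides_primepow_nat)
qed

text \<open>Induction on the distance from \<open>E\<close> to \<open>A\<close>. The preimage Z of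
  the centre of A/E is normal in G and larger than \<open>E\<close>, as A/E is a p-group. The
  induction hypothesis covers Z, since subgroups above Z are above \<open>E\<close>; the abelian
  case then leads from Z to \<open>E\<close>, since Z lies in \<open>A\<close>.\<close>

lemma p_nilpotent_over_nongenerators:
  assumes p: "Factorial_Ring.prime p" and A: "A \<lhd> G"
    and P: "subgroup P G" "A \<subseteq> P" "card P = p ^ a"
    and over: "p_nilpotent_over p G A"
  shows "E \<lhd> G \<Longrightarrow> E \<subseteq> A \<Longrightarrow>
    (\<And>H. subgroup H G \<Longrightarrow> E \<subseteq> H \<Longrightarrow> H \<subseteq> P \<Longrightarrow> P \<subseteq> A <#> H \<Longrightarrow> H = P) \<Longrightarrow>
    p_nilpotent_over p G E"
proof (induction "card A - card E" arbitrary: E rule: less_induct)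
  case less
  note E = less.prems(1) and EA = less.prems(2) and nongen = less.prems(3)
  note As = normal_imp_subgroup [OF A] and Es = normal_imp_subgroup [OF E]
  show ?case
  proof (cases "E = A")
    case True
    then show ?thesis using over by simp
  next
    case False
    \<comment> \<open>The preimage of the centre of A/E.\<close>
    define Z where "Z = {x \<in> A. \<forall>y\<in>A. cj y x \<otimes> inv x \<in> E}"
    have Ac: "x \<in> carrier G" if "x \<in> A" for x using that As subgroup_carrier by blast
    have Ec: "x \<in> carrier G" if "x \<in> E" for x using that Es subgroup_carrier by blast
    have Zs: "subgroup Z G"
    proof (rule submonoid_imp_subgroup)
      show "\<one> \<in> Z" using subgroup.one_closed [OF As] subgroup.one_closed [OF Es] Ac by (simp add: Z_def)
      fix x y assume xy: "x \<in> Z" "y \<in> Z"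
      then have c: "x \<in> carrier G" "y \<in> carrier G" "x \<in> A" "y \<in> A" using Ac by (auto simp: Z_def)
      have "cj a (x \<otimes> y) \<otimes> inv (x \<otimes> y) \<in> E" if a: "a \<in> A" for a
      proof -
        have e: "cj a y \<otimes> inv y \<in> E" "cj a x \<otimes> inv x \<in> E" using xy a by (auto simp: Z_def)
        have "cj a (x \<otimes> y) \<otimes> inv (x \<otimes> y) = cj a x \<otimes> (cj a y \<otimes> inv y) \<otimes> inv x"
          using c Ac [OF a] by (simp add: cj_mult m_assoc inv_mult_group)
        also have "\<dots> = (cj a x \<otimes> inv x) \<otimes> cj x (cj a y \<otimes> inv y)"
          using c Ac [OF a] by (simp add: conj_by_def m_assoc inv_mult_group)
        also have "\<dots> \<in> E" using e c normal_cj [OF E] subgroup.m_closed [OF Es] by blast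
        finally show ?thesis .
      qed
      then show "x \<otimes> y \<in> Z" using c subgroup.m_closed [OF As] by (simp add: Z_def)
    qed (use Ac in \<open>auto simp: Z_def\<close>)
    have "invar G (carrier G) Z"
    proof (rule invarI)
      fix g x assume g: "g \<in> carrier G" and x: "x \<in> Z"
      have xc: "x \<in> A" "x \<in> carrier G" using x Ac by (auto simp: Z_def)
      have "cj y (cj g x) \<otimes> inv (cj g x) \<in> E" if y: "y \<in> A" for y
      proof -
        have y': "cj (inv g) y \<in> A" using normal_cj [OF A] g y by simp
        have "cj g (cj (cj (inv g) y) x \<otimes> inv x) \<in> E"
          using x y' normal_cj [OF E g] by (simp add: Z_def)
        also have "cj g (cj (cj (inv g) y) x \<otimes> inv x) = cj y (cj g x) \<otimes> inv (cj g x)"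
          using g xc Ac [OF y] by (simp add: conj_by_def m_assoc inv_mult_group)
        finally show ?thesis .
      qed
      then show "cj g x \<in> Z" using normal_cj [OF A g] xc by (simp add: Z_def)
    qed
    then have Zn: "Z \<lhd> G" using Zs by (simp add: normal_iff_invar)
    have EZ: "E \<subseteq> Z"
    proof
      fix x assume x: "x \<in> E"
      have "cj y x \<otimes> inv x \<in> E" if "y \<in> A" for y
        using x normal_cj [OF E Ac [OF that] x] Es by (simp add: subgroup.m_closed subgroup.m_inv_closed)
      then show "x \<in> Z" using x EA by (auto simp: Z_def)
    qed
    have ZA: "Z \<subseteq> A" by (auto simp: Z_def)
    obtain b where b: "card A = p ^ b"
      using subgroup_card_quotient_prime_power [OF p triv_subgroup As _ P] subgroup.one_closed [OF As] by auto
    have Acar: "A \<subseteq> carrier G" using As by (rule subgroup.subset)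
    obtain z where z: "z \<in> A - E" "\<And>s. s \<in> A \<Longrightarrow> cj s z \<otimes> inv z \<in> E"
      using central_element_mod [OF p As b As Es] False EA invar_self [OF As] normal_invar [OF E Acar] by blast
    then have "z \<in> Z - E" by (simp add: Z_def)
    then have "E \<subset> Z" using EZ by auto
    then have "card E < card Z" using finite_subgroup [OF Zs] psubset_card_mono by blast
    moreover have "card Z \<le> card A" using ZA finite_subgroup [OF As] card_mono by blast
    ultimately have "card A - card Z < card A - card E" by simp
    moreover have "H = P" if "subgroup H G" "Z \<subseteq> H" "H \<subseteq> P" "P \<subseteq> A <#> H" for H
      using nongen that EZ by blast
    ultimately have overZ: "p_nilpotent_over p G Z" using less.hyps [of Z] Zn ZA by blast
    obtain j where j: "card Z = card E * p ^ j"
      using subgroup_card_quotient_prime_power [OF p Es Zs EZ P(1) _ P(3)] ZA P(2) by blast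
    show ?thesis
    proof (rule p_nilpotent_over_nongenerators_abelian [OF p E Zn EZ j _ P(1) _ _ overZ])
      show "cj x y \<otimes> inv y \<in> E" if "x \<in> Z" "y \<in> Z" for x y using that by (auto simp: Z_def)
      show "Z \<subseteq> P" using ZA P by auto
      show "H = P" if "subgroup H G" "E \<subseteq> H" "H \<subseteq> P" "P \<subseteq> Z <#> H" for H
        using nongen [OF that(1-3)] that(4) mono_set_mult [OF ZA subset_refl] by blast
    qed
  qed
qed

end

section \<open>Normal \<open>p\<close>-subgroups\<close>

text \<open>A maximal subgroup of \<open>P\<close> seen from the ambient group, so that it can be
  conjugated and compared with subgroups outside \<open>P\<close> without changing the
  structure.\<close>

definition maximal_in :: "('a, 'b) monoid_scheme \<Rightarrow> 'a set \<Rightarrow> 'a set \<Rightarrow> bool"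
  where "maximal_in G M P \<longleftrightarrow> subgroup M G \<and> M \<subset> P \<and>
    (\<forall>L. subgroup L G \<longrightarrow> M \<subset> L \<longrightarrow> L \<subseteq> P \<longrightarrow> L = P)"

text \<open>Modulo p, i is a unit whose order divides n, and p-1 by Fermat. Bezout for these coprime
  exponents gives order 1.\<close>

lemma cong_one_if_coprime_exponents:
  fixes i n p :: nat
  assumes p: "Factorial_Ring.prime p" and n: "0 < n" "gcd n (p - 1) = 1" and i: "[i ^ n = 1] (mod p)"
  shows "[i = 1] (mod p)"
proof -
  have "\<not> p dvd i"
  proof
    assume "p dvd i"
    then have "p dvd i ^ n" using n by (simp add: dvd_power_same dvd_trans)
    then have "p dvd 1" using i by (meson cong_dvd_iff)
    then show False using p by (simp add: prime_nat_iff)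
  qed
  then have f: "[i ^ (p - 1) = 1] (mod p)" using p by (intro fermat_theorem)
  obtain x y where xy: "n * x = (p - 1) * y + 1" using bezout_nat [of n "p - 1"] n by auto
  have "[(i ^ n) ^ x = 1 ^ x] (mod p)" using i by (rule cong_pow)
  then have "[i ^ (n * x) = 1] (mod p)" by (simp add: power_mult)
  moreover have "[(i ^ (p - 1)) ^ y * i = 1 ^ y * i] (mod p)" using f by (intro cong_mult cong_pow) auto
  moreover have "i ^ (n * x) = (i ^ (p - 1)) ^ y * i"
    unfolding xy by (simp only: power_add power_mult power_one_right)
  ultimately have "[i ^ (n * x) = i] (mod p)" "[i ^ (n * x) = 1] (mod p)" by simp_all
  then show ?thesis by (meson cong_sym cong_trans)
qed

section \<open>Subgroups of p-groups\<close>

context finite_group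
begin

text \<open>The cyclic subgroup of \<open>z\<close>; natural exponents reach all of it because G is
  finite.\<close>

definition powers :: "'a \<Rightarrow> 'a set" where "powers z = range (\<lambda>i::nat. z [^] i)"

lemma powers_subgroup: "z \<in> carrier G \<Longrightarrow> subgroup (powers z) G"
proof (rule submonoid_imp_subgroup)
  assume z: "z \<in> carrier G"
  show "\<one> \<in> powers z" unfolding powers_def by (rule range_eqI [of _ _ 0]) simp
  show "x \<otimes> y \<in> powers z" if xy: "x \<in> powers z" "y \<in> powers z" for x y
  proof -
    obtain i j :: nat where "x = z [^] i" "y = z [^] j" using xy unfolding powers_def by blast
    then have "x \<otimes> y = z [^] (i + j)" using z by (simp add: nat_pow_mult)
    then show ?thesis unfolding powers_def by blast
  qed
qed (auto simp: powers_def)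

lemma powers_subset: "subgroup H G \<Longrightarrow> z \<in> H \<Longrightarrow> powers z \<subseteq> H"
  by (auto simp: powers_def subgroup_pow)

lemma self_mem_powers: "z \<in> carrier G \<Longrightarrow> z \<in> powers z"
  unfolding powers_def by (rule range_eqI [of _ _ 1]) simp

lemma mem_ext_iff: "x \<in> B <#> powers z \<longleftrightarrow> (\<exists>b\<in>B. \<exists>i::nat. x = b \<otimes> z [^] i)"
  by (auto simp: set_mult_def powers_def)

text \<open>If s fixes z modulo \<open>B\<close>, it fixes the powers of z as well. In elements:
  [s, z^(n+1)] is [s, z^n] times the conjugate of [s, z] by z^n, and z normalises
  \<open>B\<close>.\<close>

lemma commutator_pow:
  assumes S: "subgroup S G" and B: "subgroup B G" and inv: "invar G S B"
    and z: "z \<in> S" and s: "s \<in> carrier G" and c: "cj s z \<otimes> inv z \<in> B"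
  shows "cj s (z [^] (n::nat)) \<otimes> inv (z [^] n) \<in> B"
proof (induction n)
  case 0
  then show ?case using s B by (simp add: subgroup.one_closed)
next
  case (Suc n)
  have zc: "z \<in> carrier G" using z S subgroup_carrier by blast
  have "cj s (z [^] Suc n) \<otimes> inv (z [^] Suc n)
      = (cj s (z [^] n) \<otimes> inv (z [^] n)) \<otimes> cj (z [^] n) (cj s z \<otimes> inv z)"
    using zc s by (simp add: conj_by_def m_assoc inv_mult_group)
  moreover have "cj (z [^] n) (cj s z \<otimes> inv z) \<in> B"
    by (rule invarD [OF inv subgroup_pow [OF S z] c])
  ultimately show ?case using Suc B subgroup.m_closed by simp
qed

lemma cyclic_extension:
  assumes S: "subgroup S G" and B: "subgroup B G" and inv: "invar G S B" and z: "z \<in> S"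
  shows "subgroup (B <#> powers z) G" "B \<subseteq> B <#> powers z" "z \<in> B <#> powers z"
    and "(\<And>s. s \<in> S \<Longrightarrow> cj s z \<otimes> inv z \<in> B) \<Longrightarrow> invar G S (B <#> powers z)"
proof -
  have zc: "z \<in> carrier G" using z S subgroup_carrier by blast
  have Bc: "B \<subseteq> carrier G" using B by (rule subgroup.subset)
  have pw: "subgroup (powers z) G" by (rule powers_subgroup [OF zc])
  show "subgroup (B <#> powers z) G"
    using B pw invar_mono [OF inv powers_subset [OF S z]] by (rule subgroup_set_mult_invar)
  show "B \<subseteq> B <#> powers z" using Bc pw by (rule subset_set_mult_left)
  show "z \<in> B <#> powers z"
    using subset_set_mult_right [OF B subgroup.subset [OF pw]] self_mem_powers [OF zc] by blast
  assume c: "\<And>s. s \<in> S \<Longrightarrow> cj s z \<otimes> inv z \<in> B"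
  show "invar G S (B <#> powers z)"
  proof (rule invarI)
    fix s x assume s: "s \<in> S" and "x \<in> B <#> powers z"
    then obtain b i where b: "b \<in> B" "x = b \<otimes> z [^] (i::nat)" unfolding mem_ext_iff by auto
    have bc: "b \<in> carrier G" "s \<in> carrier G" using b Bc s S subgroup_carrier by auto
    have "cj s x = (cj s b \<otimes> (cj s (z [^] i) \<otimes> inv (z [^] i))) \<otimes> z [^] i"
      using b bc zc by (simp add: cj_mult m_assoc)
    moreover have "cj s b \<otimes> (cj s (z [^] i) \<otimes> inv (z [^] i)) \<in> B"
      using invarD [OF inv s b(1)] commutator_pow [OF S B inv z bc(2) c [OF s]]
      by (rule subgroup.m_closed [OF B])
    ultimately show "cj s x \<in> B <#> powers z" unfolding mem_ext_iff by blast
  qed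
qed

text \<open>U is maximal among the proper \<open>S\<close>-invariant subgroups of \<open>N\<close>
  above \<open>E\<close>. Some y outside U is central modulo U, and z is the last of y, y^p,
  y^(p^2), ... outside U. Then U and z generate an invariant subgroup, which is \<open>N\<close> by
  maximality. That U has index p in \<open>N\<close> is recorded through z.\<close>

lemma p_group_coatom:
  assumes p: "Factorial_Ring.prime p" and S: "subgroup S G" "card S = p ^ a"
    and E: "subgroup E G" "E \<subset> N" "invar G S E" and N: "subgroup N G" "N \<subseteq> S" "invar G S N"
  shows "\<exists>U z. subgroup U G \<and> E \<subseteq> U \<and> U \<subset> N \<and> invar G S U \<and> z \<in> N \<and> z \<notin> U \<and> z [^] p \<in> U \<and>
    N = U <#> powers z"
proof -
  define \<U> where "\<U> = {U. subgroup U G \<and> E \<subseteq> U \<and> U \<subset> N \<and> invar G S U}"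
  have "\<U> \<subseteq> Pow N" by (auto simp: \<U>_def)
  then have "finite \<U>" using finite_subgroup [OF N(1)] by (simp add: finite_subset)
  moreover have "\<U> \<noteq> {}" using E by (auto simp: \<U>_def)
  ultimately obtain U where "U \<in> \<U>" and max: "\<And>V. V \<in> \<U> \<Longrightarrow> U \<subseteq> V \<Longrightarrow> U = V"
    using finite_has_maximal by metis
  then have U: "subgroup U G" "E \<subseteq> U" "U \<subset> N" "invar G S U" by (auto simp: \<U>_def)
  obtain y where y: "y \<in> N - U" "\<And>s. s \<in> S \<Longrightarrow> cj s y \<otimes> inv y \<in> U"
    using central_element_mod [OF p S N(1) U(1,3) N(2,3) U(4)] by blast
  have yS: "y \<in> S" "y \<in> carrier G" using y N S subgroup_carrier by auto
  \<comment> \<open>The first power in the sequence y^(p^j) to enter U; it is not y itself, so a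
    predecessor exists.\<close>
  define j where "j = (LEAST j. y [^] (p ^ j) \<in> U)"
  have "y [^] (p ^ a) \<in> U" using pow_card_eq_one [OF S(1) yS(1)] S(2) U(1) subgroup.one_closed by simp
  then have j: "y [^] (p ^ j) \<in> U" unfolding j_def by (rule LeastI)
  have "j \<noteq> 0" using j y yS by (cases j) auto
  then obtain l where l: "j = Suc l" by (cases j) auto
  define z where "z = y [^] (p ^ l)"
  have z: "z \<in> N" "z \<in> S" using y N subgroup_pow unfolding z_def by auto
  have zU: "z \<notin> U" using not_less_Least [of l "\<lambda>j. y [^] (p ^ j) \<in> U"] l unfolding j_def [symmetric] z_def by simp
  have zp: "z [^] p \<in> U" using j l yS by (simp add: z_def nat_pow_pow mult.commute)
  have cz: "cj s z \<otimes> inv z \<in> U" if "s \<in> S" for s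
    unfolding z_def using commutator_pow [OF S(1) U(1,4) yS(1)] that y(2) S(1) subgroup_carrier by blast
  note ext = cyclic_extension [OF S(1) U(1,4) z(2)]
  have "U <#> powers z \<subseteq> N"
    using set_mult_subset [OF N(1), of U "powers z"] U(3) powers_subset [OF N(1) z(1)] by blast
  moreover have "\<not> U <#> powers z \<subset> N"
  proof
    assume "U <#> powers z \<subset> N"
    then have "U <#> powers z \<in> \<U>" using ext cz U by (auto simp: \<U>_def)
    then show False using max ext zU by blast
  qed
  ultimately have "N = U <#> powers z" by blast
  then show ?thesis using U z zU zp by blast
qed

text \<open>Normalizers grow in p-groups. Let U be a maximal P-invariant subgroup inside
  \<open>M\<close> and z outside U central modulo U. Then z is not in \<open>M\<close>, since U
  could be enlarged by it, but z normalises \<open>M\<close> because its commutators with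
  \<open>M\<close> lie in U. So the normalizer in \<open>P\<close> properly contains
  \<open>M\<close>.\<close>

lemma maximal_in_p_group_normal:
  assumes p: "Factorial_Ring.prime p" and P: "subgroup P G" "card P = p ^ a" and M: "maximal_in G M P"
  shows "invar G P M"
proof -
  have Ms: "subgroup M G" "M \<subset> P" and Mmax: "\<And>L. subgroup L G \<Longrightarrow> M \<subset> L \<Longrightarrow> L \<subseteq> P \<Longrightarrow> L = P"
    using M by (auto simp: maximal_in_def)
  have Mc: "M \<subseteq> carrier G" using Ms subgroup.subset by blast
  define \<U> where "\<U> = {U. subgroup U G \<and> U \<subseteq> M \<and> invar G P U}"
  have "\<U> \<subseteq> Pow M" by (auto simp: \<U>_def)
  then have "finite \<U>" using finite_subgroup [OF Ms(1)] by (simp add: finite_subset)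
  moreover have "{\<one>} \<in> \<U>"
    using triv_subgroup subgroup.one_closed [OF Ms(1)] subgroup_carrier [OF P(1)] by (auto simp: \<U>_def invar_def)
  ultimately obtain U where "U \<in> \<U>" and max: "\<And>V. V \<in> \<U> \<Longrightarrow> U \<subseteq> V \<Longrightarrow> U = V"
    using finite_has_maximal by (metis empty_iff)
  then have U: "subgroup U G" "U \<subseteq> M" "invar G P U" by (auto simp: \<U>_def)
  obtain z where z: "z \<in> P - U" "\<And>s. s \<in> P \<Longrightarrow> cj s z \<otimes> inv z \<in> U"
    using central_element_mod [OF p P P(1) U(1) _ subset_refl invar_self [OF P(1)] U(3)] U(2) Ms(2) by blast
  have zP: "z \<in> P" "z \<in> carrier G" using z P subgroup_carrier by auto
  note ext = cyclic_extension [OF P(1) U(1,3) zP(1)]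
  have "z \<notin> M"
  proof
    assume "z \<in> M"
    then have "U <#> powers z \<subseteq> M"
      using set_mult_subset [OF Ms(1) U(2)] powers_subset [OF Ms(1)] by blast
    then have "U <#> powers z \<in> \<U>" using ext z by (simp add: \<U>_def)
    then show False using max [of "U <#> powers z"] ext z by blast
  qed
  let ?N = "P \<inter> normalizer G M"
  have "?N = P"
  proof (rule Mmax)
    show "subgroup ?N G" using P normalizer_subgroup [OF Mc] by (simp add: subgroups_Inter_pair)
    have "M \<subseteq> ?N" using Ms Mc cj_subgroup by (auto simp: mem_normalizer_iff [OF Mc])
    moreover have "z \<in> normalizer G M" unfolding mem_normalizer_iff [OF Mc]
    proof (intro conjI ballI)
      fix m assume m: "m \<in> M"
      then have mc: "m \<in> carrier G" "m \<in> P" using Mc Ms by auto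
      have "inv (cj m z \<otimes> inv z) \<in> M"
        using subsetD [OF U(2) z(2) [OF mc(2)]] by (rule subgroup.m_inv_closed [OF Ms(1)])
      then have "inv (cj m z \<otimes> inv z) \<otimes> m \<in> M" using m by (rule subgroup.m_closed [OF Ms(1)])
      moreover have "inv (cj m z \<otimes> inv z) \<otimes> m = cj z m"
        using mc zP by (simp add: conj_by_def m_assoc inv_mult_group)
      ultimately show "cj z m \<in> M" by simp
    qed (rule zP)
    ultimately show "M \<subset> ?N" using zP \<open>z \<notin> M\<close> by blast
  qed auto
  then show ?thesis using invar_normalizer [OF Mc] invar_mono by blast
qed

text \<open>Each w in \<open>P\<close> outside \<open>M\<close> generates \<open>P\<close> together
  with \<open>M\<close>. If y^p were outside, then y = m y^(p i), so a power of y with exponent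
  prime to p, and hence y, would lie in \<open>M\<close>. For commutators with x outside
  \<open>M\<close>, write y = m x^i; the factor x^i commutes with x.\<close>

lemma maximal_in_p_group:
  assumes p: "Factorial_Ring.prime p" and P: "subgroup P G" "card P = p ^ a" and M: "maximal_in G M P"
  shows "y \<in> P \<Longrightarrow> y [^] p \<in> M" "x \<in> P \<Longrightarrow> y \<in> P \<Longrightarrow> cj x y \<otimes> inv y \<in> M"
proof -
  have Ms: "subgroup M G" "M \<subset> P" and Mmax: "\<And>L. subgroup L G \<Longrightarrow> M \<subset> L \<Longrightarrow> L \<subseteq> P \<Longrightarrow> L = P"
    using M by (auto simp: maximal_in_def)
  have inv: "invar G P M" by (rule maximal_in_p_group_normal [OF p P M])
  have Pc: "x \<in> carrier G" if "x \<in> P" for x using that P subgroup_carrier by blast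
  have gen: "M <#> powers w = P" if w: "w \<in> P" "w \<notin> M" for w
  proof -
    note ext = cyclic_extension [OF P(1) Ms(1) inv w(1)]
    have "M <#> powers w \<subseteq> P"
      using set_mult_subset [OF P(1)] Ms(2) powers_subset [OF P(1) w(1)] by blast
    then show ?thesis using Mmax [of "M <#> powers w"] ext w by blast
  qed
  show "y [^] p \<in> M" if y: "y \<in> P"
  proof (rule ccontr)
    assume n: "y [^] p \<notin> M"
    have yc: "y \<in> carrier G" using y Pc by blast
    have yp: "y [^] p \<in> P" using subgroup_pow [OF P(1) y] .
    have "y \<in> M <#> powers (y [^] p)" using gen [OF yp n] y by simp
    then obtain m i where m: "m \<in> M" "y = m \<otimes> (y [^] p) [^] (i::nat)" unfolding mem_ext_iff by auto
    have mc: "m \<in> carrier G" using m Ms Pc by auto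
    have one: "y [^] (p ^ a) = \<one>" using pow_card_eq_one [OF P(1) y] P(2) by simp
    have pa: "0 < p ^ a" using p by (simp add: prime_gt_0_nat)
    \<comment> \<open>As y^(p^a) = 1, this is a natural number representing the exponent -p
      i.\<close>
    let ?e = "p * i * (p ^ a - 1)"
    have "y [^] (1 + ?e) = y \<otimes> y [^] ?e"
      using nat_pow_mult [OF yc, of 1 ?e] yc by (simp only: nat_pow_eone)
    also have "\<dots> = m \<otimes> (y [^] (p * i) \<otimes> y [^] ?e)"
      using m(2) mc yc by (metis m_assoc nat_pow_closed nat_pow_pow)
    also have "y [^] (p * i) \<otimes> y [^] ?e = y [^] (p * i + ?e)" using yc by (simp add: nat_pow_mult)
    also have "p * i + ?e = p ^ a * (p * i)" using pa by (simp add: algebra_simps)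
    also have "y [^] (p ^ a * (p * i)) = \<one>" using yc one nat_pow_pow [OF yc, of "p ^ a" "p * i"] by simp
    finally have "y [^] (1 + ?e) \<in> M" using m(1) mc by simp
    moreover have "\<not> p dvd 1 + ?e"
      using p by (metis dvd_add_left_iff dvd_mult2 dvd_triv_left not_prime_unit)
    ultimately have "y \<in> M" using mem_of_pow_p_group [OF p Ms(1) P y] by blast
    then show False using n subgroup_pow [OF Ms(1)] by blast
  qed
  show "cj x y \<otimes> inv y \<in> M" if x: "x \<in> P" and y: "y \<in> P"
  proof -
    have c: "x \<in> carrier G" "y \<in> carrier G" using x y Pc by auto
    show ?thesis
    proof (cases "x \<in> M")
      case True
      have "x \<otimes> cj y (inv x) \<in> M"
        using True inv y Ms(1) by (simp add: invarD subgroup.m_closed subgroup.m_inv_closed)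
      then show ?thesis using c by (simp add: conj_by_def m_assoc)
    next
      case False
      obtain m i where m: "m \<in> M" "y = m \<otimes> x [^] (i::nat)"
        using gen [OF x False] y mem_ext_iff by blast
      have mc: "m \<in> carrier G" using m Ms Pc by auto
      have "x \<otimes> x [^] i = x [^] i \<otimes> x" using c by (metis nat_pow_Suc nat_pow_Suc2)
      then have "cj x (x [^] i) = x [^] i" using c by (simp add: cj_fixed_iff)
      then have "cj x y \<otimes> inv y = cj x m \<otimes> inv m"
        using m(2) mc c by (simp add: cj_mult m_assoc inv_mult_group)
      then show ?thesis
        using invarD [OF inv x m(1)] m(1) Ms(1) by (simp add: subgroup.m_closed subgroup.m_inv_closed)
    qed
  qed
qed

text \<open>\<open>G\<close> acts on the group \<open>N / E\<close> of order \<open>p\<close>, and \<open>gcd |G| (p - 1) = 1\<close> makes this action trivial.\<close>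

lemma order_p_section_central:
  assumes p: "Factorial_Ring.prime p" and gcd: "gcd (order G) (p - 1) = 1"
    and E: "E \<lhd> G" and N: "N \<lhd> G" "N = E <#> powers z"
    and z: "z \<in> carrier G" "z \<notin> E" "z [^] p \<in> E" and g: "g \<in> carrier G" and n: "n \<in> N"
  shows "cj g n \<otimes> inv n \<in> E"
proof -
  interpret normal_quotient G E by (intro normal_quotient.intro normal_quotient_axioms.intro finite_group_axioms E)
  have Ec: "e \<in> carrier G" if "e \<in> E" for e using that E_sub subgroup_carrier by blast
  have Einv: "invar G (carrier G) E" using E by (simp add: normal_iff_invar)
  have zN: "z \<in> N" unfolding N(2)
    using cyclic_extension(3) [OF subgroup_self E_sub Einv z(1)] .
  have qe: "q (e \<otimes> x) = q x" if "e \<in> E" "x \<in> carrier G" for e x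
    using that Ec by (subst q_eq_iff) auto
  \<comment> \<open>Modulo \<open>E\<close> the element g acts on the cyclic group generated by z as
    the i-th power map, so g^k acts as the power map with exponent i^k.\<close>
  obtain e i where i: "e \<in> E" "cj g z = e \<otimes> z [^] (i::nat)"
    using normal_cj [OF N(1) g zN] unfolding N(2) mem_ext_iff by blast
  have qi: "q (cj g z) = q (z [^] i)" using i z qe by simp
  have conj_q: "q (cj h (z [^] k)) = q (cj h z) [^]\<^bsub>G Mod E\<^esub> k" if "h \<in> carrier G" for h and k :: nat
    using that z by (simp add: cj_pow q_pow)
  have pow: "q (cj (g [^] k) z) = q (z [^] (i ^ k))" for k :: nat
  proof (induction k)
    case 0
    then show ?case using z by simp
  next
    case (Suc k)
    have "q (cj (g [^] Suc k) z) = q (cj (g [^] k) (cj g z))" using g z by (simp add: cj_cj)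
    also have "\<dots> = conj_by (G Mod E) (q (g [^] k)) (q (cj g z))" using g z by (simp add: q_conj)
    also have "\<dots> = q (cj (g [^] k) (z [^] i))" unfolding qi using g z by (simp add: q_conj)
    also have "\<dots> = q (z [^] (i ^ k)) [^]\<^bsub>G Mod E\<^esub> i" using g by (simp add: conj_q Suc)
    also have "\<dots> = q (z [^] (i ^ Suc k))" using z by (simp add: q_pow nat_pow_pow mult.commute)
    finally show ?case .
  qed
  \<comment> \<open>The order of z modulo \<open>E\<close> is exactly p.\<close>
  have p_dvd: "p dvd k" if "z [^] (k::nat) \<in> E" for k
  proof (rule ccontr)
    assume "\<not> p dvd k"
    then have "coprime k p" using p by (metis coprime_commute prime_imp_coprime)
    then show False using coprime_pow_mem [OF E_sub z(1) that z(3)] z(2) by blast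
  qed
  \<comment> \<open>The |G|-th power of g is trivial, hence i^|G| = 1 modulo p.\<close>
  let ?n = "order G"
  have n0: "0 < ?n" using finite_carrier by (simp add: order_gt_0_iff_finite)
  have "q (z [^] (i ^ ?n)) = q z" using pow [of ?n] pow_order_eq_1 [OF g] z by simp
  then have e: "z [^] (i ^ ?n) \<otimes> inv z \<in> E" using z by (subst (asm) q_eq_iff) auto
  have "i \<noteq> 0"
  proof
    assume "i = 0"
    then have "inv z \<in> E" using e n0 z by (simp add: power_0_left)
    then show False using z subgroup_inv_iff [OF E_sub] by blast
  qed
  then have ge: "1 \<le> i ^ ?n" by simp
  then have "z [^] (i ^ ?n) = z [^] (i ^ ?n - 1) \<otimes> z"
    by (metis le_add_diff_inverse2 nat_pow_Suc Suc_eq_plus1)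
  then have "z [^] (i ^ ?n - 1) \<in> E" using e z by simp
  then have "p dvd i ^ ?n - 1" by (rule p_dvd)
  then have "[i ^ ?n = 1] (mod p)" using ge by (simp add: cong_altdef_nat)
  then have "[i = 1] (mod p)" using cong_one_if_coprime_exponents [OF p n0 gcd] by blast
  then have "p dvd i - 1" using \<open>i \<noteq> 0\<close> by (simp add: cong_altdef_nat)
  then have "z [^] (i - 1) \<in> E" using pow_dvd_mem [OF E_sub z(1,3)] by blast
  moreover have "z [^] i \<otimes> inv z = z [^] (i - 1)"
    using z \<open>i \<noteq> 0\<close> by (cases i) simp_all
  ultimately have "q (z [^] i) = q z" using z by (subst q_eq_iff) auto
  then have fix_z: "q (cj g z) = q z" using qi by simp
  obtain d k where d: "d \<in> E" "n = d \<otimes> z [^] (k::nat)" using n unfolding N(2) mem_ext_iff by blast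
  have "q (cj g n) = q (cj g d \<otimes> cj g (z [^] k))" using d g z Ec by (simp add: cj_mult)
  also have "\<dots> = q (cj g (z [^] k))" using qe normal_cj [OF E g d(1)] g z by simp
  also have "\<dots> = q (z [^] k)" using conj_q [OF g] fix_z z by (simp add: q_pow)
  also have "\<dots> = q n" using d z qe by simp
  finally show ?thesis using g d z Ec by (subst (asm) q_eq_iff) auto
qed

lemma maximal_in_cj:
  assumes M: "maximal_in G M P" and P: "P \<lhd> G" and g: "g \<in> carrier G"
  shows "maximal_in G (cj g ` M) P"
proof -
  have Ms: "subgroup M G" "M \<subset> P" and Mmax: "\<And>L. subgroup L G \<Longrightarrow> M \<subset> L \<Longrightarrow> L \<subseteq> P \<Longrightarrow> L = P"
    using M by (auto simp: maximal_in_def)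
  have Pc: "P \<subseteq> carrier G" using P by (simp add: normal_imp_subgroup subgroup.subset)
  have Mc: "M \<subseteq> carrier G" using Ms(1) by (rule subgroup.subset)
  have gi: "inv g \<in> carrier G" using g by simp
  have undo_cj: "cj (inv g) ` cj g ` A = A" "cj g ` cj (inv g) ` A = A" if "A \<subseteq> carrier G" for A
    using that g by (force simp: image_image)+
  have into: "cj h ` A \<subseteq> P" if "A \<subseteq> P" "h \<in> carrier G" for A h
    using that normal_cj [OF P] by auto
  show ?thesis unfolding maximal_in_def
  proof (intro conjI allI impI)
    show "subgroup (cj g ` M) G" using subgroup_cj_image Ms g by blast
    show "cj g ` M \<subset> P"
    proof
      show "cj g ` M \<subseteq> P" using into [of M g] Ms g by blast
      have "card (cj g ` M) = card M" using card_cj_image [OF Mc g] .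
      moreover have "card M < card P" using Ms(2) finite_subset_carrier [OF Pc] by (simp add: psubset_card_mono)
      ultimately show "cj g ` M \<noteq> P" by auto
    qed
    fix L assume L: "subgroup L G" "cj g ` M \<subset> L" "L \<subseteq> P"
    have Lc: "L \<subseteq> carrier G" using L(1) by (rule subgroup.subset)
    have sub: "M \<subseteq> cj (inv g) ` L"
      using image_mono [of "cj g ` M" L "cj (inv g)"] L(2) undo_cj(1) [OF Mc] by auto
    have "M \<noteq> cj (inv g) ` L" using L(2) undo_cj(2) [OF Lc] by auto
    then have "cj (inv g) ` L = P"
      using Mmax [of "cj (inv g) ` L"] subgroup_cj_image [OF L(1) gi] sub into [OF L(3) gi] by blast
    then have "card L = card P" using card_cj_image [OF Lc gi] by simp
    then show "L = P" using L(3) finite_subset_carrier [OF Pc] by (simp add: card_subset_eq)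
  qed
qed

lemma maximal_in_exists:
  assumes H: "subgroup H G" "H \<subset> P" and P: "subgroup P G"
  shows "\<exists>M. maximal_in G M P \<and> H \<subseteq> M"
proof -
  define \<U> where "\<U> = {U. subgroup U G \<and> H \<subseteq> U \<and> U \<subset> P}"
  have "\<U> \<subseteq> Pow P" by (auto simp: \<U>_def)
  then have "finite \<U>" using finite_subgroup [OF P] by (simp add: finite_subset)
  moreover have "\<U> \<noteq> {}" using H by (auto simp: \<U>_def)
  ultimately obtain U where U: "U \<in> \<U>" and max: "\<And>V. V \<in> \<U> \<Longrightarrow> U \<subseteq> V \<Longrightarrow> U = V"
    using finite_has_maximal by metis
  have "maximal_in G U P" unfolding maximal_in_def
  proof (intro conjI allI impI)
    show "subgroup U G" "U \<subset> P" using U by (auto simp: \<U>_def)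
    fix L assume L: "subgroup L G" "U \<subset> L" "L \<subseteq> P"
    show "L = P"
    proof (rule ccontr)
      assume "L \<noteq> P"
      then have "L \<in> \<U>" using L U by (auto simp: \<U>_def)
      then show False using max L by blast
    qed
  qed
  then show ?thesis using U by (auto simp: \<U>_def)
qed

text \<open>A subgroup maximal among those containing \<open>U\<close> and avoiding \<open>z\<close> works, because every
  subgroup of \<open>P\<close> above \<open>U\<close> is normal in \<open>P\<close> with elementary abelian quotient.\<close>

lemma maximal_in_avoiding:
  assumes p: "Factorial_Ring.prime p" and P: "subgroup P G" "card P = p ^ a"
    and F: "\<And>y. y \<in> P \<Longrightarrow> y [^] p \<in> U" "\<And>x y. x \<in> P \<Longrightarrow> y \<in> P \<Longrightarrow> cj x y \<otimes> inv y \<in> U"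
    and U: "subgroup U G" "U \<subseteq> P" and z: "z \<in> P" "z \<notin> U"
  shows "\<exists>M. maximal_in G M P \<and> U \<subseteq> M \<and> z \<notin> M"
proof -
  define \<U> where "\<U> = {V. subgroup V G \<and> U \<subseteq> V \<and> V \<subseteq> P \<and> z \<notin> V}"
  have "\<U> \<subseteq> Pow P" by (auto simp: \<U>_def)
  then have "finite \<U>" using finite_subgroup [OF P(1)] by (simp add: finite_subset)
  moreover have "\<U> \<noteq> {}" using U z by (auto simp: \<U>_def)
  ultimately obtain M where "M \<in> \<U>" and max: "\<And>V. V \<in> \<U> \<Longrightarrow> M \<subseteq> V \<Longrightarrow> M = V"
    using finite_has_maximal by metis
  then have M: "subgroup M G" "U \<subseteq> M" "M \<subseteq> P" "z \<notin> M" by (auto simp: \<U>_def)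
  have Pc: "x \<in> carrier G" if "x \<in> P" for x using that P subgroup_carrier by blast
  have inv: "invar G P M"
  proof (rule invarI)
    fix x y assume x: "x \<in> P" and y: "y \<in> M"
    have c: "x \<in> carrier G" "y \<in> carrier G" "y \<in> P" using x y M Pc by auto
    have "(cj x y \<otimes> inv y) \<otimes> y \<in> M"
      using subsetD [OF M(2) F(2) [OF x c(3)]] y by (rule subgroup.m_closed [OF M(1)])
    then show "cj x y \<in> M" using c by simp
  qed
  \<comment> \<open>\<open>M\<close> and z generate \<open>P\<close>. For y outside
    \<open>M\<close>, maximality puts z into the group generated by \<open>M\<close> and y, so z = m
    y^i. Here p does not divide i, because y^p is in \<open>M\<close> and z is not; thus y^i, and
    then y, lies in \<open>L\<close>.\<close>
  have gen: "P \<subseteq> L" if L: "subgroup L G" "M \<subseteq> L" "z \<in> L" for L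
  proof
    fix y assume y: "y \<in> P"
    have yc: "y \<in> carrier G" using y Pc by blast
    show "y \<in> L"
    proof (cases "y \<in> M")
      case False
      note ext = cyclic_extension [OF P(1) M(1) inv y]
      have "M <#> powers y \<subseteq> P"
        using set_mult_subset [OF P(1) M(3)] powers_subset [OF P(1) y] by blast
      then have "z \<in> M <#> powers y"
        using max [of "M <#> powers y"] ext M False unfolding \<U>_def by blast
      then obtain m i where m: "m \<in> M" "z = m \<otimes> y [^] (i::nat)" unfolding mem_ext_iff by auto
      have mc: "m \<in> carrier G" using m M Pc by auto
      have "\<not> p dvd i"
      proof
        assume "p dvd i"
        then have "y [^] i \<in> M" using pow_dvd_mem [OF M(1) yc] F(1) [OF y] M(2) by blast
        then show False using m M(1,4) by (simp add: subgroup.m_closed)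
      qed
      moreover have "y [^] i \<in> L"
      proof -
        have "inv m \<otimes> z \<in> L"
          using L m by (intro subgroup.m_closed [OF L(1)] subgroup.m_inv_closed [OF L(1)]) auto
        then show ?thesis using m mc yc by simp
      qed
      ultimately show ?thesis using mem_of_pow_p_group [OF p L(1) P y] by blast
    qed (use L in auto)
  qed
  have "maximal_in G M P" unfolding maximal_in_def
  proof (intro conjI allI impI)
    show "subgroup M G" "M \<subset> P" using M z by auto
    fix L assume L: "subgroup L G" "M \<subset> L" "L \<subseteq> P"
    have "z \<in> L"
    proof (rule ccontr)
      assume "z \<notin> L"
      then have "L \<in> \<U>" using L M by (auto simp: \<U>_def)
      then show False using max L by blast
    qed
    then show "L = P" using gen [of L] L by blast
  qed
  then show ?thesis using M by blast
qed

text \<open>The index of N(U) divides l, which is prime to p, as well as p^k. The divisibility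
  assumed for \<open>T\<close> says that its index divides p^k.\<close>

lemma normalizer_full:
  assumes p: "Factorial_Ring.prime p" and U: "U \<subseteq> carrier G"
    and S: "subgroup S G" "invar G S U" "order G = card S * l" "\<not> p dvd l"
    and T: "subgroup T G" "invar G T U" "order G dvd card T * p ^ k"
  shows "invar G (carrier G) U"
proof -
  let ?N = "normalizer G U"
  have N: "subgroup ?N G" by (rule normalizer_subgroup [OF U])
  have sub: "S \<subseteq> ?N" "T \<subseteq> ?N"
    using S T subset_normalizer_iff [OF U] subgroup.subset by blast+
  obtain c where c: "order G = card ?N * c"
    using card_dvd_subgroup [OF N subgroup_self subgroup.subset [OF N]] by (auto simp: order_def)
  have pos: "0 < card ?N" by (rule card_subgroup_pos [OF N])
  obtain d where d: "card ?N = card S * d" using card_dvd_subgroup [OF S(1) N sub(1)] by blast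
  have "0 < card S" by (rule card_subgroup_pos [OF S(1)])
  then have "l = d * c" using c d S(3) by (auto simp: mult.assoc)
  then have "\<not> p dvd c" using S(4) by auto
  have "card T dvd card ?N" by (rule card_dvd_subgroup [OF T(1) N sub(2)])
  then have "card T * p ^ k dvd card ?N * p ^ k" by simp
  then have "card ?N * c dvd card ?N * p ^ k" using T(3) c by (metis dvd_trans)
  then have "c dvd p ^ k" using pos by simp
  then have "c = 1" using dvd_prime_power_cases [OF p] \<open>\<not> p dvd c\<close> by blast
  then have "?N = carrier G"
    using c subgroup.subset [OF N] finite_carrier by (simp add: order_def card_subset_eq)
  then show ?thesis using invar_normalizer [OF U] by simp
qed

text \<open>\<open>W\<close> isolates the contribution of the partial Pi-property and is supplied by
  \<open>partial_Pi_maximal\<close>. It is stated for all \<open>M\<close> and \<open>E\<close>,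
  since the relevant pair is found only during the proof.\<close>

theorem p_nilpotent_over_normal_p_subgroup:
  assumes p: "Factorial_Ring.prime p" and gcd: "gcd (order G) (p - 1) = 1"
    and P: "P \<lhd> G" "card P = p ^ a" and over: "p_nilpotent_over p G P"
    and W: "\<And>M E. maximal_in G M P \<Longrightarrow> E \<lhd> G \<Longrightarrow> E \<subseteq> M \<Longrightarrow>
      \<exists>D T k. D \<lhd> G \<and> E \<subset> D \<and> D \<subseteq> P \<and> subgroup T G \<and> invar G T (M \<inter> D) \<and> order G dvd card T * p ^ k"
  shows "p_nilpotent_over p G {\<one>}"
proof (rule ccontr)
  assume "\<not> p_nilpotent_over p G {\<one>}"
  note Ps = normal_imp_subgroup [OF P(1)]
  have Pc: "x \<in> carrier G" if "x \<in> P" for x using that Ps subgroup_carrier by blast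
  define \<E> where "\<E> = {E. E \<lhd> G \<and> E \<subseteq> P \<and> \<not> p_nilpotent_over p G E}"
  have "\<E> \<subseteq> Pow P" by (auto simp: \<E>_def)
  then have "finite \<E>" using finite_subgroup [OF Ps] by (simp add: finite_subset)
  moreover have "{\<one>} \<in> \<E>"
    using one_is_normal subgroup.one_closed [OF Ps] \<open>\<not> p_nilpotent_over p G {\<one>}\<close> by (simp add: \<E>_def)
  ultimately obtain E where "E \<in> \<E>" and Emax: "\<And>V. V \<in> \<E> \<Longrightarrow> E \<subseteq> V \<Longrightarrow> E = V"
    using finite_has_maximal by (metis empty_iff)
  then have E: "E \<lhd> G" "E \<subseteq> P" "\<not> p_nilpotent_over p G E" by (auto simp: \<E>_def)
  note Es = normal_imp_subgroup [OF E(1)]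
  have above: "p_nilpotent_over p G D" if "D \<lhd> G" "E \<subset> D" "D \<subseteq> P" for D
    using Emax [of D] that by (auto simp: \<E>_def)
  have "E \<noteq> P" using E over by auto
  define \<N> where "\<N> = {D. D \<lhd> G \<and> E \<subset> D \<and> D \<subseteq> P}"
  have "\<N> \<subseteq> Pow P" by (auto simp: \<N>_def)
  then have "finite \<N>" using finite_subgroup [OF Ps] by (simp add: finite_subset)
  moreover have "P \<in> \<N>" using P E \<open>E \<noteq> P\<close> by (auto simp: \<N>_def)
  ultimately obtain N where "N \<in> \<N>" and Nmin: "\<And>V. V \<in> \<N> \<Longrightarrow> V \<subseteq> N \<Longrightarrow> N = V"
    using finite_has_minimal by (metis empty_iff)
  then have N: "N \<lhd> G" "E \<subset> N" "N \<subseteq> P" by (auto simp: \<N>_def)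
  note Ns = normal_imp_subgroup [OF N(1)]
  \<comment> \<open>Otherwise D meets N in E, by the minimality of N, and p-nilpotency modulo D and
    modulo N gives it modulo E.\<close>
  have Nleast: "N \<subseteq> D" if D: "D \<lhd> G" "E \<subset> D" "D \<subseteq> P" for D
  proof (rule ccontr)
    assume "\<not> N \<subseteq> D"
    have DN: "D \<inter> N \<lhd> G" using D N normal_subgroup_intersect by blast
    show False
    proof (cases "D \<inter> N = E")
      case True
      then show False using p_nilpotent_over_Int [OF p above [OF D] above [OF N]] E by simp
    next
      case False
      then have "D \<inter> N \<in> \<N>" using DN D N by (auto simp: \<N>_def)
      then show False using Nmin [of "D \<inter> N"] \<open>\<not> N \<subseteq> D\<close> by blast
    qed
  qed
  \<comment> \<open>F/E is the Frattini subgroup of P/E. It is normal because conjugation by G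
    permutes the maximal subgroups of P above E.\<close>
  define F where "F = {x \<in> P. \<forall>M. maximal_in G M P \<longrightarrow> E \<subseteq> M \<longrightarrow> x \<in> M}"
  have Fs: "subgroup F G"
  proof (rule submonoid_imp_subgroup)
    show "F \<subseteq> carrier G" using Pc by (auto simp: F_def)
    show "\<one> \<in> F" using Ps by (auto simp: F_def maximal_in_def subgroup.one_closed)
    show "x \<otimes> y \<in> F" if "x \<in> F" "y \<in> F" for x y
      using that Ps by (auto simp: F_def maximal_in_def subgroup.m_closed)
  qed
  have EF: "E \<subseteq> F" using E by (auto simp: F_def)
  have FP: "F \<subseteq> P" by (auto simp: F_def)
  have "invar G (carrier G) F"
  proof (rule invarI)
    fix g x assume g: "g \<in> carrier G" and x: "x \<in> F"
    then have xP: "x \<in> P" "x \<in> carrier G" using FP Pc by auto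
    have "cj g x \<in> M" if M: "maximal_in G M P" "E \<subseteq> M" for M
    proof -
      have gi: "inv g \<in> carrier G" using g by simp
      have "cj (inv g) ` E = E"
        using cj_image_eq [OF gi subgroup.subset [OF Es]] normal_cj [OF E(1) gi] by blast
      then have "E \<subseteq> cj (inv g) ` M" using M(2) by blast
      then have "x \<in> cj (inv g) ` M" using x maximal_in_cj [OF M(1) P(1) gi] by (auto simp: F_def)
      then obtain m where m: "m \<in> M" "x = cj (inv g) m" by auto
      have "m \<in> carrier G" using m M subgroup_carrier by (auto simp: maximal_in_def)
      then show ?thesis using m g by simp
    qed
    then show "cj g x \<in> F" using normal_cj [OF P(1) g xP(1)] by (simp add: F_def)
  qed
  then have Fn: "F \<lhd> G" using Fs by (simp add: normal_iff_invar)
  show False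
  proof (cases "N \<subseteq> F")
    case True
    have "p_nilpotent_over p G E"
    proof (rule p_nilpotent_over_nongenerators [OF p N(1) Ps N(3) P(2) above [OF N] E(1)])
      show "E \<subseteq> N" using N by auto
      fix H assume H: "subgroup H G" "E \<subseteq> H" "H \<subseteq> P" "P \<subseteq> N <#> H"
      show "H = P"
      proof (rule ccontr)
        assume "H \<noteq> P"
        then obtain M where M: "maximal_in G M P" "H \<subseteq> M"
          using maximal_in_exists [OF H(1) _ Ps] H(3) by blast
        have "N \<subseteq> M" using True M H by (auto simp: F_def)
        then have "N <#> H \<subseteq> M" using M set_mult_subset by (simp add: maximal_in_def)
        then show False using H(4) M(1) by (auto simp: maximal_in_def)
      qed
    qed
    then show False using E by simp
  next
    case False
    have FN: "F \<inter> N = E"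
    proof (rule ccontr)
      assume n: "F \<inter> N \<noteq> E"
      have "E \<subset> F \<inter> N" using EF N n by auto
      then have "N \<subseteq> F \<inter> N"
        using Nleast normal_subgroup_intersect [OF Fn N(1)] FP by blast
      then show False using False by blast
    qed
    obtain b l where bl: "order G = p ^ b * l" "\<not> p dvd l"
      using card_decompose [OF p subgroup_self] by (auto simp: order_def)
    obtain S where S: "subgroup S G" "card S = p ^ b"
      using sylow_exists [OF p subgroup_self, of b l] bl(1) by (auto simp: order_def)
    have Sc: "S \<subseteq> carrier G" using S(1) by (rule subgroup.subset)
    \<comment> \<open>A conjugate of P lies in S by Sylow, and P is its own conjugate.\<close>
    have PS: "P \<subseteq> S"
    proof -
      obtain x where x: "x \<in> carrier G" "\<forall>y\<in>P. cj x y \<in> S"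
        using sylow_contains_conjugate [OF p subgroup_self S(1) Sc _ bl(2) Ps subgroup.subset [OF Ps] P(2)]
          S(2) bl(1) by (auto simp: order_def)
      have "cj x ` P = P" using cj_image_eq [OF x(1) subgroup.subset [OF Ps]] normal_cj [OF P(1) x(1)] by blast
      then show ?thesis using x(2) by (metis imageE subsetI)
    qed
    have NS: "N \<subseteq> S" using N(3) PS by blast
    obtain U z where U: "subgroup U G" "E \<subseteq> U" "U \<subset> N" "invar G S U"
      and z: "z \<in> N" "z \<notin> U" "z [^] p \<in> U" and NU: "N = U <#> powers z"
      using p_group_coatom [OF p S Es N(2) normal_invar [OF E(1) Sc] Ns NS normal_invar [OF N(1) Sc]] by blast
    have Uc: "U \<subseteq> carrier G" using U(1) by (rule subgroup.subset)
    have zP: "z \<in> P" "z \<in> carrier G" using z N Pc by auto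
    have FU: "subgroup (F <#> U) G"
      by (rule subgroup_set_mult_invar [OF Fs U(1) normal_invar [OF Fn Uc]])
    have F_FU: "F \<subseteq> F <#> U" and U_FU: "U \<subseteq> F <#> U"
      using subset_set_mult_left [OF subgroup.subset [OF Fs] U(1)] subset_set_mult_right [OF Fs Uc] by auto
    \<comment> \<open>Dedekind's law with F meet N = E: what F U has in common with N is U.\<close>
    have zFU: "z \<notin> F <#> U"
    proof
      assume "z \<in> F <#> U"
      then obtain f u where fu: "f \<in> F" "u \<in> U" "z = f \<otimes> u" by (rule set_multE)
      have c: "f \<in> carrier G" "u \<in> carrier G" using fu Fs U(1) subgroup_carrier by auto
      have "f \<in> N" using subgroup_cancel_right [OF Ns _ c(1), of u] fu U(3) z(1) by auto
      then have "f \<in> U" using fu FN U(2) by blast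
      then show False using fu U(1) z(2) by (simp add: subgroup.m_closed)
    qed
    have "F <#> U \<subseteq> P" using set_mult_subset [OF Ps FP] U(3) N(3) by blast
    \<comment> \<open>All maximal subgroups of P contain its p-th powers and commutators, so F does.
      This is what makes \<open>maximal_in_avoiding\<close> applicable above F U.\<close>
    moreover have "y [^] p \<in> F <#> U" if "y \<in> P" for y
    proof -
      have "y [^] p \<in> F"
        using maximal_in_p_group(1) [OF p Ps P(2) _ that] subgroup_pow [OF Ps that] by (simp add: F_def)
      then show ?thesis using F_FU by blast
    qed
    moreover have "cj x y \<otimes> inv y \<in> F <#> U" if "x \<in> P" "y \<in> P" for x y
    proof -
      have "cj x y \<otimes> inv y \<in> P"
        using cj_subgroup [OF Ps that] subgroup.m_inv_closed [OF Ps that(2)] by (rule subgroup.m_closed [OF Ps])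
      then have "cj x y \<otimes> inv y \<in> F"
        using maximal_in_p_group(2) [OF p Ps P(2) _ that] by (simp add: F_def)
      then show ?thesis using F_FU by blast
    qed
    ultimately obtain M where M: "maximal_in G M P" "F <#> U \<subseteq> M" "z \<notin> M"
      using maximal_in_avoiding [OF p Ps P(2) _ _ FU _ zP(1) zFU] by blast
    have Ms: "subgroup M G" using M by (simp add: maximal_in_def)
    have MN: "M \<inter> N = U"
    proof
      show "U \<subseteq> M \<inter> N" using U_FU M(2) U(3) by blast
      show "M \<inter> N \<subseteq> U"
      proof
        fix x assume x: "x \<in> M \<inter> N"
        then obtain u i where u: "u \<in> U" "x = u \<otimes> z [^] (i::nat)"
          using mem_ext_iff [of x U z] NU by blast
        have uM: "u \<in> M" using u U_FU M(2) by blast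
        have "z [^] i \<in> M"
          using subgroup_cancel_left [OF Ms uM, of "z [^] i"] zP x u by simp
        then have "p dvd i" using mem_of_pow_p_group [OF p Ms Ps P(2) zP(1)] M(3) by blast
        then have "z [^] i \<in> U" using pow_dvd_mem [OF U(1) zP(2) z(3)] by blast
        then show "x \<in> U" using u U(1) by (simp add: subgroup.m_closed)
      qed
    qed
    have "E \<subseteq> M" using EF F_FU M(2) by blast
    then obtain D T k where D: "D \<lhd> G" "E \<subset> D" "D \<subseteq> P"
      and T: "subgroup T G" "invar G T (M \<inter> D)" "order G dvd card T * p ^ k"
      using W [OF M(1) E(1)] by blast
    \<comment> \<open>D lies properly above E and so contains N. Intersecting with the normal
      subgroup N transfers the invariance from M meet D to U.\<close>
    have "M \<inter> D \<inter> N = U" using MN Nleast [OF D] by blast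
    then have "invar G T U"
      using invar_Int [OF T(2) normal_invar [OF N(1) subgroup.subset [OF T(1)]]] by simp
    then have "invar G (carrier G) U"
      using normalizer_full [OF p Uc S(1) U(4) _ bl(2) T(1) _ T(3)] bl(1) S(2) by simp
    then have Un: "U \<lhd> G" using U(1) by (simp add: normal_iff_invar)
    \<comment> \<open>A normal U properly above E would contain N. So N/E is generated by z and has
      order p, and the condition on the gcd makes it central.\<close>
    have "U = E"
    proof (rule ccontr)
      assume "U \<noteq> E"
      then have "N \<subseteq> U" using Nleast [OF Un] U N by blast
      then show False using U by blast
    qed
    obtain j where j: "card N = card E * p ^ j"
      using subgroup_card_quotient_prime_power [OF p Es Ns _ Ps N(3) P(2)] N(2) by blast
    have "p_nilpotent_over p G E"
    proof (rule p_nilpotent_over_central [OF p E(1) N(1) _ j _ above [OF N]])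
      show "cj g n \<otimes> inv n \<in> E" if "g \<in> carrier G" "n \<in> N" for g n
        using order_p_section_central [OF p gcd E(1) N(1) _ zP(2) _ _ that] NU z \<open>U = E\<close> by simp
    qed (use N in auto)
    then show False using E by simp
  qed
qed

end

section \<open>Sylow subgroups \<open>P\<close> with \<open>N(P) = P C(P)\<close>\<close>

lemma (in normal_quotient) p_nilpotent_over_quotient:
  assumes A: "E \<subseteq> A" and over: "p_nilpotent_over p G A"
  shows "p_nilpotent_over p (G Mod E) (q ` A)"
proof -
  obtain K m k where K: "A \<lhd> G" "K \<lhd> G" "A \<subseteq> K" "\<not> p dvd (m::nat)"
    "\<And>x. x \<in> K \<Longrightarrow> x [^] m \<in> A" "\<And>x. x \<in> carrier G \<Longrightarrow> x [^] (p ^ k) \<in> K"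
    using over unfolding p_nilpotent_over_def by blast
  have Kc: "x \<in> carrier G" if "x \<in> K" for x
    using that K(2) normal_imp_subgroup subgroup_carrier by blast
  show ?thesis unfolding p_nilpotent_over_def
  proof (intro conjI exI)
    show "q ` A \<lhd> G Mod E" "q ` K \<lhd> G Mod E" using q_normal K by auto
    show "q ` A \<subseteq> q ` K" "\<not> p dvd m" using K by auto
    show "\<forall>x\<in>q ` K. x [^]\<^bsub>G Mod E\<^esub> m \<in> q ` A" using K(5) Kc q_pow by auto
    show "\<forall>x\<in>carrier (G Mod E). x [^]\<^bsub>G Mod E\<^esub> (p ^ k) \<in> q ` K"
      using K(6) q_pow by (auto simp: carrier_quotient)
  qed
qed

lemma (in normal_quotient) preimage_normal:
  assumes T: "T \<lhd> G Mod E" shows "preimage T \<lhd> G"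
  unfolding normal_iff_invar
proof (intro conjI preimage_subgroup normal_imp_subgroup [OF T] invarI)
  fix g x assume g: "g \<in> carrier G" and x: "x \<in> preimage T"
  then have c: "x \<in> carrier G" "q x \<in> T" by (auto simp: preimage_def)
  have "conj_by (G Mod E) (q g) (q x) \<in> T" using Q.normal_cj [OF T _ c(2)] g by simp
  then show "cj g x \<in> preimage T" using g c q_conj [of g x] by (simp add: preimage_def)
qed

lemma (in normal_quotient) p_nilpotent_over_preimage:
  assumes over: "p_nilpotent_over p (G Mod E) {E}" shows "p_nilpotent_over p G E"
proof -
  obtain K m k where "K \<lhd> G Mod E \<and> {E} \<subseteq> K \<and> \<not> p dvd (m::nat) \<and>
      (\<forall>x\<in>K. x [^]\<^bsub>G Mod E\<^esub> m \<in> {E}) \<and> (\<forall>x\<in>carrier (G Mod E). x [^]\<^bsub>G Mod E\<^esub> (p ^ k) \<in> K)"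
    using over unfolding p_nilpotent_over_def by (elim conjE exE) (intro that conjI)
  then have K: "K \<lhd> G Mod E" "{E} \<subseteq> K" "\<not> p dvd (m::nat)"
    "\<And>x. x \<in> K \<Longrightarrow> x [^]\<^bsub>G Mod E\<^esub> m \<in> {E}"
    "\<And>x. x \<in> carrier (G Mod E) \<Longrightarrow> x [^]\<^bsub>G Mod E\<^esub> (p ^ k) \<in> K"
    by auto
  show ?thesis unfolding p_nilpotent_over_def
  proof (intro conjI exI ballI)
    show "E \<lhd> G" "\<not> p dvd m" by (rule E_normal, rule K(3))
    show "preimage K \<lhd> G" by (rule preimage_normal [OF K(1)])
    show "E \<subseteq> preimage K" by (rule E_subset_preimage [OF normal_imp_subgroup [OF K(1)]])
    show "x [^] m \<in> E" if "x \<in> preimage K" for x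
    proof -
      have x: "x \<in> carrier G" "q x \<in> K" using that by (simp_all add: preimage_def)
      have "q (x [^] m) = E" using K(4) [OF x(2)] unfolding q_pow [OF x(1)] by (rule singletonD)
      then show ?thesis using q_one_iff [OF nat_pow_closed [OF x(1)]] by blast
    qed
    show "x [^] (p ^ k) \<in> preimage K" if "x \<in> carrier G" for x
    proof -
      have "q x \<in> carrier (G Mod E)" unfolding carrier_quotient using that by (rule imageI)
      then have "q (x [^] (p ^ k)) \<in> K" unfolding q_pow [OF that, symmetric] by (rule K(5))
      then show ?thesis using that by (simp add: preimage_def)
    qed
  qed
qed

section \<open>Control of fusion, and the p-complement from transfer\<close>

context finite_group
begin

text \<open>A Sylow p-subgroup of \<open>E\<close> is conjugate into \<open>P\<close>. The conjugate
  stays in the normal subgroup \<open>E\<close>, so P meet E is as large as it.\<close>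

lemma sylow_Int_normal:
  assumes p: "Factorial_Ring.prime p" and P: "subgroup P G" "card P = p ^ a"
    and n: "order G = card P * n" "\<not> p dvd n" and E: "E \<lhd> G"
  obtains c e where "card (P \<inter> E) = p ^ c" "card E = card (P \<inter> E) * e" "\<not> p dvd e"
proof -
  note Es = normal_imp_subgroup [OF E]
  have PE: "subgroup (P \<inter> E) G" using P Es by (simp add: subgroups_Inter_pair)
  obtain c e where ce: "card E = p ^ c * e" "\<not> p dvd e" using card_decompose [OF p Es] by blast
  obtain Q where Q: "subgroup Q G" "Q \<subseteq> E" "card Q = p ^ c" using sylow_exists [OF p Es ce(1)] by blast
  obtain x where x: "x \<in> carrier G" "\<forall>u\<in>Q. cj x u \<in> P"
    using sylow_contains_conjugate [OF p subgroup_self P(1) subgroup.subset [OF P(1)] _ n(2) Q(1)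
      subgroup.subset [OF Q(1)] Q(3)] n(1) by (auto simp: order_def)
  have "cj x ` Q \<subseteq> P \<inter> E" using x Q(2) normal_cj [OF E x(1)] by auto
  then have "card (cj x ` Q) \<le> card (P \<inter> E)" using card_mono finite_subgroup [OF PE] by blast
  then have le: "p ^ c \<le> card (P \<inter> E)" using card_cj_image [OF subgroup.subset [OF Q(1)] x(1)] Q(3) by simp
  obtain d where d: "card (P \<inter> E) = p ^ d"
    using card_dvd_subgroup [OF PE P(1)] P(2) p by (auto simp: divides_primepow_nat)
  have "p ^ d dvd p ^ c * e" using card_dvd_subgroup [OF PE Es] d ce by auto
  then have "p ^ d dvd p ^ c"
    using p ce(2) by (metis coprime_dvd_mult_left_iff coprime_power_left_iff prime_imp_coprime)
  then have "p ^ d = p ^ c" using le d by (simp add: dvd_imp_le le_antisym p prime_gt_0_nat)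
  then show ?thesis using that [of c e] d ce by simp
qed

text \<open>The condition N(P) = P C(P), written with elements; only the inclusion from left to
  right has content.\<close>

definition centralised_by_normalizer :: "'a set \<Rightarrow> bool"
  where "centralised_by_normalizer P \<longleftrightarrow>
    (\<forall>g\<in>normalizer G P. \<exists>x\<in>P. \<exists>y\<in>carrier G. g = x \<otimes> y \<and> (\<forall>u\<in>P. cj y u = u))"

text \<open>Burnside's fusion argument inside the centraliser of \<open>cj g u\<close>.\<close>

lemma central_elements_unfused:
  assumes p: "Factorial_Ring.prime p" and P: "subgroup P G" "card P = p ^ a"
    and n: "order G = card P * n" "\<not> p dvd n" and ctrl: "centralised_by_normalizer P"
    and g: "g \<in> carrier G" and u: "u \<in> P" "cj g u \<in> P"
    and central: "\<And>x. x \<in> P \<Longrightarrow> cj x u = u" "\<And>x. x \<in> P \<Longrightarrow> cj x (cj g u) = cj g u"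
  shows "cj g u = u"
proof -
  have Pc: "x \<in> carrier G" if "x \<in> P" for x using that P subgroup_carrier by blast
  let ?b = "cj g u"
  define C where "C = {c \<in> carrier G. cj c ?b = ?b}"
  have b: "?b \<in> carrier G" using u Pc by blast
  have C: "subgroup C G"
    by (rule submonoid_imp_subgroup) (use b in \<open>auto simp: C_def cj_cj [symmetric]\<close>)
  have PC: "P \<subseteq> C" using central(2) Pc by (auto simp: C_def)
  let ?Q = "cj g ` P"
  have Q: "subgroup ?Q G" by (rule subgroup_cj_image [OF P(1) g])
  have cQ: "card ?Q = card P" by (rule card_cj_image [OF subgroup.subset [OF P(1)] g])
  \<comment> \<open>P and its conjugate by g both lie in the centraliser C of cj g u: the former by
    assumption, the latter because P centralises u. Both are Sylow subgroups of C.\<close>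
  have QC: "?Q \<subseteq> C"
  proof
    fix y assume "y \<in> ?Q"
    then obtain x where x: "x \<in> P" "y = cj g x" by auto
    have c: "x \<in> carrier G" "u \<in> carrier G" using x u Pc by auto
    have "cj (cj g x) (cj g u) = cj g (cj x u)"
      using c g by (simp add: conj_by_def m_assoc inv_mult_group)
    then have "cj y ?b = ?b" using central(1) [OF x(1)] x by simp
    then show "y \<in> C" using x c g by (simp add: C_def)
  qed
  obtain n' where n': "card C = card P * n'" using card_dvd_subgroup [OF P(1) C PC] by blast
  have "card C dvd order G"
    using card_dvd_subgroup [OF C subgroup_self subgroup.subset [OF C]] by (simp add: order_def)
  then have "n' dvd n" using n n' card_subgroup_pos [OF P(1)] by simp
  then have "\<not> p dvd n'" using n(2) by (meson dvd_trans)
  then obtain x where x: "x \<in> C" "cj x ` ?Q = P"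
    using sylow_conjugate [OF p C P(1) PC n' _ Q QC] cQ P(2) by metis
  have xc: "x \<in> carrier G" "cj x ?b = ?b" using x by (auto simp: C_def)
  \<comment> \<open>With x in C carrying the conjugate back to P, the element x g normalises P and
    still maps u to cj g u. Being in P C(P), it acts on u like an element of P, that is,
    trivially.\<close>
  have "x \<otimes> g \<in> normalizer G P"
    unfolding mem_normalizer_iff [OF subgroup.subset [OF P(1)]]
  proof (intro conjI ballI)
    fix y assume y: "y \<in> P"
    then have "cj x (cj g y) \<in> P" using x(2) by blast
    then show "cj (x \<otimes> g) y \<in> P" using xc g Pc [OF y] by (simp add: cj_cj)
  qed (use xc g in simp)
  then obtain v y where vy: "v \<in> P" "y \<in> carrier G" "x \<otimes> g = v \<otimes> y" "\<forall>u\<in>P. cj y u = u"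
    using ctrl unfolding centralised_by_normalizer_def by blast
  have uc: "u \<in> carrier G" using u Pc by blast
  have "?b = cj (x \<otimes> g) u" using xc g uc cj_cj by metis
  also have "\<dots> = cj v (cj y u)" using vy(1-3) Pc uc by (simp add: cj_cj)
  also have "\<dots> = u" using vy u central by simp
  finally show ?thesis .
qed

text \<open>A = P meet E is a Sylow p-subgroup of \<open>E\<close>, and also of K, since p does not
  divide |K:E|. It is central in \<open>P\<close>, hence unfused, so by
  \<open>unfused_complement\<close> the elements of K killed by |K:A| form a subgroup. Being defined
  by an exponent inside the normal K, it is normal in G.\<close>

lemma p_nilpotent_over_central_Int:
  assumes p: "Factorial_Ring.prime p" and P: "subgroup P G" "card P = p ^ a"
    and n: "order G = card P * n" "\<not> p dvd n" and ctrl: "centralised_by_normalizer P"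
    and E: "E \<lhd> G" and central: "\<And>u x. u \<in> P \<inter> E \<Longrightarrow> x \<in> P \<Longrightarrow> cj x u = u"
    and over: "p_nilpotent_over p G E"
  shows "p_nilpotent_over p G {\<one>}"
proof -
  obtain K m k where K: "K \<lhd> G" "E \<subseteq> K" "\<not> p dvd (m::nat)"
    "\<And>x. x \<in> K \<Longrightarrow> x [^] m \<in> E" "\<And>x. x \<in> carrier G \<Longrightarrow> x [^] (p ^ k) \<in> K"
    using over unfolding p_nilpotent_over_def by blast
  note Es = normal_imp_subgroup [OF E] and Ks = normal_imp_subgroup [OF K(1)]
  have Kc: "x \<in> carrier G" if "x \<in> K" for x using that Ks subgroup_carrier by blast
  define A where "A = P \<inter> E"
  have A: "subgroup A G" unfolding A_def using P Es by (simp add: subgroups_Inter_pair)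
  obtain c e where ce: "card A = p ^ c" "card E = card A * e" "\<not> p dvd e"
    unfolding A_def using sylow_Int_normal [OF p P n E] by blast
  obtain t where t: "card K = card E * t" using card_dvd_subgroup [OF Es Ks K(2)] by blast
  have pt: "\<not> p dvd t" using index_not_dvd [OF p Es Ks K(2) t K(4) K(3)] by blast
  interpret AK: abelian_subgroup G A K
  proof (intro abelian_subgroup.intro abelian_subgroup_axioms.intro finite_group_axioms A Ks)
    show "A \<subseteq> K" using K(2) by (auto simp: A_def)
    show "x \<otimes> y = y \<otimes> x" if "x \<in> A" "y \<in> A" for x y
      using central [of y x] that A subgroup_carrier by (simp add: A_def cj_fixed_iff)
  qed
  let ?m = "card AK.cosets"
  have "?m * card A = card A * e * t" by (simp only: AK.card_cosets t ce(2))
  also have "\<dots> = (e * t) * card A" by (simp only: ac_simps)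
  finally have "?m * card A = (e * t) * card A" .
  then have m: "?m = e * t" using card_subgroup_pos [OF A] by simp
  have pm: "\<not> p dvd ?m" unfolding m using p ce(3) pt by (simp add: prime_dvd_mult_iff)
  then have cop: "coprime ?m (card A)"
    unfolding ce(1) using p by (metis coprime_commute coprime_power_right_iff prime_imp_coprime)
  have unfused: "cj x u = u" if "x \<in> K" "u \<in> A" "cj x u \<in> A" for x u
    by (rule central_elements_unfused [OF p P n ctrl]) (use that Kc central in \<open>auto simp: A_def\<close>)
  define L where "L = {x \<in> K. x [^] ?m = \<one>}"
  have L: "subgroup L G"
  proof (rule submonoid_imp_subgroup)
    show "x \<otimes> y \<in> L" if "x \<in> L" "y \<in> L" for x y
      using AK.unfused_complement [OF unfused cop, of x y] that Ks by (simp add: L_def subgroup.m_closed)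
  qed (use Kc Ks in \<open>auto simp: L_def subgroup.one_closed\<close>)
  have "invar G (carrier G) L"
  proof (rule invarI)
    fix g x assume g: "g \<in> carrier G" and x: "x \<in> L"
    then have xK: "x \<in> K" "x \<in> carrier G" "x [^] ?m = \<one>" using Kc by (auto simp: L_def)
    then have "cj g x [^] ?m = \<one>" using g by (simp add: cj_pow [symmetric])
    then show "cj g x \<in> L" using normal_cj [OF K(1) g xK(1)] by (simp add: L_def)
  qed
  then have Ln: "L \<lhd> G" using L by (simp add: normal_iff_invar)
  show ?thesis unfolding p_nilpotent_over_def
  proof (intro conjI exI ballI)
    show "{\<one>} \<lhd> G" by (rule one_is_normal)
    show "L \<lhd> G" "\<not> p dvd ?m" by fact+
    show "{\<one>} \<subseteq> L" using subgroup.one_closed [OF L] by simp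
    show "x [^] ?m \<in> {\<one>}" if "x \<in> L" for x using that by (simp add: L_def)
    show "x [^] (p ^ (k + c)) \<in> L" if x: "x \<in> carrier G" for x
    proof -
      let ?y = "x [^] (p ^ k)"
      have y: "?y \<in> K" "?y \<in> carrier G" using K(5) x by auto
      have "(?y [^] (p ^ c)) [^] ?m = ?y [^] card K"
        using y AK.card_cosets ce(1) by (simp add: nat_pow_pow mult.commute)
      then have "?y [^] (p ^ c) \<in> L"
        using pow_card_eq_one [OF Ks y(1)] subgroup_pow [OF Ks y(1)] by (simp add: L_def)
      then show ?thesis using x by (simp add: nat_pow_pow power_add)
    qed
  qed
qed

end

section \<open>Passage to quotients: avoided and covered factors\<close>

context normal_quotient
begin

lemma q_set_mult: "P \<subseteq> carrier G \<Longrightarrow> q ` (E <#> P) = q ` P"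
proof -
  assume P: "P \<subseteq> carrier G"
  have eq: "q (e \<otimes> x) = q x" if "e \<in> E" "x \<in> P" for e x
    using that P subgroup_carrier [OF E_sub] by (subst q_eq_iff) auto
  show "q ` (E <#> P) = q ` P"
  proof
    show "q ` (E <#> P) \<subseteq> q ` P" using eq by (auto elim!: set_multE)
    show "q ` P \<subseteq> q ` (E <#> P)"
      using subset_set_mult_right [OF E_sub P] by (rule image_mono)
  qed
qed

lemma card_q_p_group:
  assumes p: "Factorial_Ring.prime p" and P: "subgroup P G" "card P = p ^ a"
  obtains c where "card (q ` P) = p ^ c"
proof -
  have "\<exists>j. card (q ` P) = card {\<one>\<^bsub>G Mod E\<^esub>} * p ^ j"
  proof (rule Q.index_prime_power [OF p Q.triv_subgroup q_subgroup [OF P(1)]])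
    show "{\<one>\<^bsub>G Mod E\<^esub>} \<subseteq> q ` P"
      using subgroup.one_closed [OF q_subgroup [OF P(1)]] by simp
    show "x [^]\<^bsub>G Mod E\<^esub> (p ^ a) \<in> {\<one>\<^bsub>G Mod E\<^esub>}" if x: "x \<in> q ` P" for x
    proof -
      obtain y where y: "y \<in> P" "x = q y" using x by auto
      have "y \<in> carrier G" "y [^] (p ^ a) = \<one>"
        using y P subgroup_carrier pow_card_eq_one [OF P(1)] by auto
      then show ?thesis using q_pow [of y "p ^ a"] y hom.hom_one by simp
    qed
  qed
  then show ?thesis using that by auto
qed

lemma order_quotient: "order (G Mod E) * card E = order G"
  using card_q_image [OF subgroup_self subgroup.subset [OF E_sub]]
  by (simp add: order_def carrier_quotient)

text \<open>\<open>P\<close> and E P have the same image, and the index of E P divides that of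
  \<open>P\<close>.\<close>

lemma sylow_quotient:
  assumes P: "subgroup P G" and n: "order G = card P * n" "\<not> p dvd n"
  obtains n' where "order (G Mod E) = card (q ` P) * n'" "\<not> p dvd n'"
proof -
  have Pc: "P \<subseteq> carrier G" using P by (rule subgroup.subset)
  let ?V = "E <#> P"
  have V: "subgroup ?V G" "E \<subseteq> ?V" "P \<subseteq> ?V"
    using subgroup_set_mult_invar [OF E_sub P normal_invar [OF E_normal Pc]]
      subset_set_mult_left [OF subgroup.subset [OF E_sub] P] subset_set_mult_right [OF E_sub Pc] by auto
  obtain d where d: "card ?V = card P * d" using card_dvd_subgroup [OF P V(1,3)] by blast
  obtain c where c: "order G = card ?V * c"
    using card_dvd_subgroup [OF V(1) subgroup_self subgroup.subset [OF V(1)]] by (auto simp: order_def)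
  have "n = d * c" using n(1) c d card_subgroup_pos [OF P] by (simp add: mult.assoc)
  then have pc: "\<not> p dvd c" using n(2) by auto
  have "order (G Mod E) * card E = card (q ` P) * c * card E"
    using order_quotient c card_q_image [OF V(1,2)] by (simp add: q_set_mult [OF Pc] mult.assoc mult.commute)
  then have "order (G Mod E) = card (q ` P) * c" using card_subgroup_pos [OF E_sub] by simp
  then show ?thesis using that pc by blast
qed

text \<open>Frattini argument in V = E P: if g normalises \<open>P\<close> modulo \<open>E\<close>,
  its conjugate of \<open>P\<close> is a Sylow subgroup of V, and some v in V moves it back to
  \<open>P\<close>. Then v g lies in N(P) = P C(P), while v agrees with an element of
  \<open>P\<close> modulo \<open>E\<close>.\<close>

lemma centralised_by_normalizer_quotient:
  assumes p: "Factorial_Ring.prime p" and P: "subgroup P G" "card P = p ^ a"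
    and n: "order G = card P * n" "\<not> p dvd n" and ctrl: "centralised_by_normalizer P"
  shows "Q.centralised_by_normalizer (q ` P)"
  unfolding Q.centralised_by_normalizer_def
proof
  have Pc: "P \<subseteq> carrier G" using P(1) by (rule subgroup.subset)
  have Pc': "x \<in> carrier G" if "x \<in> P" for x using that Pc by blast
  let ?V = "E <#> P"
  have V: "subgroup ?V G" "E \<subseteq> ?V" "P \<subseteq> ?V"
    using subgroup_set_mult_invar [OF E_sub P(1) normal_invar [OF E_normal Pc]]
      subset_set_mult_left [OF subgroup.subset [OF E_sub] P(1)] subset_set_mult_right [OF E_sub Pc] by auto
  fix h assume h: "h \<in> normalizer (G Mod E) (q ` P)"
  have qP: "q ` P \<subseteq> carrier (G Mod E)" using Pc carrier_quotient by auto
  obtain g where g: "g \<in> carrier G" "h = q g"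
    using h Q.mem_normalizer_iff [OF qP] carrier_quotient by auto
  let ?Q = "cj g ` P"
  have Qs: "subgroup ?Q G" by (rule subgroup_cj_image [OF P(1) g(1)])
  have cQ: "card ?Q = card P" by (rule card_cj_image [OF Pc g(1)])
  have QV: "?Q \<subseteq> ?V"
  proof
    fix y assume "y \<in> ?Q"
    then obtain x where x: "x \<in> P" "y = cj g x" by auto
    have "conj_by (G Mod E) (q g) (q x) \<in> q ` P"
      using h x(1) unfolding Q.mem_normalizer_iff [OF qP] g(2) by blast
    then have "q (cj g x) \<in> q ` P" unfolding q_conj [OF g(1) Pc' [OF x(1)]] .
    then have "q y \<in> q ` ?V" using x q_set_mult [OF Pc] by simp
    then show "y \<in> ?V" using q_image_iff [OF V(1,2)] x g(1) Pc' by auto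
  qed
  obtain d where d: "card ?V = card P * d" using card_dvd_subgroup [OF P(1) V(1,3)] by blast
  have "card ?V dvd order G"
    using card_dvd_subgroup [OF V(1) subgroup_self subgroup.subset [OF V(1)]] by (simp add: order_def)
  then have "d dvd n" using n d card_subgroup_pos [OF P(1)] by simp
  then have "\<not> p dvd d" using n(2) by (meson dvd_trans)
  then obtain v where v: "v \<in> ?V" "cj v ` ?Q = P"
    using sylow_conjugate [OF p V(1) P(1) V(3) d _ Qs QV] cQ P(2) by metis
  obtain e w where ew: "e \<in> E" "w \<in> P" "v = e \<otimes> w" using v(1) by (rule set_multE)
  have ec: "e \<in> carrier G" using ew E_sub subgroup_carrier by blast
  have vc: "v \<in> carrier G" using ew ec Pc' by simp
  have "v \<otimes> g \<in> normalizer G P" unfolding mem_normalizer_iff [OF Pc]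
  proof (intro conjI ballI)
    fix y assume y: "y \<in> P"
    then have "cj v (cj g y) \<in> P" using v(2) by blast
    then show "cj (v \<otimes> g) y \<in> P" using vc g Pc' [OF y] by (simp add: cj_cj)
  qed (use vc g in simp)
  then obtain u y where uy: "u \<in> P" "y \<in> carrier G" "v \<otimes> g = u \<otimes> y" "\<forall>x\<in>P. cj y x = x"
    using ctrl unfolding centralised_by_normalizer_def by blast
  have qv: "q v = q w" using ew ec Pc' by (subst q_eq_iff) auto
  have wu: "inv w \<otimes> u \<in> P" using ew uy P(1) by (simp add: subgroup.m_closed subgroup.m_inv_closed)
  have "q (w \<otimes> g) = q (u \<otimes> y)"
    using q_mult [OF vc g(1)] q_mult [OF Pc' [OF ew(2)] g(1)] qv uy(3) by simp
  then have "q (inv w \<otimes> (w \<otimes> g)) = q (inv w \<otimes> (u \<otimes> y))"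
    using q_mult [of "inv w" "w \<otimes> g"] q_mult [of "inv w" "u \<otimes> y"] Pc' ew uy g by simp
  then have "h = q ((inv w \<otimes> u) \<otimes> y)" using g Pc' ew uy by (simp add: m_assoc)
  also have "\<dots> = q (inv w \<otimes> u) \<otimes>\<^bsub>G Mod E\<^esub> q y" using Pc' ew uy by (intro q_mult) auto
  finally have "h = q (inv w \<otimes> u) \<otimes>\<^bsub>G Mod E\<^esub> q y" .
  moreover have "\<forall>x\<in>q ` P. conj_by (G Mod E) (q y) x = x" using uy Pc' q_conj by auto
  ultimately show "\<exists>x\<in>q ` P. \<exists>y\<in>carrier (G Mod E).
      h = x \<otimes>\<^bsub>G Mod E\<^esub> y \<and> (\<forall>u\<in>q ` P. conj_by (G Mod E) y u = u)"
    using wu uy(2) by (intro bexI [of _ "q (inv w \<otimes> u)"] bexI [of _ "q y"]) auto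
qed

text \<open>\<open>p_nilpotent_over_central_Int\<close> in G/E. As \<open>E\<close> lies in
  \<open>A\<close>, the images of \<open>P\<close> and \<open>A\<close> meet in the image of P meet
  A, which \<open>central\<close> places in the centre of the image of \<open>P\<close>.\<close>

lemma p_nilpotent_over_avoid:
  assumes p: "Factorial_Ring.prime p" and P: "subgroup P G" "card P = p ^ a"
    and n: "order G = card P * n" "\<not> p dvd n" and ctrl: "centralised_by_normalizer P"
    and A: "A \<lhd> G" "E \<subseteq> A"
    and central: "\<And>u x. u \<in> P \<inter> A \<Longrightarrow> x \<in> P \<Longrightarrow> cj x u \<otimes> inv u \<in> E"
    and over: "p_nilpotent_over p G A"
  shows "p_nilpotent_over p G E"
proof (rule p_nilpotent_over_preimage)
  have Pc': "x \<in> carrier G" if "x \<in> P" for x using that P(1) subgroup_carrier by blast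
  obtain c where c: "card (q ` P) = p ^ c" using card_q_p_group [OF p P] by blast
  obtain n' where n': "order (G Mod E) = card (q ` P) * n'" "\<not> p dvd n'"
    using sylow_quotient [OF P(1) n] by blast
  have "p_nilpotent_over p (G Mod E) {\<one>\<^bsub>G Mod E\<^esub>}"
  proof (rule Q.p_nilpotent_over_central_Int [OF p q_subgroup [OF P(1)] c n'])
    show "Q.centralised_by_normalizer (q ` P)"
      by (rule centralised_by_normalizer_quotient [OF p P n ctrl])
    show "q ` A \<lhd> G Mod E" by (rule q_normal [OF A(1)])
    show "p_nilpotent_over p (G Mod E) (q ` A)" by (rule p_nilpotent_over_quotient [OF A(2) over])
    fix u x assume "u \<in> q ` P \<inter> q ` A" "x \<in> q ` P"
    then obtain u' x' where ux: "u' \<in> P" "u = q u'" "u \<in> q ` A" "x' \<in> P" "x = q x'" by auto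
    have "u' \<in> A" using q_image_iff [OF normal_imp_subgroup [OF A(1)] A(2)] ux Pc' by auto
    then have "cj x' u' \<otimes> inv u' \<in> E" using central ux by blast
    then have "q (cj x' u') = q u'" using ux Pc' by (subst q_eq_iff) auto
    then show "conj_by (G Mod E) x u = u" using ux Pc' q_conj by simp
  qed
  then show "p_nilpotent_over p (G Mod E) {E}" by simp
qed

text \<open>Modulo \<open>E\<close> the subgroup \<open>A\<close> lies in the image of
  \<open>R\<close>, and elements common to all maximal subgroups of \<open>P\<close> are
  non-generators; this survives in the quotient.\<close>

lemma p_nilpotent_over_cover:
  assumes p: "Factorial_Ring.prime p" and P: "subgroup P G" "card P = p ^ a"
    and R: "R \<subseteq> P" "\<And>M. maximal_in G M P \<Longrightarrow> R \<subseteq> M"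
    and A: "A \<lhd> G" "E \<subseteq> A" "A \<subseteq> R <#> E"
    and over: "p_nilpotent_over p G A"
  shows "p_nilpotent_over p G E"
proof (rule p_nilpotent_over_preimage)
  have Pc': "x \<in> carrier G" if "x \<in> P" for x using that P(1) subgroup_carrier by blast
  have Ec: "x \<in> carrier G" if "x \<in> E" for x using that E_sub subgroup_carrier by blast
  obtain c where c: "card (q ` P) = p ^ c" using card_q_p_group [OF p P] by blast
  have qA: "q ` A \<subseteq> q ` R"
  proof
    fix y assume "y \<in> q ` A"
    then obtain r e where re: "r \<in> R" "e \<in> E" "y = q (r \<otimes> e)" using A(3) by (auto elim!: set_multE)
    have rc: "r \<in> carrier G" "e \<in> carrier G" using re R Pc' Ec by auto
    have "r \<otimes> e \<otimes> inv r \<in> E" using normal_cj [OF E_normal rc(1) re(2)] by (simp add: conj_by_def)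
    then have "q (r \<otimes> e) = q r" using rc by (subst q_eq_iff) auto
    then have "y = q r" using re by simp
    then show "y \<in> q ` R" using re by blast
  qed
  have "p_nilpotent_over p (G Mod E) {\<one>\<^bsub>G Mod E\<^esub>}"
  proof (rule Q.p_nilpotent_over_nongenerators [OF p q_normal [OF A(1)] q_subgroup [OF P(1)] _ c])
    show "q ` A \<subseteq> q ` P" using qA image_mono [OF R(1)] by (rule subset_trans)
    show "p_nilpotent_over p (G Mod E) (q ` A)" by (rule p_nilpotent_over_quotient [OF A(2) over])
    show "{\<one>\<^bsub>G Mod E\<^esub>} \<lhd> G Mod E" by (rule Q.one_is_normal)
    show "{\<one>\<^bsub>G Mod E\<^esub>} \<subseteq> q ` A"
      using subgroup.one_closed [OF q_subgroup [OF normal_imp_subgroup [OF A(1)]]] by simp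
    fix H assume H: "subgroup H (G Mod E)" "H \<subseteq> q ` P" "q ` P \<subseteq> q ` A <#>\<^bsub>G Mod E\<^esub> H"
    define J where "J = P \<inter> preimage H"
    have J: "subgroup J G" unfolding J_def
      using P(1) preimage_subgroup [OF H(1)] by (rule subgroups_Inter_pair)
    have "J = P"
    proof (rule ccontr)
      assume "J \<noteq> P"
      then obtain M where M: "maximal_in G M P" "J \<subseteq> M"
        using maximal_in_exists [OF J _ P(1)] by (auto simp: J_def)
      then have Ms: "subgroup M G" "M \<subset> P" by (auto simp: maximal_in_def)
      \<comment> \<open>With q x = q r q y, r in R and y in J, write x as x (r y)^-1 times r y. The
        first factor is in P meet E, hence in J; so all factors lie in M.\<close>
      have "P \<subseteq> M"
      proof
        fix x assume x: "x \<in> P"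
        then have "q x \<in> q ` A <#>\<^bsub>G Mod E\<^esub> H" using H(3) by blast
        then obtain b h where bh: "b \<in> q ` A" "h \<in> H" "q x = b \<otimes>\<^bsub>G Mod E\<^esub> h"
          by (rule Q.set_multE)
        obtain r where r: "r \<in> R" "b = q r" using bh(1) qA by auto
        obtain y where y: "y \<in> P" "h = q y" using bh(2) H(2) by auto
        have cc: "r \<in> carrier G" "y \<in> carrier G" "x \<in> carrier G" using r R y x Pc' by auto
        have yJ: "y \<in> J" using y bh(2) cc by (simp add: J_def preimage_def)
        have rP: "r \<in> P" using r R by blast
        have "q x = q (r \<otimes> y)" using bh(3) r y q_mult [OF cc(1,2)] by simp
        then have "x \<otimes> inv (r \<otimes> y) \<in> E" using cc by (subst (asm) q_eq_iff) auto
        moreover have xry: "x \<otimes> inv (r \<otimes> y) \<in> carrier G" using cc by simp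
        ultimately have "q (x \<otimes> inv (r \<otimes> y)) = E" by (simp only: q_one_iff)
        then have "q (x \<otimes> inv (r \<otimes> y)) \<in> H" using subgroup.one_closed [OF H(1)] by simp
        moreover have "x \<otimes> inv (r \<otimes> y) \<in> P"
          using subgroup.m_closed [OF P(1) x subgroup.m_inv_closed [OF P(1) subgroup.m_closed [OF P(1) rP y(1)]]] .
        ultimately have "x \<otimes> inv (r \<otimes> y) \<in> J" using xry unfolding J_def preimage_def by blast
        then have "x \<otimes> inv (r \<otimes> y) \<in> M" using M(2) by blast
        moreover have "r \<otimes> y \<in> M"
          using subgroup.m_closed [OF Ms(1)] R(2) [OF M(1)] r(1) M(2) yJ by (meson subsetD)
        ultimately have "x \<otimes> inv (r \<otimes> y) \<otimes> (r \<otimes> y) \<in> M" by (rule subgroup.m_closed [OF Ms(1)])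
        then show "x \<in> M" using cc by simp
      qed
      then show False using Ms by blast
    qed
    then show "H = q ` P" using H(2) by (auto simp: J_def preimage_def)
  qed
  then show "p_nilpotent_over p (G Mod E) {E}" by simp
qed

end

context finite_group
begin

text \<open>Downward induction along the series, with j counting the steps from the top.
  \<open>C\<close> is only asked to increase weakly, because it will be a chief series of a larger
  group intersected with a normal subgroup. \<open>R\<close> stands for the derived subgroup of
  \<open>P\<close>.\<close>

theorem p_nilpotent_over_cover_avoid:
  assumes p: "Factorial_Ring.prime p" and P: "subgroup P G" "card P = p ^ a"
    and n: "order G = card P * n" "\<not> p dvd n" and ctrl: "centralised_by_normalizer P"
    and R: "R \<subseteq> P" "\<And>M. maximal_in G M P \<Longrightarrow> R \<subseteq> M"
      "\<And>x y. x \<in> P \<Longrightarrow> y \<in> P \<Longrightarrow> cj x y \<otimes> inv y \<in> R"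
    and C: "C 0 = {\<one>}" "C l = carrier G" "\<And>i. i \<le> l \<Longrightarrow> C i \<lhd> G"
      "\<And>i. i < l \<Longrightarrow> C i \<subseteq> C (Suc i)"
      "\<And>i. i < l \<Longrightarrow> C (Suc i) \<subseteq> R <#> C i \<or> R \<inter> C (Suc i) \<subseteq> C i"
  shows "p_nilpotent_over p G {\<one>}"
proof -
  have "p_nilpotent_over p G (C (l - j))" if "j \<le> l" for j
    using that
  proof (induction j)
    case 0
    have top: "carrier G \<lhd> G"
      unfolding normal_iff_invar using subgroup_self by (auto simp: invar_def)
    have "p_nilpotent_over p G (carrier G)" unfolding p_nilpotent_over_def
    proof (intro conjI exI ballI)
      show "carrier G \<lhd> G" "carrier G \<lhd> G" by (rule top)+
      show "\<not> p dvd (1::nat)" using p by (simp add: prime_nat_iff)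
      show "x [^] (p ^ 0) \<in> carrier G" if "x \<in> carrier G" for x using that by simp
    qed auto
    then show ?case using C(2) by simp
  next
    case (Suc j)
    let ?i = "l - Suc j"
    have i: "?i < l" "Suc ?i = l - j" using Suc.prems by auto
    have N: "C ?i \<lhd> G" "C (Suc ?i) \<lhd> G" using C(3) i by auto
    have over: "p_nilpotent_over p G (C (Suc ?i))" using Suc i by simp
    interpret normal_quotient G "C ?i"
      by (intro normal_quotient.intro normal_quotient_axioms.intro finite_group_axioms N)
    show ?case using C(5) [OF i(1)]
    proof
      assume "C (Suc ?i) \<subseteq> R <#> C ?i"
      then show ?thesis using p_nilpotent_over_cover [OF p P R(1,2) N(2) C(4) [OF i(1)] _ over] by blast
    next
      assume av: "R \<inter> C (Suc ?i) \<subseteq> C ?i"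
      show ?thesis
      proof (rule p_nilpotent_over_avoid [OF p P n ctrl N(2) C(4) [OF i(1)] _ over])
        \<comment> \<open>In the avoided case the commutators of P with P meet C (Suc i) lie in R
          and in C (Suc i), hence in C i: the section is central in the image of P.\<close>
        fix u x assume u: "u \<in> P \<inter> C (Suc ?i)" and x: "x \<in> P"
        have xc: "x \<in> carrier G" using x P(1) subgroup_carrier by blast
        note Ns = normal_imp_subgroup [OF N(2)]
        have "cj x u \<otimes> inv u \<in> C (Suc ?i)"
          using normal_cj [OF N(2) xc] u subgroup.m_inv_closed [OF Ns] by (intro subgroup.m_closed [OF Ns]) auto
        then show "cj x u \<otimes> inv u \<in> C ?i" using R(3) [OF x] u av by blast
      qed
    qed
  qed
  from this [of l] show ?thesis using C(1) by simp
qed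

end

section \<open>The partial \<open>\<Pi>\<close>-property of \<open>p\<close>-subgroups\<close>

lemma chief_series_Suc:
  assumes "chief_series G n C" "i < n"
  shows "C i \<subset> C (Suc i)" "\<not> (\<exists>L. L \<lhd> G \<and> C i \<subset> L \<and> L \<subset> C (Suc i))"
proof -
  have "\<forall>j\<in>{1..n}. C (j - 1) \<subset> C j \<and> \<not> (\<exists>L. L \<lhd> G \<and> C (j - 1) \<subset> L \<and> L \<subset> C j)"
    using assms(1) unfolding chief_series_def by blast
  moreover have "Suc i \<in> {1..n}" using assms(2) by simp
  ultimately show "C i \<subset> C (Suc i)" "\<not> (\<exists>L. L \<lhd> G \<and> C i \<subset> L \<and> L \<subset> C (Suc i))"
    by (metis diff_Suc_1)+
qed

context finite_group
begin

text \<open>The sections of a p-group are p-groups, so the index in the property has no prime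
  divisor but p. T is the preimage of the normalizer of the section, and invariance is pulled back
  from the quotient.\<close>

lemma partial_Pi_property_p_group:
  assumes p: "Factorial_Ring.prime p" and H: "card H = p ^ a"
    and Pi: "partial_Pi_property H G"
  obtains n C where "chief_series G n C"
    "\<And>i. i \<in> {1..n} \<Longrightarrow> \<exists>T k. subgroup T G \<and> invar G T ((H <#> C (i - 1)) \<inter> C i) \<and>
      order G dvd card T * p ^ k"
proof -
  have Hs: "subgroup H G" using Pi by (simp add: partial_Pi_property_def)
  obtain n C where C: "chief_series G n C"
    and ind: "\<And>i. i \<in> {1..n} \<Longrightarrow>
      (let K = C (i - 1); Q = G Mod K;
           S = carrier (G\<lparr>carrier := H <#> K\<rparr> Mod K) \<inter> carrier (G\<lparr>carrier := C i\<rparr> Mod K)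
       in pi_number (group_primes (Q\<lparr>carrier := S\<rparr>)) (subgroup_index Q (normalizer Q S)))"
    using Pi unfolding partial_Pi_property_def by blast
  have "\<exists>T k. subgroup T G \<and> invar G T ((H <#> C (i - 1)) \<inter> C i) \<and> order G dvd card T * p ^ k"
    if i: "i \<in> {1..n}" for i
  proof -
    let ?K = "C (i - 1)"
    have N: "?K \<lhd> G" "C i \<lhd> G" and KC: "?K \<subseteq> C i"
      using C i unfolding chief_series_def by auto
    interpret normal_quotient G ?K
      by (intro normal_quotient.intro normal_quotient_axioms.intro finite_group_axioms N)
    let ?Q = "G Mod ?K"
    let ?W = "(H <#> ?K) \<inter> C i"
    have Hc: "H \<subseteq> carrier G" using Hs by (rule subgroup.subset)
    \<comment> \<open>The property is phrased with H K, the rules for quotients with K H.\<close>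
    have comm: "H <#> ?K = ?K <#> H"
    proof (intro equalityI subsetI)
      fix x assume "x \<in> H <#> ?K"
      then obtain h k where hk: "h \<in> H" "k \<in> ?K" "x = h \<otimes> k" by (rule set_multE)
      have c: "h \<in> carrier G" "k \<in> carrier G" using hk Hc E_sub subgroup_carrier by auto
      have "x = cj h k \<otimes> h" using c hk by (simp add: conj_by_def)
      then show "x \<in> ?K <#> H" using normal_cj [OF N(1) c(1) hk(2)] hk(1) set_multI by simp
    next
      fix x assume "x \<in> ?K <#> H"
      then obtain k h where hk: "k \<in> ?K" "h \<in> H" "x = k \<otimes> h" by (rule set_multE)
      have c: "h \<in> carrier G" "k \<in> carrier G" using hk Hc E_sub subgroup_carrier by auto
      have "x = h \<otimes> cj (inv h) k" using c hk by (simp add: conj_by_def m_assoc)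
      then show "x \<in> H <#> ?K" using normal_cj [OF N(1) _ hk(1), of "inv h"] c hk(2) set_multI by simp
    qed
    have HK: "subgroup (H <#> ?K) G" unfolding comm
      by (rule subgroup_set_mult_invar [OF E_sub Hs normal_invar [OF N(1) Hc]])
    have K_HK: "?K \<subseteq> H <#> ?K" by (rule subset_set_mult_right [OF Hs subgroup.subset [OF E_sub]])
    have Ws: "subgroup ?W G" using HK normal_imp_subgroup [OF N(2)] by (simp add: subgroups_Inter_pair)
    have KW: "?K \<subseteq> ?W" using K_HK KC by blast
    define S where "S = carrier (G\<lparr>carrier := H <#> ?K\<rparr> Mod ?K) \<inter> carrier (G\<lparr>carrier := C i\<rparr> Mod ?K)"
    have S: "S = q ` ?W"
    proof -
      have "S = q ` (H <#> ?K) \<inter> q ` C i" by (simp add: S_def carrier_FactGroup)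
      also have "\<dots> = q ` ?W"
      proof
        show "q ` (H <#> ?K) \<inter> q ` C i \<subseteq> q ` ?W"
        proof
          fix y assume y: "y \<in> q ` (H <#> ?K) \<inter> q ` C i"
          then obtain x where x: "x \<in> H <#> ?K" "y = q x" by auto
          have "x \<in> carrier G" using x(1) HK subgroup_carrier by blast
          then have "x \<in> C i" using y x q_image_iff [OF normal_imp_subgroup [OF N(2)] KC] by auto
          then show "y \<in> q ` ?W" using x by blast
        qed
      qed auto
      finally show ?thesis .
    qed
    have Ss: "subgroup S ?Q" unfolding S by (rule q_subgroup [OF Ws])
    have Sc: "S \<subseteq> carrier ?Q" using Ss by (rule subgroup.subset)
    have "\<exists>j. card S = card {\<one>\<^bsub>?Q\<^esub>} * p ^ j"
    proof (rule Q.index_prime_power [OF p Q.triv_subgroup Ss])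
      show "{\<one>\<^bsub>?Q\<^esub>} \<subseteq> S" using subgroup.one_closed [OF Ss] by simp
      fix x assume "x \<in> S"
      then have "x \<in> q ` (?K <#> H)" unfolding S comm by blast
      then obtain h where h: "h \<in> H" "x = q h" unfolding q_set_mult [OF Hc] by blast
      have hc: "h \<in> carrier G" using h Hc by blast
      have "h [^] (p ^ a) = \<one>" using pow_card_eq_one [OF Hs h(1)] H by simp
      then have "x [^]\<^bsub>?Q\<^esub> (p ^ a) = q \<one>" unfolding h(2) q_pow [OF hc] by simp
      then show "x [^]\<^bsub>?Q\<^esub> (p ^ a) \<in> {\<one>\<^bsub>?Q\<^esub>}" using hom.hom_one by simp
    qed
    then obtain j where j: "card S = p ^ j" by auto
    define Nb where "Nb = normalizer ?Q S"
    have Nb: "subgroup Nb ?Q" unfolding Nb_def by (rule Q.normalizer_subgroup [OF Sc])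
    have pi: "pi_number (group_primes (?Q\<lparr>carrier := S\<rparr>)) (subgroup_index ?Q Nb)"
      using ind [OF i] by (simp add: Let_def S_def Nb_def)
    have lag: "subgroup_index ?Q Nb * card Nb = order ?Q"
      unfolding subgroup_index_def by (rule Q.lagrange [OF Nb])
    have "\<exists>k. subgroup_index ?Q Nb = p ^ k"
    proof (rule prime_power_if_only_prime_divisor [OF p])
      show "0 < subgroup_index ?Q Nb" using pi by (simp add: pi_number_def)
      fix r assume r: "Factorial_Ring.prime r" "r dvd subgroup_index ?Q Nb"
      then have "r dvd card S" using pi by (auto simp: pi_number_def group_primes_def order_def)
      then show "r = p" unfolding j using p r(1) by (metis prime_dvd_power primes_dvd_imp_eq)
    qed
    then obtain k where k: "subgroup_index ?Q Nb = p ^ k" by blast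
    let ?T = "preimage Nb"
    have T: "subgroup ?T G" "?K \<subseteq> ?T" using preimage_subgroup [OF Nb] E_subset_preimage [OF Nb] by auto
    have "q ` ?T = Nb"
      using subgroup.subset [OF Nb] unfolding carrier_quotient preimage_def by auto
    then have "card Nb * card ?K = card ?T" using card_q_image [OF T] by simp
    then have "order G = card ?T * p ^ k"
      using order_quotient lag k by (metis mult.assoc mult.commute)
    moreover have "invar G ?T ?W"
    proof (rule invarI)
      fix t u assume t: "t \<in> ?T" and u: "u \<in> ?W"
      have tc: "t \<in> carrier G" "q t \<in> Nb" using t unfolding preimage_def by blast+
      have uc: "u \<in> carrier G" using u Ws subgroup_carrier by blast
      have "q u \<in> S" unfolding S using u by blast
      then have "conj_by ?Q (q t) (q u) \<in> S"
        using Q.invar_normalizer [OF Sc] tc(2) unfolding Nb_def by (metis invarD)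
      then have "q (cj t u) \<in> q ` ?W" unfolding q_conj [OF tc(1) uc] S .
      then show "cj t u \<in> ?W" using q_image_iff [OF Ws KW] tc uc by simp
    qed
    ultimately show ?thesis using T(1) by (intro exI [of _ ?T] exI [of _ k]) simp
  qed
  then show ?thesis using that C by blast
qed

text \<open>Let i be least such that P meet C_i is not in \<open>E\<close>, and D = (P meet C_i)E.
  Since P meet C_{i-1} lies in \<open>E\<close> and so in \<open>M\<close>, the part of (M C_{i-1})
  meet C_i inside \<open>P\<close> is M meet C_i. Its product with \<open>E\<close> is M meet D by
  Dedekind's law, and both factors are invariant.\<close>

lemma partial_Pi_maximal:
  assumes p: "Factorial_Ring.prime p" and P: "P \<lhd> G" "card P = p ^ a"
    and M: "maximal_in G M P" and Pi: "partial_Pi_property M G"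
    and E: "E \<lhd> G" "E \<subseteq> M"
  shows "\<exists>D T k. D \<lhd> G \<and> E \<subset> D \<and> D \<subseteq> P \<and> subgroup T G \<and> invar G T (M \<inter> D) \<and>
    order G dvd card T * p ^ k"
proof -
  note Ps = normal_imp_subgroup [OF P(1)] and Es = normal_imp_subgroup [OF E(1)]
  have Ms: "subgroup M G" "M \<subset> P" using M by (auto simp: maximal_in_def)
  obtain b where b: "card M = p ^ b"
    using card_dvd_subgroup [OF Ms(1) Ps] Ms(2) P(2) p by (auto simp: divides_primepow_nat)
  obtain n C where C: "chief_series G n C"
    and T: "\<And>i. i \<in> {1..n} \<Longrightarrow> \<exists>T k. subgroup T G \<and> invar G T ((M <#> C (i - 1)) \<inter> C i) \<and>
      order G dvd card T * p ^ k"
    using partial_Pi_property_p_group [OF p b Pi] by blast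
  define i where "i = (LEAST i. \<not> P \<inter> C i \<subseteq> E)"
  have "C n = carrier G" using C by (simp add: chief_series_def)
  then have nn: "\<not> P \<inter> C n \<subseteq> E" using subgroup.subset [OF Ps] Ms(2) E(2) by blast
  then have i: "\<not> P \<inter> C i \<subseteq> E" unfolding i_def by (rule LeastI)
  have "i \<le> n" unfolding i_def using nn by (rule Least_le)
  have "i \<noteq> 0"
  proof
    assume "i = 0"
    then have "C i = {\<one>}" using C by (simp add: chief_series_def)
    then show False using i subgroup.one_closed [OF Es] by auto
  qed
  then have prev: "P \<inter> C (i - 1) \<subseteq> E"
    using not_less_Least [of "i - 1" "\<lambda>i. \<not> P \<inter> C i \<subseteq> E"] unfolding i_def [symmetric] by simp
  have mem: "i \<in> {1..n}" using \<open>i \<noteq> 0\<close> \<open>i \<le> n\<close> by simp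
  then have N: "C i \<lhd> G" "C (i - 1) \<lhd> G" using C by (auto simp: chief_series_def)
  obtain S k where S: "subgroup S G" "invar G S ((M <#> C (i - 1)) \<inter> C i)" "order G dvd card S * p ^ k"
    using T [OF mem] by blast
  let ?D = "(P \<inter> C i) <#> E"
  have PC: "P \<inter> C i \<lhd> G" by (rule normal_subgroup_intersect [OF P(1) N(1)])
  note PCs = normal_imp_subgroup [OF PC]
  have Dn: "?D \<lhd> G" by (rule normal_set_mult [OF PC E(1)])
  have "E \<subseteq> ?D" by (rule subset_set_mult_right [OF PCs subgroup.subset [OF Es]])
  moreover have "P \<inter> C i \<subseteq> ?D" by (rule subset_set_mult_left [OF subgroup.subset [OF PCs] Es])
  ultimately have ED: "E \<subset> ?D" using i by blast
  have DP: "?D \<subseteq> P" using set_mult_subset [OF Ps, of "P \<inter> C i" E] E(2) Ms(2) by blast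
  have MD: "M \<inter> ?D = (M \<inter> C i) <#> E"
    using set_mult_Int_modular [OF Es E(2) Ms(1) subgroup.subset [OF PCs]] Ms(2)
    by (simp add: Int_assoc [symmetric] inf.absorb1 psubset_imp_subset)
  \<comment> \<open>If m c lies in P with m in M and c in C (i - 1), then c is in P meet C (i - 1),
    hence in E and in M.\<close>
  have MC: "(M <#> C (i - 1)) \<inter> C i \<inter> P = M \<inter> C i"
  proof
    show "(M <#> C (i - 1)) \<inter> C i \<inter> P \<subseteq> M \<inter> C i"
    proof
      fix w assume w: "w \<in> (M <#> C (i - 1)) \<inter> C i \<inter> P"
      then obtain m c where mc: "m \<in> M" "c \<in> C (i - 1)" "w = m \<otimes> c" by (auto elim: set_multE)
      have cc: "c \<in> carrier G" using mc N(2) normal_imp_subgroup subgroup_carrier by blast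
      have "c \<in> P" using subgroup_cancel_left [OF Ps _ cc, of m] mc w Ms(2) by auto
      then have "c \<in> M" using prev mc E(2) by blast
      then show "w \<in> M \<inter> C i" using mc w Ms(1) by (simp add: subgroup.m_closed)
    qed
    have "M \<subseteq> M <#> C (i - 1)"
      by (rule subset_set_mult_left [OF subgroup.subset [OF Ms(1)] normal_imp_subgroup [OF N(2)]])
    then show "M \<inter> C i \<subseteq> (M <#> C (i - 1)) \<inter> C i \<inter> P" using Ms(2) by blast
  qed
  have Sc: "S \<subseteq> carrier G" using S(1) by (rule subgroup.subset)
  have "invar G S (M \<inter> C i)"
    using invar_Int [OF S(2) normal_invar [OF P(1) Sc]] unfolding MC .
  then have "invar G S (M \<inter> ?D)"
    unfolding MD using normal_invar [OF E(1) Sc] Sc subgroup.subset [OF Ms(1)] subgroup.subset [OF Es]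
    by (intro invar_set_mult) auto
  then show ?thesis using Dn ED DP S by blast
qed

text \<open>W = (R C_i) meet C_{i+1} is invariant under \<open>N\<close>, of index prime to p, and
  under a subgroup whose index divides a power of p, so it is normal. Lying between C_i and C_{i+1},
  it is one of them: the factor is avoided in the first case and covered in the second.\<close>

lemma partial_Pi_cover_avoid:
  assumes p: "Factorial_Ring.prime p" and R: "card R = p ^ a" and Pi: "partial_Pi_property R G"
    and N: "subgroup N G" "invar G N R" "order G = card N * l" "\<not> p dvd l"
  obtains n C where "chief_series G n C"
    "\<And>i. i < n \<Longrightarrow> C (Suc i) \<subseteq> R <#> C i \<or> R \<inter> C (Suc i) \<subseteq> C i"
proof -
  have Rs: "subgroup R G" using Pi by (simp add: partial_Pi_property_def)
  obtain n C where C: "chief_series G n C"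
    and T: "\<And>i. i \<in> {1..n} \<Longrightarrow> \<exists>T k. subgroup T G \<and> invar G T ((R <#> C (i - 1)) \<inter> C i) \<and>
      order G dvd card T * p ^ k"
    using partial_Pi_property_p_group [OF p R Pi] by blast
  have "C (Suc i) \<subseteq> R <#> C i \<or> R \<inter> C (Suc i) \<subseteq> C i" if i: "i < n" for i
  proof -
    have chief: "C i \<lhd> G" "C (Suc i) \<lhd> G" "C i \<subset> C (Suc i)"
      "\<not> (\<exists>L. L \<lhd> G \<and> C i \<subset> L \<and> L \<subset> C (Suc i))"
      using chief_series_Suc [OF C i] C i by (auto simp: chief_series_def)
    note Cs = chief(1,2) [THEN normal_imp_subgroup]
    let ?W = "(R <#> C i) \<inter> C (Suc i)"
    obtain S k where S: "subgroup S G" "invar G S ?W" "order G dvd card S * p ^ k"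
      using T [of "Suc i"] i by auto
    have Nc: "N \<subseteq> carrier G" using N(1) by (rule subgroup.subset)
    have Rc: "R \<subseteq> carrier G" using Rs by (rule subgroup.subset)
    have Wc: "?W \<subseteq> carrier G" using subgroup.subset [OF Cs(2)] by blast
    have "invar G N ?W"
      by (intro invar_Int invar_set_mult N(2) normal_invar chief Nc Rc subgroup.subset [OF Cs(1)])
    then have Winv: "invar G (carrier G) ?W"
      using normalizer_full [OF p Wc N(1) _ N(3,4) S] by blast
    have "subgroup ?W G"
    proof (rule submonoid_imp_subgroup [OF Wc])
      show "\<one> \<in> ?W" using set_multI [OF subgroup.one_closed [OF Rs] subgroup.one_closed [OF Cs(1)]]
        subgroup.one_closed [OF Cs(2)] by simp
      fix x y assume x: "x \<in> ?W" and y: "y \<in> ?W"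
      obtain r c where rc: "r \<in> R" "c \<in> C i" "x = r \<otimes> c" using x by (auto elim: set_multE)
      obtain s d where sd: "s \<in> R" "d \<in> C i" "y = s \<otimes> d" using y by (auto elim: set_multE)
      have cc: "r \<in> carrier G" "s \<in> carrier G" "c \<in> carrier G" "d \<in> carrier G"
        using rc sd Rc subgroup_carrier [OF Cs(1)] by auto
      have "x \<otimes> y = (r \<otimes> s) \<otimes> (cj (inv s) c \<otimes> d)"
        using cc rc sd by (simp add: conj_by_def m_assoc)
      moreover have "cj (inv s) c \<otimes> d \<in> C i"
        using normal_cj [OF chief(1) _ rc(2), of "inv s"] cc sd Cs(1) by (simp add: subgroup.m_closed)
      moreover have "r \<otimes> s \<in> R" using rc sd Rs by (simp add: subgroup.m_closed)
      ultimately have "x \<otimes> y \<in> R <#> C i" using set_multI by simp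
      moreover have "x \<otimes> y \<in> C (Suc i)" using x y by (intro subgroup.m_closed [OF Cs(2)]) auto
      ultimately show "x \<otimes> y \<in> ?W" by blast
    qed
    then have "?W \<lhd> G" using Winv by (simp add: normal_iff_invar)
    moreover have "C i \<subseteq> ?W"
      using subset_set_mult_right [OF Rs subgroup.subset [OF Cs(1)]] chief(3) by blast
    ultimately have "?W = C i \<or> ?W = C (Suc i)" using chief(4) by blast
    then show ?thesis
      using subset_set_mult_left [OF Rc Cs(1)] by blast
  qed
  then show ?thesis using that C by blast
qed

text \<open>A Sylow p-subgroup S of G meets \<open>K\<close> in a Sylow subgroup, which is conjugate
  to \<open>P\<close>. The corresponding conjugate of S normalises its intersection with the normal
  subgroup \<open>K\<close>, that is \<open>P\<close>. So N(P) contains a Sylow p-subgroup of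
  G.\<close>

lemma frattini_sylow:
  assumes p: "Factorial_Ring.prime p" and K: "K \<lhd> G"
    and P: "subgroup P G" "P \<subseteq> K" "card P = p ^ a" and n: "card K = card P * n" "\<not> p dvd n"
  obtains l where "order G = card (normalizer G P) * l" "\<not> p dvd l"
proof -
  note Ks = normal_imp_subgroup [OF K]
  have Pc: "P \<subseteq> carrier G" using P(1) by (rule subgroup.subset)
  obtain b m where bm: "order G = p ^ b * m" "\<not> p dvd m"
    using card_decompose [OF p subgroup_self] by (auto simp: order_def)
  obtain S where S: "subgroup S G" "card S = p ^ b"
    using sylow_exists [OF p subgroup_self, of b m] bm(1) by (auto simp: order_def)
  have ord: "order G = card S * m" using bm S by simp
  obtain c e where ce: "card (S \<inter> K) = p ^ c" "card K = card (S \<inter> K) * e" "\<not> p dvd e"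
    using sylow_Int_normal [OF p S ord bm(2) K] by blast
  have SK: "subgroup (S \<inter> K) G" using S Ks by (simp add: subgroups_Inter_pair)
  have eq: "card P = card (S \<inter> K)"
  proof -
    have "p ^ a * n = p ^ c * e" using n(1) ce(1,2) P(3) by simp
    then have "p ^ a dvd p ^ c * e" "p ^ c dvd p ^ a * n" by (metis dvd_triv_left)+
    then have "p ^ a dvd p ^ c" "p ^ c dvd p ^ a"
      using p ce(3) n(2) by (metis coprime_dvd_mult_left_iff coprime_power_left_iff prime_imp_coprime)+
    then show ?thesis using P(3) ce(1) by (simp add: dvd_antisym)
  qed
  obtain x where x: "x \<in> K" "cj x ` (S \<inter> K) = P"
    using sylow_conjugate [OF p Ks P(1,2) n SK _ ce(1) eq] by blast
  have xc: "x \<in> carrier G" using x Ks subgroup_carrier by blast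
  let ?N = "normalizer G P"
  have N: "subgroup ?N G" by (rule normalizer_subgroup [OF Pc])
  have SN: "cj x ` S \<subseteq> ?N"
  proof
    fix y assume "y \<in> cj x ` S"
    then obtain s where s: "s \<in> S" "y = cj x s" by auto
    have sc: "s \<in> carrier G" using s S subgroup_carrier by blast
    have "cj y u \<in> P" if u: "u \<in> P" for u
    proof -
      obtain v where v: "v \<in> S \<inter> K" "u = cj x v" using u x(2) by blast
      have vc: "v \<in> carrier G" using v S subgroup_carrier by blast
      have "cj s v \<in> S \<inter> K" using cj_subgroup [OF S(1) s(1)] normal_cj [OF K sc] v by simp
      then have "cj x (cj s v) \<in> P" using x(2) by blast
      moreover have "cj x (cj s v) = cj y u"
        using s v xc sc vc by (simp add: conj_by_def m_assoc inv_mult_group)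
      ultimately show ?thesis by simp
    qed
    then show "y \<in> ?N" using s sc xc by (simp add: mem_normalizer_iff [OF Pc])
  qed
  have "card (cj x ` S) = card S" by (rule card_cj_image [OF subgroup.subset [OF S(1)] xc])
  then obtain d where d: "card ?N = card S * d"
    using card_dvd_subgroup [OF subgroup_cj_image [OF S(1) xc] N SN] by (auto simp: dvd_def)
  obtain l where l: "order G = card ?N * l"
    using card_dvd_subgroup [OF N subgroup_self subgroup.subset [OF N]] by (auto simp: order_def)
  have "m = d * l" using ord l d card_subgroup_pos [OF S(1)] by (simp add: mult.assoc)
  then have "\<not> p dvd l" using bm(2) by auto
  then show ?thesis using that l by blast
qed

lemma commutator_mem_derived: "x \<in> P \<Longrightarrow> y \<in> P \<Longrightarrow> cj x y \<otimes> inv y \<in> derived G P"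
  unfolding derived_def conj_by_def by (rule generate.incl) blast

lemma derived_subset:
  assumes H: "subgroup H G" "\<And>x y. x \<in> P \<Longrightarrow> y \<in> P \<Longrightarrow> cj x y \<otimes> inv y \<in> H"
  shows "derived G P \<subseteq> H"
  unfolding derived_def
  by (rule generate_subgroup_incl [OF _ H(1)]) (use H(2) in \<open>auto simp: conj_by_def\<close>)

text \<open>The elements that g conjugates into P' form a subgroup, and it contains all commutators
  of \<open>P\<close>.\<close>

lemma normalizer_invar_derived:
  assumes P: "P \<subseteq> carrier G" shows "invar G (normalizer G P) (derived G P)"
proof (rule invarI)
  fix g u assume g: "g \<in> normalizer G P" and u: "u \<in> derived G P"
  have gc: "g \<in> carrier G" "\<And>x. x \<in> P \<Longrightarrow> cj g x \<in> P" using g mem_normalizer_iff [OF P] by auto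
  have D: "subgroup (derived G P) G" by (rule derived_is_subgroup [OF P])
  define H where "H = {x \<in> carrier G. cj g x \<in> derived G P}"
  have "subgroup H G"
    by (rule submonoid_imp_subgroup)
      (use gc(1) D in \<open>auto simp: H_def cj_mult subgroup.one_closed subgroup.m_closed\<close>)
  moreover have "cj x y \<otimes> inv y \<in> H" if "x \<in> P" "y \<in> P" for x y
  proof -
    have c: "x \<in> carrier G" "y \<in> carrier G" using that P by auto
    have "cj g (cj x y \<otimes> inv y) = cj (cj g x) (cj g y) \<otimes> inv (cj g y)"
      using c gc(1) by (simp add: conj_by_def m_assoc inv_mult_group)
    then show ?thesis using c commutator_mem_derived gc that by (simp add: H_def)
  qed
  ultimately show "cj g u \<in> derived G P" using derived_subset [of H P] u by (auto simp: H_def)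
qed

text \<open>From orders to exponents: Lagrange in the p-complement of G/N and in the quotient by
  it.\<close>

lemma p_nilpotent_imp_over:
  assumes p: "Factorial_Ring.prime p" and N: "N \<lhd> G"
    and pn: "p_nilpotent p (G Mod N)"
  shows "p_nilpotent_over p G N"
proof -
  interpret normal_quotient G N
    by (intro normal_quotient.intro normal_quotient_axioms.intro finite_group_axioms N)
  obtain K k where K: "K \<lhd> G Mod N" "\<not> p dvd card K" "order (G Mod N Mod K) = p ^ k"
    using pn unfolding p_nilpotent_def by blast
  note Ks = normal_imp_subgroup [OF K(1)]
  have "order (G Mod N Mod K) * card K = order (G Mod N)"
    using Q.lagrange [OF Ks] by (simp add: order_def FactGroup_def)
  then have ord: "order (G Mod N) = card K * p ^ k" using K(3) by (simp add: mult.commute)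
  have "p_nilpotent_over p (G Mod N) {\<one>\<^bsub>G Mod N\<^esub>}" unfolding p_nilpotent_over_def
  proof (intro conjI exI ballI)
    show "{\<one>\<^bsub>G Mod N\<^esub>} \<lhd> G Mod N" by (rule Q.one_is_normal)
    show "K \<lhd> G Mod N" "\<not> p dvd card K" by fact+
    show "{\<one>\<^bsub>G Mod N\<^esub>} \<subseteq> K" using subgroup.one_closed [OF Ks] by simp
    show "x [^]\<^bsub>G Mod N\<^esub> card K \<in> {\<one>\<^bsub>G Mod N\<^esub>}" if "x \<in> K" for x
      using Q.pow_card_eq_one [OF Ks that] by simp
    show "x [^]\<^bsub>G Mod N\<^esub> (p ^ k) \<in> K" if "x \<in> carrier (G Mod N)" for x
      using Q.pow_index_mem [OF Ks Q.subgroup_self subgroup.subset [OF Ks] _ _ that, of "p ^ k"]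
        Q.normal_invar [OF K(1)] ord by (simp add: order_def)
  qed
  then show ?thesis using p_nilpotent_over_preimage by simp
qed

lemma p_nilpotent_over_subgroupE:
  assumes "p_nilpotent_over p (G\<lparr>carrier := H\<rparr>) {\<one>}"
  obtains L m j where "L \<lhd> G\<lparr>carrier := H\<rparr>" "\<not> p dvd (m::nat)"
    "\<And>x. x \<in> L \<Longrightarrow> x [^] m = \<one>" "\<And>x. x \<in> H \<Longrightarrow> x [^] (p ^ j) \<in> L"
proof -
  obtain L m j where L: "L \<lhd> G\<lparr>carrier := H\<rparr> \<and> {\<one>} \<subseteq> L \<and> \<not> p dvd (m::nat) \<and>
      (\<forall>x\<in>L. x [^]\<^bsub>G\<lparr>carrier := H\<rparr>\<^esub> m \<in> {\<one>}) \<and>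
      (\<forall>x\<in>carrier (G\<lparr>carrier := H\<rparr>). x [^]\<^bsub>G\<lparr>carrier := H\<rparr>\<^esub> (p ^ j) \<in> L)"
    using assms unfolding p_nilpotent_over_def by (elim conjE exE) (intro that conjI)
  show ?thesis
    by (rule that [of L m j]) (use L in \<open>auto simp: nat_pow_consistent [symmetric]\<close>)
qed

text \<open>The complement of \<open>K\<close> consists of the elements of \<open>K\<close> killed
  by m, so it is invariant under G. Afterwards exponents are turned back into orders.\<close>

lemma p_nilpotent_if_normal_subgroup:
  assumes p: "Factorial_Ring.prime p" and K: "K \<lhd> G"
    and pow: "\<And>x. x \<in> carrier G \<Longrightarrow> x [^] (p ^ k) \<in> K"
    and over: "p_nilpotent_over p (G\<lparr>carrier := K\<rparr>) {\<one>}"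
  shows "p_nilpotent p G"
proof -
  note Ks = normal_imp_subgroup [OF K]
  have Kc: "x \<in> carrier G" if "x \<in> K" for x using that Ks subgroup_carrier by blast
  obtain L m j where "L \<lhd> G\<lparr>carrier := K\<rparr>" and m: "\<not> p dvd (m::nat)"
    and L1: "\<And>x. x \<in> L \<Longrightarrow> x [^] m = \<one>" and L2: "\<And>x. x \<in> K \<Longrightarrow> x [^] (p ^ j) \<in> L"
    using p_nilpotent_over_subgroupE [OF over] by blast
  then have L: "subgroup L G" "L \<subseteq> K" using normal_restrict_iff [OF Ks] by auto
  have L_iff: "x \<in> L \<longleftrightarrow> x [^] m = \<one>" if x: "x \<in> K" for x
  proof
    assume "x [^] m = \<one>"
    then have "x [^] m \<in> L" using subgroup.one_closed [OF L(1)] by simp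
    moreover have "coprime m (p ^ j)"
      using p m by (metis coprime_commute coprime_power_right_iff prime_imp_coprime)
    ultimately show "x \<in> L" using coprime_pow_mem [OF L(1) Kc [OF x] _ L2 [OF x]] by blast
  qed (rule L1)
  have "invar G (carrier G) L"
  proof (rule invarI)
    fix g x assume g: "g \<in> carrier G" and x: "x \<in> L"
    have xK: "x \<in> K" "x \<in> carrier G" using x L Kc by auto
    have "cj g x [^] m = \<one>" using L1 [OF x] g xK by (simp add: cj_pow [symmetric])
    then show "cj g x \<in> L" using L_iff normal_cj [OF K g xK(1)] by simp
  qed
  then have Ln: "L \<lhd> G" using L(1) by (simp add: normal_iff_invar)
  have "\<not> p dvd card L"
    using index_not_dvd [OF p triv_subgroup L(1) _ _ _ m, of "card L"] subgroup.one_closed [OF L(1)] L1 by simp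
  moreover have "\<exists>i. card (carrier G) = card L * p ^ i"
  proof (rule index_prime_power [OF p L(1) subgroup_self subgroup.subset [OF L(1)]])
    show "x [^] (p ^ (k + j)) \<in> L" if "x \<in> carrier G" for x
      using L2 [OF pow [OF that]] that by (simp add: nat_pow_pow power_add)
  qed
  then obtain i where "card (carrier G) = card L * p ^ i" by blast
  then have "order (G Mod L) = p ^ i"
    using lagrange [OF L(1)] card_subgroup_pos [OF L(1)] by (simp add: order_def FactGroup_def mult.commute)
  ultimately show ?thesis unfolding p_nilpotent_def using Ln by blast
qed

section \<open>Assembly of the two steps\<close>

lemma maximal_in_imp_maximal_subgroup:
  assumes P: "subgroup P G" and M: "maximal_in G M P"
  shows "maximal_subgroup M (G\<lparr>carrier := P\<rparr>)"
  using M unfolding maximal_in_def maximal_subgroup_def subgroup_iff_restrict [OF P]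
  by auto

lemma maximal_in_restrict:
  assumes Y: "subgroup Y G" and P: "P \<subseteq> Y"
  shows "maximal_in (G\<lparr>carrier := Y\<rparr>) M P \<longleftrightarrow> maximal_in G M P"
  unfolding maximal_in_def subgroup_iff_restrict [OF Y] using P by blast

lemma p_nilpotent_if_partial_Pi:
  assumes p: "Factorial_Ring.prime p" and gcd: "gcd (order G) (p - 1) = 1"
    and N: "N \<lhd> G" "p_nilpotent p (G Mod N)"
    and P: "sylow_subgroup p P (G\<lparr>carrier := N\<rparr>)"
    and maximal: "\<And>M. maximal_subgroup M (G\<lparr>carrier := P\<rparr>) \<Longrightarrow>
      partial_Pi_property M (G\<lparr>carrier := normalizer G P\<rparr>)"
    and derived: "partial_Pi_property (derived G P) G"
  shows "p_nilpotent p G"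
proof -
  note Ns = normal_imp_subgroup [OF N(1)]
  have "p_nilpotent_over p G N"
    by (rule p_nilpotent_imp_over [OF p N])
  then obtain K m k where K: "K \<lhd> G" "N \<subseteq> K" "\<not> p dvd (m::nat)"
    "\<And>x. x \<in> K \<Longrightarrow> x [^] m \<in> N" "\<And>x. x \<in> carrier G \<Longrightarrow> x [^] (p ^ k) \<in> K"
    unfolding p_nilpotent_over_def by blast
  note Ks = normal_imp_subgroup [OF K(1)]
  have Kc: "x \<in> carrier G" if "x \<in> K" for x using that Ks subgroup_carrier by blast
  define a where "a = multiplicity p (card N)"
  have Ps: "subgroup P G" "P \<subseteq> N" and cP: "card P = p ^ a"
    using P subgroup_iff_restrict [OF Ns] by (auto simp: sylow_subgroup_def a_def order_def)
  have PK: "P \<subseteq> K" using Ps(2) K(2) by blast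
  have Pc: "P \<subseteq> carrier G" using Ps(1) by (rule subgroup.subset)
  \<comment> \<open>P is Sylow in N, and p does not divide |K:N| because m-th powers of elements of
    K lie in N. So P is Sylow in K.\<close>
  obtain n where n: "card K = card P * n" "\<not> p dvd n"
  proof -
    have "\<not> p dvd card N div p ^ a"
      unfolding a_def using card_subgroup_pos [OF Ns] p
      by (intro multiplicity_decompose) (auto simp: not_prime_unit)
    moreover have "card N = p ^ a * (card N div p ^ a)"
      unfolding a_def by (simp add: multiplicity_dvd)
    moreover obtain t where t: "card K = card N * t" using card_dvd_subgroup [OF Ns Ks K(2)] by blast
    moreover have "\<not> p dvd t" using index_not_dvd [OF p Ns Ks K(2) t K(4) K(3)] by blast
    ultimately show ?thesis
      using that [of "(card N div p ^ a) * t"] cP p by (metis mult.assoc prime_dvd_mult_iff)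
  qed
  define Y where "Y = normalizer G P"
  have Y: "subgroup Y G" unfolding Y_def by (rule normalizer_subgroup [OF Pc])
  have Xc: "Y \<subseteq> carrier G" using Y by (rule subgroup.subset)
  have XP: "invar G Y P" unfolding Y_def by (rule invar_normalizer [OF Pc])
  have PX: "P \<subseteq> Y"
    unfolding Y_def using subset_normalizer_iff [OF Pc Pc] invar_self [OF Ps(1)] by simp
  interpret Y: finite_group "G\<lparr>carrier := Y\<rparr>" by (rule finite_group_subgroup [OF Y])
  have PnX: "P \<lhd> G\<lparr>carrier := Y\<rparr>" using normal_restrict_iff [OF Y] Ps PX XP by simp
  have KX: "subgroup (K \<inter> Y) G" using Ks Y by (rule subgroups_Inter_pair)
  have PKX: "P \<subseteq> K \<inter> Y" using PK PX by blast
  obtain n1 where n1: "card (K \<inter> Y) = card P * n1" using card_dvd_subgroup [OF Ps(1) KX PKX] by blast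
  have "card P * n1 dvd card P * n" using card_dvd_subgroup [OF KX Ks] n1 n by auto
  then have "n1 dvd n" using card_subgroup_pos [OF Ps(1)] by simp
  then have pn1: "\<not> p dvd n1" using n(2) by (meson dvd_trans)
  have pow_n1: "x [^] n1 \<in> P" if "x \<in> K \<inter> Y" for x
    using pow_index_mem [OF Ps(1) KX PKX _ n1 that] invar_mono [OF XP, of "K \<inter> Y"] by blast
  \<comment> \<open>The subgroup K meet Y is the p-complement modulo P: its elements reach P with
    the exponent n1, prime to p, and Y reaches it with the exponent p^k.\<close>
  have overX: "p_nilpotent_over p (G\<lparr>carrier := Y\<rparr>) P" unfolding p_nilpotent_over_def
  proof (intro conjI exI ballI)
    show "P \<lhd> G\<lparr>carrier := Y\<rparr>" by (rule PnX)
    show "K \<inter> Y \<lhd> G\<lparr>carrier := Y\<rparr>"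
      using normal_restrict_iff [OF Y] KX invar_Int [OF normal_invar [OF K(1) Xc] invar_self [OF Y]] by blast
    show "P \<subseteq> K \<inter> Y" "\<not> p dvd n1" by fact+
    show "x [^]\<^bsub>G\<lparr>carrier := Y\<rparr>\<^esub> n1 \<in> P" if "x \<in> K \<inter> Y" for x
      using pow_n1 [OF that] by (simp add: nat_pow_consistent [symmetric])
    show "x [^]\<^bsub>G\<lparr>carrier := Y\<rparr>\<^esub> (p ^ k) \<in> K \<inter> Y" if "x \<in> carrier (G\<lparr>carrier := Y\<rparr>)" for x
      using that K(5) [of x] Xc subgroup_pow [OF Y] by (auto simp: nat_pow_consistent [symmetric])
  qed
  have gcdX: "gcd (order (G\<lparr>carrier := Y\<rparr>)) (p - 1) = 1"
  proof -
    have "order (G\<lparr>carrier := Y\<rparr>) dvd order G"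
      using card_dvd_subgroup [OF Y subgroup_self Xc] by (simp add: order_def)
    then show ?thesis using gcd by (metis coprime_divisors coprime_iff_gcd_eq_1 dvd_refl)
  qed
  have "p_nilpotent_over p (G\<lparr>carrier := Y\<rparr>) {\<one>\<^bsub>G\<lparr>carrier := Y\<rparr>\<^esub>}"
  proof (rule Y.p_nilpotent_over_normal_p_subgroup [OF p gcdX PnX cP overX])
    fix M E assume M: "maximal_in (G\<lparr>carrier := Y\<rparr>) M P" and E: "E \<lhd> G\<lparr>carrier := Y\<rparr>" "E \<subseteq> M"
    have "partial_Pi_property M (G\<lparr>carrier := Y\<rparr>)"
      using maximal [OF maximal_in_imp_maximal_subgroup [OF Ps(1)]] M maximal_in_restrict [OF Y PX]
      unfolding Y_def by blast
    then show "\<exists>D T k. D \<lhd> G\<lparr>carrier := Y\<rparr> \<and> E \<subset> D \<and> D \<subseteq> P \<and> subgroup T (G\<lparr>carrier := Y\<rparr>) \<and>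
        invar (G\<lparr>carrier := Y\<rparr>) T (M \<inter> D) \<and> order (G\<lparr>carrier := Y\<rparr>) dvd card T * p ^ k"
      by (rule Y.partial_Pi_maximal [OF p PnX cP M _ E])
  qed
  then have "p_nilpotent_over p (G\<lparr>carrier := Y\<rparr>) {\<one>}" by simp
  from p_nilpotent_over_subgroupE [OF this]
  obtain L m' j where Ln: "L \<lhd> G\<lparr>carrier := Y\<rparr>" and m': "\<not> p dvd (m'::nat)"
    and L1: "\<And>x. x \<in> L \<Longrightarrow> x [^] m' = \<one>" and L2: "\<And>x. x \<in> Y \<Longrightarrow> x [^] (p ^ j) \<in> L"
    by blast
  have L: "subgroup L G" "L \<subseteq> Y" "invar G Y L" using Ln normal_restrict_iff [OF Y] by auto
  have LP: "x = \<one>" if "x \<in> L" "x \<in> P" for x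
    using mem_of_pow_p_group [OF p triv_subgroup Ps(1) cP that(2) _ m'] L1 [OF that(1)] by simp
  \<comment> \<open>L and P are normal in Y and meet trivially, since L has exponent prime to p. A
    commutator of y and u lies in both.\<close>
  have cent: "cj y u = u" if y: "y \<in> L" and u: "u \<in> P" for y u
  proof -
    have c: "y \<in> Y" "u \<in> Y" "y \<in> carrier G" "u \<in> carrier G" using y u L PX Xc by auto
    have "cj y u \<otimes> inv u \<in> P"
      using invarD [OF XP c(1) u] u Ps(1) by (simp add: subgroup.m_closed subgroup.m_inv_closed)
    moreover have "y \<otimes> cj u (inv y) \<in> L"
      using invarD [OF L(3) c(2)] y L(1) by (simp add: subgroup.m_closed subgroup.m_inv_closed)
    then have "cj y u \<otimes> inv u \<in> L" using c by (simp add: conj_by_def m_assoc)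
    ultimately have "cj y u \<otimes> inv u = \<one>" using LP by blast
    then show ?thesis using c by (metis cj_closed inv_mult_cancel_right(1) l_one)
  qed
  interpret K: finite_group "G\<lparr>carrier := K\<rparr>" by (rule finite_group_subgroup [OF Ks])
  have PsK: "subgroup P (G\<lparr>carrier := K\<rparr>)" using subgroup_iff_restrict [OF Ks] Ps PK by simp
  have ordK: "order (G\<lparr>carrier := K\<rparr>) = card P * n" using n by (simp add: order_def)
  have PL: "subgroup (P <#> L) G"
    by (rule subgroup_set_mult_invar [OF Ps(1) L(1) invar_mono [OF XP L(2)]])
  have ctrl: "K.centralised_by_normalizer P"
    unfolding K.centralised_by_normalizer_def
  proof
    fix g assume g: "g \<in> normalizer (G\<lparr>carrier := K\<rparr>) P"
    have gK: "g \<in> K" "\<forall>u\<in>P. cj g u \<in> P"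
      using g K.mem_normalizer_iff [of P g] PK conj_by_restrict [OF Ks, of g] by auto
    then have gKX: "g \<in> K \<inter> Y" unfolding Y_def using mem_normalizer_iff [OF Pc] Kc by simp
    have gc: "g \<in> carrier G" using gK Kc by blast
    have "P \<subseteq> P <#> L" "L \<subseteq> P <#> L"
      using subset_set_mult_left [OF Pc L(1)] subset_set_mult_right [OF Ps(1) subgroup.subset [OF L(1)]] by auto
    \<comment> \<open>One power of g lies in P and another in L, with coprime exponents, so g lies
      in P L. As P is inside K, the factor from L is in K too.\<close>
    then have "g [^] n1 \<in> P <#> L" "g [^] (p ^ j) \<in> P <#> L"
      using pow_n1 [OF gKX] L2 [of g] gKX by auto
    moreover have "coprime n1 (p ^ j)"
      using p pn1 by (metis coprime_commute coprime_power_right_iff prime_imp_coprime)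
    ultimately have "g \<in> P <#> L" using coprime_pow_mem [OF PL gc] by blast
    then obtain x y where xy: "x \<in> P" "y \<in> L" "g = x \<otimes> y" by (rule set_multE)
    have yc: "y \<in> carrier G" using xy(2) L(1) subgroup_carrier by blast
    have "x \<in> K" "x \<otimes> y \<in> K" using xy PK gK by auto
    then have "y \<in> K" using subgroup_cancel_left [OF Ks _ yc] by blast
    then show "\<exists>x\<in>P. \<exists>y\<in>carrier (G\<lparr>carrier := K\<rparr>). g = x \<otimes>\<^bsub>G\<lparr>carrier := K\<rparr>\<^esub> y \<and>
        (\<forall>u\<in>P. conj_by (G\<lparr>carrier := K\<rparr>) y u = u)"
      using xy cent conj_by_restrict [OF Ks]
      by (intro bexI [of _ x] bexI [of _ y]) auto
  qed
  let ?R = "derived G P"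
  have Rs: "subgroup ?R G" by (rule derived_is_subgroup [OF Pc])
  have RP: "?R \<subseteq> P" by (rule derived_incl [OF subset_refl Ps(1)])
  obtain r where r: "card ?R = p ^ r"
    using card_dvd_subgroup [OF Rs Ps(1) RP] cP p by (auto simp: divides_primepow_nat)
  obtain l where l: "order G = card Y * l" "\<not> p dvd l"
    using frattini_sylow [OF p K(1) Ps(1) PK cP n] unfolding Y_def by blast
  have "invar G Y ?R" unfolding Y_def by (rule normalizer_invar_derived [OF Pc])
  then obtain d C where C: "chief_series G d C"
    and CA: "\<And>i. i < d \<Longrightarrow> C (Suc i) \<subseteq> ?R <#> C i \<or> ?R \<inter> C (Suc i) \<subseteq> C i"
    using partial_Pi_cover_avoid [OF p r derived Y _ l] by blast
  \<comment> \<open>The chief series of G is intersected with K, in which P is a Sylow subgroup. The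
    new factors may fail to be chief or may vanish, but covering and avoiding are inherited.\<close>
  have "p_nilpotent_over p (G\<lparr>carrier := K\<rparr>) {\<one>\<^bsub>G\<lparr>carrier := K\<rparr>\<^esub>}"
  proof (rule K.p_nilpotent_over_cover_avoid [OF p PsK cP ordK n(2) ctrl RP, where C = "\<lambda>i. C i \<inter> K" and l = d])
    fix M assume "maximal_in (G\<lparr>carrier := K\<rparr>) M P"
    then have M: "maximal_in G M P" using maximal_in_restrict [OF Ks PK] by simp
    then show "?R \<subseteq> M"
      using maximal_in_p_group(2) [OF p Ps(1) cP M] by (intro derived_subset) (simp_all add: maximal_in_def)
  next
    fix x y assume xy: "x \<in> P" "y \<in> P"
    then show "conj_by (G\<lparr>carrier := K\<rparr>) x y \<otimes>\<^bsub>G\<lparr>carrier := K\<rparr>\<^esub> inv\<^bsub>G\<lparr>carrier := K\<rparr>\<^esub> y \<in> ?R"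
      using commutator_mem_derived [OF xy] conj_by_restrict [OF Ks] m_inv_consistent [OF Ks] PK
      by (simp add: subsetD)
  next
    show "C 0 \<inter> K = {\<one>\<^bsub>G\<lparr>carrier := K\<rparr>\<^esub>}" using C subgroup.one_closed [OF Ks] by (auto simp: chief_series_def)
    show "C d \<inter> K = carrier (G\<lparr>carrier := K\<rparr>)" using C Kc by (auto simp: chief_series_def)
  next
    fix i assume "i \<le> d"
    then have "C i \<lhd> G" using C by (simp add: chief_series_def)
    then have "C i \<inter> K \<lhd> G" using K(1) by (rule normal_subgroup_intersect)
    then show "C i \<inter> K \<lhd> G\<lparr>carrier := K\<rparr>"
      using normal_restrict_iff [OF Ks] normal_imp_subgroup normal_invar subgroup.subset [OF Ks] by blast
  next
    fix i assume i: "i < d"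
    show "C i \<inter> K \<subseteq> C (Suc i) \<inter> K"
      using chief_series_Suc(1) [OF C i] by blast
    have Ci: "C i \<subseteq> carrier G" using C i by (simp add: chief_series_def normal_imp_subgroup subgroup.subset)
    show "C (Suc i) \<inter> K \<subseteq> ?R <#>\<^bsub>G\<lparr>carrier := K\<rparr>\<^esub> (C i \<inter> K) \<or> ?R \<inter> (C (Suc i) \<inter> K) \<subseteq> C i \<inter> K"
      using CA [OF i]
    proof
      assume cov: "C (Suc i) \<subseteq> ?R <#> C i"
      \<comment> \<open>Dedekind's law, as the derived subgroup lies in K.\<close>
      have "C (Suc i) \<inter> K \<subseteq> ?R <#> (C i \<inter> K)"
      proof
        fix w assume w: "w \<in> C (Suc i) \<inter> K"
        then have "w \<in> ?R <#> C i" using cov by blast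
        then obtain x c where xc: "x \<in> ?R" "c \<in> C i" "w = x \<otimes> c" by (rule set_multE)
        have "x \<in> K" "x \<otimes> c \<in> K" using xc RP PK w by auto
        then have "c \<in> K" using subgroup_cancel_left [OF Ks _ subsetD [OF Ci xc(2)]] by blast
        then show "w \<in> ?R <#> (C i \<inter> K)" using xc set_multI by blast
      qed
      then show ?thesis by simp
    qed blast
  qed
  then have over: "p_nilpotent_over p (G\<lparr>carrier := K\<rparr>) {\<one>}" by simp
  show ?thesis
    using p_nilpotent_if_normal_subgroup [OF p K(1) _ over, of k] K(5) by blast
qed

end

theorem theorem1p5:
  fixes G :: "('a, 'b) monoid_scheme" and p :: nat and N P :: "'a set"
  assumes "group G" and "finite (carrier G)"
    and "Factorial_Ring.prime p" and "p dvd Coset.order G" and "gcd (Coset.order G) (p - 1) = 1"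
    and "N \<lhd> G" and "p_nilpotent p (G Mod N)"
    and "sylow_subgroup p P (G\<lparr>carrier := N\<rparr>)"
    and "\<And>M. maximal_subgroup M (G\<lparr>carrier := P\<rparr>) \<Longrightarrow>
           partial_Pi_property M (G\<lparr>carrier := normalizer G P\<rparr>)"
    and "partial_Pi_property (derived G P) G"
  shows "p_nilpotent p G"
proof -
  have "finite_group G"
    using assms(1,2) by (simp add: finite_group_def finite_group_axioms_def)
  then show ?thesis
    by (rule finite_group.p_nilpotent_if_partial_Pi [OF _ assms(3,5-10)])
qed

end
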